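(* For any $x\in\mathbb{R}$, $$\lim_{n\to\infty}P_n\!\left(s_n^{\frac{r(r+1)}{2}}D-\log\left(s_n^{-r}\right)+\frac{r-1}{r+1}\log\left(\log\left(s_n^{-r}\right)\right)-\log\left(\frac{2C_r}{r+1}\right)\le x\right)=e^{-e^{-x}}.$$
   Context: Throughout $r\ge 2$ is a fixed integer and $\mathbb{N}=\{1,2,\dots\}$, $\mathbb{N}_0=\mathbb{N}\cup\{0\}$. For $\mathbf{y}\in\mathbb{R}^r_{\ge0}$ put $$a(\mathbf{y}):=\frac{1}{c_r}\prod_{1\le\ell\le j\le r}(y_\ell+\dots+y_j),\qquad c_r:=r!\,(r-1)!\cdots1!.$$ Finite-dimensional irreducible representations $\rho_{\mathbf{k}}$ of $\mathfrak{sl}_{r+1}(\mathbb{C})$ are indexed (up to isomorphism) by $\mathbf{k}\in\mathbb{N}^r$, with $\dim\rho_{\mathbf{k}}=a(\mathbf{k})$. A finite-dimensional representation $\rho$ (up to isomorphism) is $\rho=\bigoplus_{\mathbf{k}\in\mathbb{N}^r}\rho_{\mathbf{k}}^{X_{\mathbf{k}}(\rho)}$ with multiplicities $X_{\mathbf{k}}(\rho)\in\mathbb{N}_0$, all but finitely many zero, and $\dim\rho=\sum_{\mathbf{k}}a(\mathbf{k})X_{\mathbf{k}}(\rho)$. $P_n$ is the uniform probability measure on the (finite) set of $n$-dimensional representations up to isomorphism. $D:=\max_{X_{\mathbf{k}}>0}a(\mathbf{k})$ is the largest dimension among the irreducible representations occurring in the decomposition. For $n\in\mathbb{N}$, $q_n\in(0,1)$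 is the unique solution $q$ of $\sum_{\mathbf{k}\in\mathbb{N}^r}\frac{a(\mathbf{k})q^{a(\mathbf{k})}}{1-q^{a(\mathbf{k})}}=n$, and $s_n>0$ is defined by $q_n=\exp\big(-s_n^{r(r+1)/2}\big)$; one has $s_n\to0$, so the expression in the claim is well defined for all sufficiently large $n$. Finally, $$C_r:=\int_{\mathbf{y}\in\mathbb{R}^r_{>0},\ a(\mathbf{y})\le1}dy_1\cdots dy_r .$$ *)

theory Defs
  imports "HOL-Probability.Probability"
begin

definition c_const :: "nat \<Rightarrow> real" where
  "c_const r = (\<Prod>i = 1..r. fact i)"

text \<open>Elements of \<open>\<real>\<^sup>r\<close> and \<open>\<nat>\<^sup>r\<close> are extensional functions on \<open>{1..r}\<close>.\<close>

definition a_fun :: "nat \<Rightarrow> (nat \<Rightarrow> real) \<Rightarrow> real" where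
  "a_fun r y = (\<Prod>j = 1..r. \<Prod>l = 1..j. \<Sum>i = l..j. y i) / c_const r"

definition weights :: "nat \<Rightarrow> (nat \<Rightarrow> nat) set" where
  "weights r = {1..r} \<rightarrow>\<^sub>E {1..}"

text \<open>The dimension of the irreducible representation \<open>\<rho>\<^sub>k\<close> of \<open>\<ss>\<ll>\<^bsub>r+1\<^esub>(\<complex>)\<close>.\<close>

definition irrep_dim :: "nat \<Rightarrow> (nat \<Rightarrow> nat) \<Rightarrow> real" where
  "irrep_dim r k = a_fun r (\<lambda>i. real (k i))"

text \<open>A finite-dimensional representation of \<open>\<ss>\<ll>\<^bsub>r+1\<^esub>(\<complex>)\<close> up to isomorphism is the finite
  multiset of the indices of its irreducible constituents: \<open>count \<rho> k\<close> is the multiplicity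
  \<open>X\<^sub>k(\<rho>)\<close>, and finiteness of the support is built into the type.\<close>

definition rep_dim :: "nat \<Rightarrow> (nat \<Rightarrow> nat) multiset \<Rightarrow> real" where
  "rep_dim r \<rho> = (\<Sum>k\<in>set_mset \<rho>. irrep_dim r k * real (count \<rho> k))"

definition reps :: "nat \<Rightarrow> nat \<Rightarrow> (nat \<Rightarrow> nat) multiset set" where
  "reps r n = {\<rho>. set_mset \<rho> \<subseteq> weights r \<and> rep_dim r \<rho> = real n}"

definition P_unif :: "nat \<Rightarrow> nat \<Rightarrow> (nat \<Rightarrow> nat) multiset pmf" where
  "P_unif r n = pmf_of_set (reps r n)"

definition D_max :: "nat \<Rightarrow> (nat \<Rightarrow> nat) multiset \<Rightarrow> real" where
  "D_max r \<rho> = Max {irrep_dim r k | k. count \<rho> k > 0}"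

definition q_seq :: "nat \<Rightarrow> nat \<Rightarrow> real" where
  "q_seq r n = (THE q. 0 < q \<and> q < 1 \<and>
     ((\<lambda>k. irrep_dim r k * q powr irrep_dim r k / (1 - q powr irrep_dim r k))
        has_sum real n) (weights r))"

definition s_seq :: "nat \<Rightarrow> nat \<Rightarrow> real" where
  "s_seq r n = (THE s. 0 < s \<and> q_seq r n = exp (- (s powr (real r * (real r + 1) / 2))))"

definition C_const :: "nat \<Rightarrow> real" where
  "C_const r = (LINT y:{y \<in> {1..r} \<rightarrow>\<^sub>E {0<..}. a_fun r y \<le> 1}|(\<Pi>\<^sub>M i\<in>{1..r}. lborel). 1)"

end

theory Submission
  imports Defs "HOL-Real_Asymp.Real_Asymp" "Jordan_Normal_Form.Determinant"
begin

text \<open>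
Write \<open>a(k)\<close> for the dimension of the irreducible representation with index \<open>k\<close>, and put
\<open>\<kappa> = 2/(r+1)\<close> and \<open>\<beta> = s\<^sub>n\<^bsup>r(r+1)/2\<^esup>\<close>, so that \<open>q\<^sub>n = exp(-\<beta>)\<close> and \<open>s\<^sub>n\<^bsup>-r\<^esup> = \<beta>\<^bsup>-\<kappa>\<^esup>\<close>.

A representation of dimension \<open>n\<close> with \<open>D \<le> d\<close> is a multiset of indices \<open>k\<close> with \<open>a(k) \<le> d\<close> and total
weight \<open>n\<close>. Hence \<open>P\<^sub>n(D \<le> d)\<close> is the quotient of two coefficients of \<open>z\<^sup>n\<close>, one in the finite product of
the factors \<open>1/(1 - z\<^bsup>a(k)\<^esup>)\<close> with \<open>a(k) \<le> d\<close> and one in the product over \<open>a(k) \<le> n\<close>. In the Boltzmann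
model the multiplicities are independent geometric variables with parameters \<open>exp(-\<beta> a(k))\<close>; the
coefficient times \<open>exp(-\<beta> n)\<close> times the product of the \<open>1 - exp(-\<beta> a(k))\<close> is then the probability that
the total weight equals \<open>n\<close>. The choice of \<open>q\<^sub>n\<close> says that the expected total weight, over all \<open>k\<close>,
is \<open>n\<close>. Discarding the \<open>k\<close> with \<open>a(k) > d\<close> changes the mean by much less than the standard deviation \<open>\<sigma>\<close>,
and \<open>\<sigma>\<close> itself only by a factor tending to \<open>1\<close>, so by a local limit theorem (\<open>local_limit\<close>,
\<open>truncated_local_limit\<close>) both probabilities are asymptotic to \<open>1/(\<sigma> sqrt(2 \<pi>))\<close>. They cancel, and
\<open>P\<^sub>n(D \<le> d)\<close> is asymptotic to the product of \<open>1 - exp(-\<beta> a(k))\<close> over \<open>d < a(k) \<le> n\<close>, that is, to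
\<open>exp(-\<Sum> exp(-\<beta> a(k)))\<close> with the sum over the same \<open>k\<close>.

It remains to choose \<open>d\<close> such that this sum tends to \<open>exp(-x)\<close> (\<open>tail_sum_tendsto\<close>,
\<open>gumbel_level_asymptotics\<close>). The sum is governed by the number of \<open>k\<close> with \<open>a(k)\<close> in windows of length
of order \<open>1/\<beta>\<close> above \<open>d\<close>, where \<open>\<beta> d\<close> is of order \<open>log(1/\<beta>)\<close>. The leading terms of the counting function
\<open>N(t) \<sim> C t\<^sup>\<kappa>\<close> cancel there up to a factor \<open>1/log(1/\<beta>)\<close>, so an error term with a power saving is wanted.
It comes from comparing \<open>N(t)\<close> with the volume of \<open>a(y) \<le> t\<close>, which scales as \<open>t\<^sup>\<kappa>\<close>
(\<open>card_weights_le\<close>, \<open>card_weights_ge\<close>). That region is unbounded, but \<open>region_subset_product_bound\<close>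
dominates its indicator by a product of integrable functions of one variable, which bounds both the
volume and the part close to the coordinate hyperplanes.

The local limit theorem rests on a bound for the characteristic function of the total weight
(\<open>char_decay\<close>). For \<open>\<bar>\<theta>\<bar> \<le> sqrt \<beta>\<close> the parts of size at most \<open>1/max(\<beta>, \<bar>\<theta>\<bar>)\<close>, whose phases have not
wrapped around yet, are numerous enough. For larger \<open>\<theta>\<close> the binomial coefficients
\<open>(m + r) choose r\<close>, which occur among the dimensions, suffice: their \<open>r\<close>-th difference is \<open>1\<close>, so out of
any \<open>r + 1\<close> consecutive ones at least one has a phase bounded away from \<open>0\<close> in terms of \<open>\<theta>\<close>. The Fourier
integral over \<open>[-\<pi>, \<pi>]\<close> requires that all \<open>a(k)\<close> are integers; this follows from the divisibility of
Vandermonde products by superfactorials (\<open>superfactorial_dvd_vandermonde\<close>).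
\<close>

section \<open>Generating functions of multisets with prescribed total weight\<close>

definition partitions_into :: "('k \<Rightarrow> nat) \<Rightarrow> 'k set \<Rightarrow> nat \<Rightarrow> 'k multiset set" where
  "partitions_into A W n = {\<rho>. set_mset \<rho> \<subseteq> W \<and> (\<Sum>k\<in>#\<rho>. A k) = n}"

text \<open>The number of copies of \<open>k\<close> is forced by the total weight \<open>i\<close> of the
  other elements.\<close>

lemma partitions_into_insert:
  assumes "k \<notin> W" "A k > 0"
  shows "partitions_into A (insert k W) n =
    (\<Union>i\<in>{i. i \<le> n \<and> A k dvd n - i}. (\<lambda>\<rho>. \<rho> + replicate_mset ((n - i) div A k) k) ` partitions_into A W i)"
    (is "?L = ?R")
proof (intro equalityI subsetI)
  fix \<rho> assume "\<rho> \<in> ?L"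
  hence \<rho>: "set_mset \<rho> \<subseteq> insert k W" "(\<Sum>k\<in>#\<rho>. A k) = n" by (auto simp: partitions_into_def)
  define \<sigma> where "\<sigma> = filter_mset (\<lambda>x. x \<noteq> k) \<rho>"
  define i where "i = (\<Sum>k\<in>#\<sigma>. A k)"
  have split: "\<rho> = \<sigma> + replicate_mset (count \<rho> k) k"
    unfolding \<sigma>_def by (rule multiset_eqI) auto
  have n: "n = i + count \<rho> k * A k"
    unfolding \<rho>(2)[symmetric] i_def by (subst split) simp
  have "\<sigma> \<in> partitions_into A W i" using \<rho>(1) by (auto simp: partitions_into_def \<sigma>_def i_def)
  moreover have "(n - i) div A k = count \<rho> k" "i \<le> n" "A k dvd n - i" using n assms by auto
  ultimately show "\<rho> \<in> ?R" using split by (intro UN_I[of i]) auto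
next
  fix \<rho> assume "\<rho> \<in> ?R"
  then obtain i \<sigma> where i: "i \<le> n" "A k dvd n - i" "\<sigma> \<in> partitions_into A W i"
    "\<rho> = \<sigma> + replicate_mset ((n - i) div A k) k" by auto
  thus "\<rho> \<in> ?L" by (auto simp: partitions_into_def split: if_splits)
qed

lemma finite_partitions_into:
  assumes "finite W" "\<And>k. k \<in> W \<Longrightarrow> A k > 0"
  shows "finite (partitions_into A W n)"
  using assms
proof (induction W arbitrary: n rule: finite_induct)
  case empty
  have "partitions_into A {} n \<subseteq> {{#}}" by (auto simp: partitions_into_def)
  thus ?case by (rule finite_subset) simp
next
  case (insert k W)
  have "{i. i \<le> n \<and> A k dvd n - i} \<subseteq> {..n}" by auto
  hence "finite {i. i \<le> n \<and> A k dvd n - i}" by (rule finite_subset) simp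
  thus ?case using insert by (subst partitions_into_insert) auto
qed

text \<open>The pieces of the preceding decomposition are disjoint. Written as a sum over all \<open>i \<le>
  n\<close>, the count is a Cauchy product with the coefficients of \<open>1/(1 - z\<^bsup>A
  k\<^esup>)\<close>.\<close>

lemma card_partitions_into_insert:
  assumes "finite W" "\<And>k. k \<in> W \<Longrightarrow> A k > 0" "k \<notin> W" "A k > 0"
  shows "card (partitions_into A (insert k W) n) =
    (\<Sum>i\<le>n. card (partitions_into A W i) * (if A k dvd n - i then 1 else 0))"
proof -
  define I where "I = {i. i \<le> n \<and> A k dvd n - i}"
  have "I \<subseteq> {..n}" by (auto simp: I_def)
  hence fin: "finite I" by (rule finite_subset) simp
  have "card (partitions_into A (insert k W) n) =
     (\<Sum>i\<in>I. card ((\<lambda>\<rho>. \<rho> + replicate_mset ((n - i) div A k) k) ` partitions_into A W i))"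
    unfolding partitions_into_insert[of k W A, OF assms(3,4)] I_def[symmetric]
  proof (rule card_UN_disjoint[OF fin])
    show "\<forall>i\<in>I. finite ((\<lambda>\<rho>. \<rho> + replicate_mset ((n - i) div A k) k) ` partitions_into A W i)"
      using finite_partitions_into[of W A, OF assms(1,2)] by auto
    have key: "\<rho> = \<sigma>" if "k \<notin># \<rho>" "k \<notin># \<sigma>" "\<rho> + replicate_mset a k = \<sigma> + replicate_mset b k" for \<rho> \<sigma> a b
    proof -
      have "count \<rho> k = 0" "count \<sigma> k = 0" using that by (auto simp: not_in_iff)
      moreover have "count (\<rho> + replicate_mset a k) k = count (\<sigma> + replicate_mset b k) k"
        using that by simp
      ultimately have "a = b" by simp
      thus ?thesis using that by simp
    qed
    show "\<forall>i\<in>I. \<forall>j\<in>I. i \<noteq> j \<longrightarrow>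
      (\<lambda>\<rho>. \<rho> + replicate_mset ((n - i) div A k) k) ` partitions_into A W i \<inter>
      (\<lambda>\<rho>. \<rho> + replicate_mset ((n - j) div A k) k) ` partitions_into A W j = {}"
    proof (intro ballI impI, rule ccontr)
      fix i j assume "i \<noteq> j" and
        "(\<lambda>\<rho>. \<rho> + replicate_mset ((n - i) div A k) k) ` partitions_into A W i \<inter>
         (\<lambda>\<rho>. \<rho> + replicate_mset ((n - j) div A k) k) ` partitions_into A W j \<noteq> {}"
      then obtain \<rho> \<sigma> where *: "\<rho> \<in> partitions_into A W i" "\<sigma> \<in> partitions_into A W j"
        "\<rho> + replicate_mset ((n - i) div A k) k = \<sigma> + replicate_mset ((n - j) div A k) k"
        by blast
      hence "k \<notin># \<rho>" "k \<notin># \<sigma>" using assms(3) by (auto simp: partitions_into_def)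
      hence "\<rho> = \<sigma>" using key * by blast
      thus False using * \<open>i \<noteq> j\<close> by (auto simp: partitions_into_def)
    qed
  qed
  also have "\<dots> = (\<Sum>i\<in>I. card (partitions_into A W i))"
    by (intro sum.cong refl card_image) (auto simp: inj_on_def)
  also have "\<dots> = (\<Sum>i\<le>n. card (partitions_into A W i) * (if A k dvd n - i then 1 else 0))"
    using fin by (intro sum.mono_neutral_cong_left) (auto simp: I_def)
  finally show ?thesis .
qed

lemma sums_dvd_geometric:
  fixes z :: "'a :: {real_normed_field, banach}"
  assumes "norm z < 1" "a > 0"
  shows "(\<lambda>n. if a dvd n then z ^ n else 0) sums (1 / (1 - z ^ a))"
proof -
  have "(\<lambda>j. (z ^ a) ^ j) sums (1 / (1 - z ^ a))"
    using assms by (intro geometric_sums) (simp add: norm_power power_Suc_less_one power_less_one_iff)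
  hence "(\<lambda>j. (\<lambda>n. if a dvd n then z ^ n else 0) (a * j)) sums (1 / (1 - z ^ a))"
    by (simp add: power_mult)
  thus ?thesis using assms
    by (subst (asm) sums_mono_reindex) (auto simp: strict_mono_def)
qed

text \<open>Absolute summability is carried through the induction because the Cauchy product needs it. In
  the step it comes for free: the coefficients are nonnegative, so convergence at the real point
  \<open>\<bar>z\<bar>\<close> is absolute convergence at \<open>z\<close>.\<close>

lemma partitions_into_generating_function:
  fixes z :: complex
  assumes "finite W" "\<And>k. k \<in> W \<Longrightarrow> A k > 0" "norm z < 1"
  shows "summable (\<lambda>n. norm (of_nat (card (partitions_into A W n)) * z ^ n)) \<and>
    (\<lambda>n. of_nat (card (partitions_into A W n)) * z ^ n) sums (\<Prod>k\<in>W. 1 / (1 - z ^ A k))"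
  using assms
proof (induction W arbitrary: z rule: finite_induct)
  case empty
  have "partitions_into A {} n = (if n = 0 then {{#}} else {})" for n
    by (auto simp: partitions_into_def)
  hence eq: "(\<lambda>n. of_nat (card (partitions_into A {} n)) * z ^ n) = (\<lambda>n. if n = 0 then 1 else 0)"
    by (auto intro!: ext)
  have eq': "(\<lambda>n. norm (of_nat (card (partitions_into A {} n)) * z ^ n)) = (\<lambda>n. if n = 0 then 1 else 0)"
    using arg_cong[OF eq, of "\<lambda>f n. norm (f n)"] by (simp add: if_distrib cong: if_cong)
  show ?case unfolding eq eq' using sums_single[of 0 "\<lambda>_. 1 :: complex"] sums_single[of 0 "\<lambda>_. 1 :: real"]
    by (auto dest: sums_summable)
next
  case (insert k W)
  define p where "p = (\<lambda>n. of_nat (card (partitions_into A W n)) :: complex)"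
  define g :: "nat \<Rightarrow> complex" where "g = (\<lambda>n. if A k dvd n then 1 else 0)"
  have conv: "of_nat (card (partitions_into A (insert k W) n)) * z ^ n =
      (\<Sum>i\<le>n. (p i * z ^ i) * (g (n - i) * z ^ (n - i)))" for n and z :: complex
  proof -
    have "of_nat (card (partitions_into A (insert k W) n)) * z ^ n = (\<Sum>i\<le>n. p i * g (n - i) * z ^ n)"
      using insert by (subst card_partitions_into_insert) (auto simp: p_def g_def sum_distrib_right intro!: sum.cong)
    also have "\<dots> = (\<Sum>i\<le>n. (p i * z ^ i) * (g (n - i) * z ^ (n - i)))"
      by (intro sum.cong refl) (simp add: power_add[symmetric])
    finally show ?thesis .
  qed
  have sp: "summable (\<lambda>n. norm (p n * z ^ n))" "(\<lambda>n. p n * z ^ n) sums (\<Prod>k\<in>W. 1 / (1 - z ^ A k))"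
    if "norm z < 1" for z :: complex
    using insert.IH[of z] insert.prems that by (auto simp: p_def)
  have sg: "summable (\<lambda>n. norm (g n * z ^ n))" "(\<lambda>n. g n * z ^ n) sums (1 / (1 - z ^ A k))"
    if "norm z < 1" for z :: complex
  proof -
    show "summable (\<lambda>n. norm (g n * z ^ n))"
      by (rule summable_comparison_test'[of "\<lambda>n. norm z ^ n" 0])
         (use that in \<open>auto simp: g_def norm_power norm_mult\<close>)
    have "(\<lambda>n. g n * z ^ n) = (\<lambda>n. if A k dvd n then z ^ n else 0)"
      by (auto simp: g_def)
    thus "(\<lambda>n. g n * z ^ n) sums (1 / (1 - z ^ A k))"
      using sums_dvd_geometric[OF that, of "A k"] insert.prems by simp
  qed
  have main: "(\<lambda>n. of_nat (card (partitions_into A (insert k W) n)) * z ^ n) sums (\<Prod>k\<in>insert k W. 1 / (1 - z ^ A k))"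
    if "norm z < 1" for z :: complex
    using Cauchy_product_sums[OF sp(1)[OF that] sg(1)[OF that]] insert.hyps
    unfolding conv
    by (simp add: sums_unique[OF sp(2)[OF that], symmetric] sums_unique[OF sg(2)[OF that], symmetric] mult.commute)
  have "summable (\<lambda>n. of_nat (card (partitions_into A (insert k W) n)) * complex_of_real (norm z) ^ n)"
    using main[of "complex_of_real (norm z)"] insert.prems by (auto dest: sums_summable)
  hence "summable (\<lambda>n. complex_of_real (norm (of_nat (card (partitions_into A (insert k W) n)) * z ^ n)))"
    by (simp add: norm_mult norm_power)
  hence "summable (\<lambda>n. norm (of_nat (card (partitions_into A (insert k W) n)) * z ^ n))"
    by (subst (asm) summable_complex_of_real)
  thus ?case using main[of z] insert.prems by blast
qed

lemma integral_cis_period: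
  "(\<integral>\<theta>. indicator {-pi..pi} \<theta> *\<^sub>R cis (of_int j * \<theta>) \<partial>lborel) = (if j = 0 then 2 * pi else 0)"
proof (cases "j = 0")
  case False
  have "(\<integral>\<theta>. indicator {-pi..pi} \<theta> *\<^sub>R cis (of_int j * \<theta>) \<partial>lborel) =
     cis (of_int j * pi) / (\<i> * of_int j) - cis (of_int j * (- pi)) / (\<i> * of_int j)"
  proof (rule integral_FTC_Icc)
    show "((\<lambda>\<theta>. cis (of_int j * \<theta>) / (\<i> * of_int j)) has_vector_derivative cis (of_int j * x)) (at x within {-pi..pi})" for x
      unfolding cis_conv_exp using False
      by (auto intro!: derivative_eq_intros has_vector_derivative_real_field simp: field_simps)
  qed (auto intro!: continuous_intros simp: cis_conv_exp)
  also have "cis (of_int j * (- pi)) = cis (of_int j * pi)"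
    by (auto simp: complex_eq_iff sin_zero_iff_int2)
  finally show ?thesis using False by simp
qed (simp add: scaleR_conv_of_real)

text \<open>Cauchy's coefficient formula on the circle of radius \<open>q\<close>; absolute convergence
  there allows termwise integration.\<close>

lemma partitions_into_eq_integral:
  assumes "finite W" "\<And>k. k \<in> W \<Longrightarrow> A k > 0" "0 < q" "q < 1"
  shows "(\<integral>\<theta>. indicator {-pi..pi} \<theta> *\<^sub>R ((\<Prod>k\<in>W. 1 / (1 - (of_real q * cis \<theta>) ^ A k)) * cis (- (real n * \<theta>))) \<partial>lborel)
    = 2 * pi * card (partitions_into A W n) * q ^ n"
proof -
  define p where "p m = real (card (partitions_into A W m))" for m
  define f where "f m \<theta> = indicator {-pi..pi} \<theta> *\<^sub>R (of_real (p m * q ^ m) * cis (of_int (int m - int n) * \<theta>))" for m \<theta>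
  have nz: "norm (of_real q * cis \<theta>) < 1" for \<theta> using assms by (simp add: norm_mult)
  have gf: "summable (\<lambda>m. p m * q ^ m)"
  proof -
    have "summable (\<lambda>n. norm (of_nat (card (partitions_into A W n)) * complex_of_real q ^ n))"
      using partitions_into_generating_function[of W A "complex_of_real q"] assms by simp
    thus ?thesis using assms by (simp add: norm_mult norm_power p_def)
  qed
  have f_sums: "(\<lambda>m. f m \<theta>) sums (indicator {-pi..pi} \<theta> *\<^sub>R ((\<Prod>k\<in>W. 1 / (1 - (of_real q * cis \<theta>) ^ A k)) * cis (- (real n * \<theta>))))" for \<theta>
  proof -
    have "(\<lambda>m. of_nat (card (partitions_into A W m)) * (of_real q * cis \<theta>) ^ m) sums
        (\<Prod>k\<in>W. 1 / (1 - (of_real q * cis \<theta>) ^ A k))"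
      using partitions_into_generating_function[of W A, OF assms(1,2) nz] by blast
    hence "(\<lambda>m. indicator {-pi..pi} \<theta> *\<^sub>R ((of_nat (card (partitions_into A W m)) * (of_real q * cis \<theta>) ^ m) * cis (- (real n * \<theta>)))) sums
      (indicator {-pi..pi} \<theta> *\<^sub>R ((\<Prod>k\<in>W. 1 / (1 - (of_real q * cis \<theta>) ^ A k)) * cis (- (real n * \<theta>))))"
      by (intro sums_scaleR_right sums_mult2)
    moreover have "(of_real q * cis \<theta>) ^ m * cis (- (real n * \<theta>)) = of_real (q ^ m) * cis (of_int (int m - int n) * \<theta>)" for m
      by (simp add: power_mult_distrib Complex.DeMoivre cis_mult left_diff_distrib del: of_int_diff) (simp add: algebra_simps)
    ultimately show ?thesis by (simp add: f_def p_def mult.assoc)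
  qed
  have normf: "norm (f m \<theta>) \<le> indicator {-pi..pi} \<theta> * (p m * q ^ m)" for m \<theta>
    using assms by (simp add: f_def norm_mult norm_power p_def abs_mult)
  have int: "integrable lborel (f m)" for m
    unfolding f_def by (rule borel_integrable_compact) (auto intro!: continuous_intros simp: cis_conv_exp)
  have "(\<integral>\<theta>. (\<Sum>m. f m \<theta>) \<partial>lborel) = (\<Sum>m. \<integral>\<theta>. f m \<theta> \<partial>lborel)"
  proof (rule integral_suminf[OF int])
    show "AE \<theta> in lborel. summable (\<lambda>m. norm (f m \<theta>))"
    proof (rule AE_I2)
      fix \<theta> show "summable (\<lambda>m. norm (f m \<theta>))"
        by (rule summable_comparison_test'[OF summable_mult[OF gf, of "indicator {-pi..pi} \<theta>"], of 0])
           (use normf in auto)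
    qed
    have "norm (\<integral>\<theta>. norm (f m \<theta>) \<partial>lborel) \<le> 2 * pi * (p m * q ^ m)" for m
    proof -
      have "(\<integral>\<theta>. norm (f m \<theta>) \<partial>lborel) \<le> (\<integral>\<theta>. indicator {-pi..pi} \<theta> * (p m * q ^ m) \<partial>lborel)"
        by (intro integral_mono integrable_norm int normf) auto
      thus ?thesis by simp
    qed
    thus "summable (\<lambda>m. \<integral>\<theta>. norm (f m \<theta>) \<partial>lborel)"
      by (intro summable_comparison_test'[OF summable_mult[OF gf, of "2 * pi"], of 0]) auto
  qed
  also have "(\<lambda>m. \<integral>\<theta>. f m \<theta> \<partial>lborel) = (\<lambda>m. if m = n then of_real (2 * pi * p n * q ^ n) else 0)"
  proof
    fix m
    have "(\<integral>\<theta>. f m \<theta> \<partial>lborel) = (\<integral>\<theta>. of_real (p m * q ^ m) * (indicator {-pi..pi} \<theta> *\<^sub>R cis (of_int (int m - int n) * \<theta>)) \<partial>lborel)"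
      by (simp add: f_def)
    also have "\<dots> = of_real (p m * q ^ m) * (if int m - int n = 0 then 2 * pi else 0)"
      by (subst integral_mult_right_zero, subst integral_cis_period) simp
    finally show "(\<integral>\<theta>. f m \<theta> \<partial>lborel) = (if m = n then of_real (2 * pi * p n * q ^ n) else 0)" by simp
  qed
  also have "(\<Sum>m. if m = n then complex_of_real (2 * pi * p n * q ^ n) else 0) = of_real (2 * pi * p n * q ^ n)"
    using sums_single[of n "\<lambda>_. complex_of_real (2 * pi * p n * q ^ n)"] by (simp add: sums_iff)
  finally show ?thesis unfolding sums_unique[OF f_sums, symmetric] by (simp add: p_def)
qed

text \<open>In the Boltzmann model at inverse temperature \<open>\<beta>\<close> the multiplicity of a part
  of size \<open>a\<close> takes the value \<open>j\<close> with probability \<open>(1 - w)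
  w\<^sup>j\<close>, where \<open>w = exp (- \<beta> * a)\<close>. This is its mean \<open>w / (1
  - w)\<close>.\<close>

definition mean_mult :: "real \<Rightarrow> real \<Rightarrow> real" where
  "mean_mult \<beta> a = 1 / (exp (\<beta> * a) - 1)"

text \<open>A geometric variable of mean \<open>m\<close> has characteristic function \<open>1 / (1 - m (cis
  x - 1))\<close>, and multiplicities of different parts are independent.\<close>

definition boltzmann_char :: "('k \<Rightarrow> nat) \<Rightarrow> real \<Rightarrow> 'k set \<Rightarrow> real \<Rightarrow> complex" where
  "boltzmann_char A \<beta> W \<theta> = (\<Prod>k\<in>W. 1 / (1 - of_real (mean_mult \<beta> (A k)) * (cis (A k * \<theta>) - 1)))"

text \<open>Fourier inversion for the Boltzmann model: the right-hand side is \<open>2 * pi\<close> times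
  the probability that the total weight equals \<open>n\<close>.\<close>

lemma partitions_into_eq_boltzmann_integral:
  assumes "finite W" "\<And>k. k \<in> W \<Longrightarrow> A k > 0" "\<beta> > 0"
  shows "(\<integral>\<theta>. indicator {-pi..pi} \<theta> *\<^sub>R (boltzmann_char A \<beta> W \<theta> * cis (- (real n * \<theta>))) \<partial>lborel)
    = 2 * pi * card (partitions_into A W n) * exp (- \<beta> * n) * (\<Prod>k\<in>W. 1 - exp (- \<beta> * A k))"
proof -
  define q where "q = exp (- \<beta>)"
  have q: "0 < q" "q < 1" using assms by (auto simp: q_def)
  define Q where "Q = (\<Prod>k\<in>W. 1 - exp (- \<beta> * A k))"
  have eq: "boltzmann_char A \<beta> W \<theta> = of_real Q * (\<Prod>k\<in>W. 1 / (1 - (of_real q * cis \<theta>) ^ A k))" for \<theta>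
    unfolding boltzmann_char_def Q_def of_real_prod prod.distrib[symmetric]
  proof (rule prod.cong[OF refl])
    fix k assume k: "k \<in> W"
    define w where "w = exp (- \<beta> * A k)"
    have w: "0 < w" "w < 1" using assms(2)[OF k] assms(3) by (auto simp: w_def)
    have "q ^ A k = w" by (simp add: q_def w_def exp_of_nat_mult[symmetric] mult.commute)
    hence pw: "(of_real q * cis \<theta>) ^ A k = of_real w * cis (A k * \<theta>)"
      by (simp add: power_mult_distrib Complex.DeMoivre flip: of_real_power)
    have "mean_mult \<beta> (A k) = w / (1 - w)"
      using w by (simp add: mean_mult_def w_def exp_minus field_simps)
    moreover have "1 - complex_of_real w \<noteq> 0"
      using w by (metis of_real_1 of_real_diff of_real_eq_0_iff diff_gt_0_iff_gt less_irrefl)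
    hence "1 - of_real (w / (1 - w)) * (c - 1) = (1 - of_real w * c) / (of_real (1 - w))" for c :: complex
      by (simp add: divide_simps) (simp add: algebra_simps)
    ultimately have "1 - of_real (mean_mult \<beta> (A k)) * (cis (A k * \<theta>) - 1) =
        (1 - of_real w * cis (A k * \<theta>)) / (of_real (1 - w) :: complex)" by simp
    thus "1 / (1 - of_real (mean_mult \<beta> (A k)) * (cis (A k * \<theta>) - 1)) =
        of_real (1 - exp (- \<beta> * A k)) * (1 / (1 - (of_real q * cis \<theta>) ^ A k))"
      unfolding pw by (simp add: w_def)
  qed
  have "(\<integral>\<theta>. indicator {-pi..pi} \<theta> *\<^sub>R (boltzmann_char A \<beta> W \<theta> * cis (- (real n * \<theta>))) \<partial>lborel) =
      (\<integral>\<theta>. of_real Q * (indicator {-pi..pi} \<theta> *\<^sub>R ((\<Prod>k\<in>W. 1 / (1 - (of_real q * cis \<theta>) ^ A k)) * cis (- (real n * \<theta>)))) \<partial>lborel)"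
    unfolding eq by (simp add: mult_ac)
  also have "\<dots> = of_real Q * (2 * pi * card (partitions_into A W n) * q ^ n)"
    by (subst integral_mult_right_zero, subst partitions_into_eq_integral[OF assms(1,2) q]) auto
  also have "q ^ n = exp (- \<beta> * n)" by (simp add: q_def exp_of_nat_mult[symmetric] mult.commute)
  finally show ?thesis by (simp add: Q_def)
qed

section \<open>Moments and characteristic functions of geometric multiplicities\<close>

lemma four_exp_quarter: "1 + x \<le> 4 * exp (x / 4 :: real)"
  using exp_ge_add_one_self[of "x / 4"] by linarith

text \<open>All bounds express \<open>x \<le> exp x - 1\<close> or \<open>1 - exp (- x) \<le> x\<close> in
  terms of \<open>m = 1 / (exp x - 1)\<close>. They are stated for the scale-free quantity
  \<open>x * m\<close>, which stays bounded however small \<open>x\<close> is.\<close>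

lemma mean_mult_bounds:
  assumes "\<beta> * a > 0"
  defines "m \<equiv> mean_mult \<beta> a" and "x \<equiv> \<beta> * a"
  shows "m > 0" "x * m \<le> 1" "1 \<le> x * (m + 1)" "x * (m + 1) \<le> 1 + x" "m = exp (- x) * (m + 1)"
proof -
  have e: "exp x - 1 \<ge> x" using exp_ge_add_one_self[of x] by linarith
  have x: "x > 0" using assms(1) by (simp add: x_def)
  have m: "m = 1 / (exp x - 1)" by (simp add: m_def mean_mult_def x_def)
  show "m > 0" using e x by (simp add: m)
  show xm: "x * m \<le> 1" using e x by (simp add: m field_simps)
  have "m + 1 = exp x / (exp x - 1)" using e x by (simp add: m field_simps)
  thus eq: "m = exp (- x) * (m + 1)" using e x by (simp add: m exp_minus field_simps)
  show "x * (m + 1) \<le> 1 + x" using xm by (simp add: algebra_simps)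
  have "1 - exp (- x) \<le> x" using exp_ge_add_one_self[of "- x"] by simp
  hence "(1 - exp (- x)) * (m + 1) \<le> x * (m + 1)" using \<open>m > 0\<close> by (intro mult_right_mono) auto
  thus "1 \<le> x * (m + 1)" using eq by (simp add: algebra_simps)
qed

lemma mean_mult_le:
  assumes "\<beta> > 0" "a > 0"
  shows "a * mean_mult \<beta> a \<le> 4 / \<beta> * exp (- (3 / 4) * (\<beta> * a))"
proof -
  define m x where "m = mean_mult \<beta> a" and "x = \<beta> * a"
  have x: "\<beta> * a > 0" using assms by simp
  have "x * m = exp (- x) * (x * (m + 1))"
    using mean_mult_bounds(5)[OF x] by (simp add: m_def x_def)
  also have "\<dots> \<le> exp (- x) * (4 * exp (x / 4))"
    using mean_mult_bounds(4)[OF x] four_exp_quarter[of x] by (intro mult_left_mono) (auto simp: m_def x_def)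
  also have "\<dots> = 4 * exp (- (3 / 4) * x)" by (simp add: exp_add[symmetric])
  finally show ?thesis using assms by (simp add: m_def x_def field_simps)
qed

text \<open>The variance of a geometric variable of mean \<open>m\<close> is \<open>m * (m + 1)\<close>.\<close>

definition var_mult :: "real \<Rightarrow> real \<Rightarrow> real" where
  "var_mult \<beta> a = mean_mult \<beta> a * (mean_mult \<beta> a + 1)"

lemma var_mult_nonneg: "\<beta> * a > 0 \<Longrightarrow> var_mult \<beta> a \<ge> 0"
  using mean_mult_bounds(1)[of \<beta> a] by (simp add: var_mult_def)

text \<open>The variance equals \<open>exp (- x) * (m + 1)\<^sup>2\<close> with \<open>x = \<beta> *
  a\<close>, and \<open>x * (m + 1)\<close> lies between \<open>1\<close> and \<open>1 +
  x\<close>. A quarter of the exponential decay is spent on absorbing each factor \<open>1 +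
  x\<close>; the lower bound uses \<open>exp (- 1) \<ge> 1/3\<close>.\<close>

lemma var_mult_bounds:
  assumes "\<beta> > 0" "a > 0"
  shows "a\<^sup>2 * var_mult \<beta> a \<le> 16 / \<beta>\<^sup>2 * exp (- (\<beta> * a) / 2)"
    and "a ^ 3 * var_mult \<beta> a \<le> 64 / \<beta> ^ 3 * exp (- (\<beta> * a) / 4)"
    and "\<beta> * a \<le> 1 \<Longrightarrow> a\<^sup>2 * var_mult \<beta> a \<ge> 1 / (3 * \<beta>\<^sup>2)"
proof -
  define m x where "m = mean_mult \<beta> a" and "x = \<beta> * a"
  have x: "\<beta> * a > 0" using assms by simp
  have eq: "x\<^sup>2 * var_mult \<beta> a = exp (- x) * (x * (m + 1))\<^sup>2"
  proof -
    have "x\<^sup>2 * var_mult \<beta> a = x\<^sup>2 * (m * (m + 1))" by (simp add: var_mult_def m_def)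
    also have "\<dots> = x\<^sup>2 * (exp (- x) * (m + 1) * (m + 1))"
      using mean_mult_bounds(5)[OF x] by (simp add: m_def x_def)
    finally show ?thesis by (simp add: power2_eq_square mult_ac)
  qed
  have "(x * (m + 1))\<^sup>2 \<le> (4 * exp (x / 4))\<^sup>2"
    using mean_mult_bounds(3,4)[OF x] four_exp_quarter[of x]
    by (intro power_mono) (auto simp: m_def x_def)
  hence "x\<^sup>2 * var_mult \<beta> a \<le> exp (- x) * (4 * exp (x / 4))\<^sup>2"
    unfolding eq by (intro mult_left_mono) auto
  also have "\<dots> = 16 * exp (- x / 2)"
    by (simp add: power_mult_distrib exp_double[symmetric] exp_add[symmetric])
  finally have up: "x\<^sup>2 * var_mult \<beta> a \<le> 16 * exp (- x / 2)" .
  thus "a\<^sup>2 * var_mult \<beta> a \<le> 16 / \<beta>\<^sup>2 * exp (- (\<beta> * a) / 2)"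
    using assms by (simp add: x_def field_simps power_mult_distrib)
  have "x * (x\<^sup>2 * var_mult \<beta> a) \<le> (4 * exp (x / 4)) * (16 * exp (- x / 2))"
    by (rule mult_mono[OF _ up])
       (use four_exp_quarter[of x] x var_mult_nonneg[OF x] in \<open>auto simp: x_def\<close>)
  also have "\<dots> = 64 * exp (- x / 4)" by (simp add: exp_add[symmetric])
  finally show "a ^ 3 * var_mult \<beta> a \<le> 64 / \<beta> ^ 3 * exp (- (\<beta> * a) / 4)"
    using assms by (simp add: x_def field_simps power_mult_distrib power2_eq_square power3_eq_cube)
  assume "\<beta> * a \<le> 1"
  hence "exp (- x) \<ge> exp (- 1)" by (simp add: x_def)
  moreover have "exp (- 1) \<ge> (1 / 3 :: real)"
    using exp_le by (simp add: exp_minus field_simps)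
  moreover have "(x * (m + 1))\<^sup>2 \<ge> 1"
    using mean_mult_bounds(3)[OF x] by (simp add: m_def x_def)
  ultimately have "1 / 3 * 1 \<le> exp (- x) * (x * (m + 1))\<^sup>2"
    by (intro mult_mono order.trans[of "1 / 3" "exp (- 1)" "exp (- x)"]) auto
  thus "a\<^sup>2 * var_mult \<beta> a \<ge> 1 / (3 * \<beta>\<^sup>2)"
    using assms unfolding eq[symmetric] by (simp add: x_def field_simps power_mult_distrib)
qed

lemma norm_cis_minus_1: "(norm (cis x - 1))\<^sup>2 = 2 * (1 - cos x)"
proof -
  have "(norm (cis x - 1))\<^sup>2 = (cos x - 1)\<^sup>2 + (sin x)\<^sup>2" by (simp add: cmod_power2)
  also have "\<dots> = 2 * (1 - cos x)" using sin_cos_squared_add[of x] by (simp add: power2_eq_square algebra_simps)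
  finally show ?thesis .
qed

lemma norm_cis_minus_1_le: "norm (cis x - 1) \<le> \<bar>x\<bar>"
  using iexp_approx1[of x 0] by (simp add: cis_conv_exp)

text \<open>The reciprocal of the centred characteristic function is \<open>cis (m * x)\<close> times a
  polynomial in \<open>cis x\<close>, so Taylor expansion of \<open>cis\<close> is all that is
  needed: the linear terms cancel and the quadratic ones add up to half the variance. Only
  \<open>m * \<bar>x\<bar>\<close> has to be small. For the largest parts \<open>x\<close> itself
  is large, but then \<open>m\<close> is tiny, and the error bound carries the factor
  \<open>m\<close>.\<close>

lemma centered_char_inverse_expansion:
  assumes "m \<ge> 0" "m * \<bar>x\<bar> \<le> 1"
  shows "norm (cis (m * x) * (1 - of_real m * (cis x - 1)) - of_real (1 + m * (m + 1) * x\<^sup>2 / 2))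
    \<le> 2 * (m * (m + 1)\<^sup>2 * \<bar>x\<bar> ^ 3)"
proof -
  define y where "y = m * x"
  define P where "P = 1 + \<i> * of_real y - of_real (y\<^sup>2 / 2)"
  define r1 where "r1 = cis y - P"
  define r2 where "r2 = cis x - (1 + \<i> * of_real x - of_real (x\<^sup>2 / 2))"
  define Q where "Q = 1 - of_real m * (cis x - 1)"
  define z where "z = \<bar>x\<bar>"
  have z: "z \<ge> 0" "m * z \<le> 1" "\<bar>y\<bar> = m * z" using assms by (auto simp: z_def y_def abs_mult)
  have "norm r1 \<le> \<bar>y\<bar> ^ 3 / 6"
    using iexp_approx1[of y 2] by (simp add: r1_def P_def cis_conv_exp eval_nat_numeral numeral_3_eq_3 power2_eq_square algebra_simps)
  hence r1: "norm r1 \<le> m ^ 3 * z ^ 3 / 6" by (simp add: z power_mult_distrib)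
  have r2: "norm r2 \<le> z ^ 3 / 6"
    using iexp_approx1[of x 2] by (simp add: r2_def z_def cis_conv_exp eval_nat_numeral numeral_3_eq_3 power2_eq_square algebra_simps)
  have nP: "norm P \<le> 5 / 2"
  proof -
    have "norm P \<le> norm (1 + \<i> * of_real y) + norm (of_real (y\<^sup>2 / 2) :: complex)"
      unfolding P_def by (rule norm_triangle_ineq4)
    also have "norm (1 + \<i> * of_real y) \<le> 1 + \<bar>y\<bar>"
      by (rule order.trans[OF norm_triangle_ineq]) (simp add: norm_mult)
    also have "norm (of_real (y\<^sup>2 / 2) :: complex) = y\<^sup>2 / 2" by (subst norm_of_real) simp
    also have "y\<^sup>2 \<le> 1" using z by (simp add: abs_square_le_1)
    finally show ?thesis using z by simp
  qed
  have nQ: "norm Q \<le> 2"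
  proof -
    have "norm Q \<le> 1 + norm (of_real m * (cis x - 1))"
      unfolding Q_def by (rule order.trans[OF norm_triangle_ineq4]) simp
    also have "\<dots> \<le> 1 + m * z"
      using norm_cis_minus_1_le[of x] assms by (simp add: norm_mult z_def mult_left_mono)
    finally show ?thesis using z by simp
  qed
  define R where "R = \<i> * of_real (y * m * x\<^sup>2 / 2 + y ^ 3 / 2) - of_real (y\<^sup>2 * m * x\<^sup>2 / 4)"
  have id: "cis y * Q - of_real (1 + m * (m + 1) * x\<^sup>2 / 2) = R - P * (of_real m * r2) + r1 * Q"
    unfolding r1_def R_def P_def Q_def r2_def y_def
    by (simp add: algebra_simps power2_eq_square power3_eq_cube add_divide_distrib) (simp add: field_simps)
  have "norm R \<le> norm (\<i> * of_real (y * m * x\<^sup>2 / 2 + y ^ 3 / 2)) + norm (of_real (y\<^sup>2 * m * x\<^sup>2 / 4) :: complex)"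
    unfolding R_def by (rule norm_triangle_ineq4)
  also have "norm (\<i> * of_real (y * m * x\<^sup>2 / 2 + y ^ 3 / 2)) = \<bar>y * m * x\<^sup>2 / 2 + y ^ 3 / 2\<bar>"
    by (simp only: norm_mult norm_ii norm_of_real) simp
  also have "\<dots> \<le> \<bar>y\<bar> * m * x\<^sup>2 / 2 + \<bar>y\<bar> ^ 3 / 2"
    by (rule order.trans[OF abs_triangle_ineq]) (use assms in \<open>simp add: abs_mult power_abs\<close>)
  also have "norm (of_real (y\<^sup>2 * m * x\<^sup>2 / 4) :: complex) = y\<^sup>2 * m * x\<^sup>2 / 4"
    using assms by (subst norm_of_real) simp
  also have "y\<^sup>2 = (m * z)\<^sup>2" using z by (metis power2_abs)
  also have "x\<^sup>2 = z\<^sup>2" by (simp add: z_def)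
  finally have nR: "norm R \<le> m\<^sup>2 * z ^ 3 / 2 + m ^ 3 * z ^ 3 / 2 + (m * z) * (m\<^sup>2 * z ^ 3) / 4"
    by (simp add: z power2_eq_square power3_eq_cube mult_ac)
  have "(m * z) * (m\<^sup>2 * z ^ 3) \<le> 1 * (m\<^sup>2 * z ^ 3)" using z assms by (intro mult_right_mono) auto
  hence nR: "norm R \<le> 3 / 4 * (m\<^sup>2 * z ^ 3) + m ^ 3 * z ^ 3 / 2" using nR by simp
  have "norm (R - P * (of_real m * r2) + r1 * Q) \<le> norm R + norm P * (m * norm r2) + norm r1 * norm Q"
    by (rule order.trans[OF norm_triangle_ineq], rule add_mono, rule order.trans[OF norm_triangle_ineq4])
       (use assms in \<open>auto simp: norm_mult\<close>)
  also have "\<dots> \<le> (3 / 4 * (m\<^sup>2 * z ^ 3) + m ^ 3 * z ^ 3 / 2) + 5 / 2 * (m * (z ^ 3 / 6)) + (m ^ 3 * z ^ 3 / 6) * 2"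
    using nR nP nQ r1 r2 assms z by (intro add_mono mult_mono) auto
  also have "\<dots> \<le> 2 * (m * z ^ 3) + 4 * (m\<^sup>2 * z ^ 3) + 2 * (m ^ 3 * z ^ 3)"
  proof -
    have "0 \<le> m * z ^ 3" "0 \<le> m\<^sup>2 * z ^ 3" "0 \<le> m ^ 3 * z ^ 3" using assms z by auto
    thus ?thesis by simp
  qed
  also have "\<dots> = 2 * (m * (m + 1)\<^sup>2 * z ^ 3)"
    by (simp add: power2_eq_square power3_eq_cube algebra_simps)
  finally show ?thesis unfolding id[symmetric] by (simp add: y_def Q_def z_def)
qed

lemma norm_prod_minus_1_le_exp:
  fixes z :: "'k \<Rightarrow> complex"
  shows "norm ((\<Prod>k\<in>S. 1 + z k) - 1) \<le> exp (\<Sum>k\<in>S. norm (z k)) - 1"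
proof (cases "finite S")
  case True
  thus ?thesis
  proof (induction S rule: finite_induct)
    case (insert k S)
    define p where "p = (\<Prod>k\<in>S. 1 + z k)"
    define s where "s = (\<Sum>k\<in>S. norm (z k))"
    have IH: "norm (p - 1) \<le> exp s - 1" using insert.IH by (simp add: p_def s_def)
    have "(1 + z k) * p - 1 = (1 + z k) * (p - 1) + z k" by (simp add: algebra_simps)
    hence "norm ((1 + z k) * p - 1) \<le> norm (1 + z k) * norm (p - 1) + norm (z k)"
      by (metis norm_mult norm_triangle_ineq)
    also have "\<dots> \<le> (1 + norm (z k)) * (exp s - 1) + norm (z k)"
      using IH norm_triangle_ineq[of 1 "z k"] by (intro add_mono mult_mono) auto
    also have "\<dots> = (1 + norm (z k)) * exp s - 1" by (simp add: algebra_simps)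
    also have "\<dots> \<le> exp (norm (z k)) * exp s - 1"
      using exp_ge_add_one_self[of "norm (z k)"] by (simp add: mult_right_mono)
    finally show ?case using insert.hyps by (simp add: p_def s_def exp_add)
  qed simp
qed simp

text \<open>Up to \<open>\<bar>x\<bar> = 1\<close> this is Taylor's formula. Beyond that, monotonicity gives
  \<open>1 - cos x \<ge> 1 - cos 1 \<ge> 1/4\<close>, while \<open>x\<^sup>2 \<le> 10\<close>.\<close>

lemma one_minus_cos_ge:
  fixes x :: real
  assumes "\<bar>x\<bar> \<le> pi"
  shows "1 - cos x \<ge> x\<^sup>2 / 40"
proof -
  have small: "1 - cos y \<ge> y\<^sup>2 / 4" if "\<bar>y\<bar> \<le> 1" for y :: real
  proof -
    have "norm (cis y - (1 + \<i> * of_real y - of_real (y\<^sup>2 / 2))) \<le> \<bar>y\<bar> ^ 3 / 6"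
      using iexp_approx1[of y 2] by (simp add: cis_conv_exp eval_nat_numeral numeral_3_eq_3 power2_eq_square algebra_simps)
    moreover have "\<bar>Re (cis y - (1 + \<i> * of_real y - of_real (y\<^sup>2 / 2)))\<bar> \<le>
        norm (cis y - (1 + \<i> * of_real y - of_real (y\<^sup>2 / 2)))" by (rule abs_Re_le_cmod)
    moreover have "Re (cis y - (1 + \<i> * of_real y - of_real (y\<^sup>2 / 2))) = cos y - 1 + y\<^sup>2 / 2"
      by simp
    ultimately have "\<bar>cos y - 1 + y\<^sup>2 / 2\<bar> \<le> \<bar>y\<bar> ^ 3 / 6" by linarith
    moreover have "\<bar>y\<bar> ^ 3 \<le> y\<^sup>2"
      using mult_right_mono[OF that, of "y\<^sup>2"] by (simp add: power3_eq_cube power2_eq_square)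
    ultimately show ?thesis by linarith
  qed
  show ?thesis
  proof (cases "\<bar>x\<bar> \<le> 1")
    case True
    thus ?thesis using small[of x] zero_le_power2[of x] by linarith
  next
    case False
    have "cos x = cos \<bar>x\<bar>" by simp
    also have "\<dots> \<le> cos 1" using False assms by (intro cos_monotone_0_pi_le) auto
    also have "\<dots> \<le> 3 / 4" using small[of 1] by simp
    finally have "1 - cos x \<ge> 1 / 4" by simp
    moreover have "x\<^sup>2 \<le> 10"
    proof -
      have "pi \<le> 3.15" using pi_approx(2) by simp
      hence "\<bar>x\<bar> \<le> 3.15" using assms by linarith
      hence "\<bar>x\<bar>\<^sup>2 \<le> 3.15\<^sup>2" by (intro power_mono) auto
      thus ?thesis by (simp add: power2_eq_square)
    qed
    ultimately show ?thesis by simp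
  qed
qed

section \<open>Families of dimensions with a power law counting function\<close>

lemma integral_exp_minus_atLeast:
  assumes "c \<ge> 0"
  shows "has_bochner_integral lborel (\<lambda>u. indicator {0..} u * (exp (- u) * indicator {c..} u)) (exp (- c :: real))"
proof -
  have "(\<integral>\<^sup>+u. ennreal (indicator {0..} u * (exp (- u) * indicator {c..} u)) \<partial>lborel) =
      (\<integral>\<^sup>+u. ennreal (indicator {c..} u * exp (- u)) \<partial>lborel)"
    using assms by (intro nn_integral_cong) (auto simp: indicator_def)
  also have "\<dots> = ennreal (exp (- c))"
    using has_integral_exp_minus_to_infinity[of 1 c]
    by (intro nn_integral_has_integral_lebesgue) auto
  finally show ?thesis
    by (intro has_bochner_integral_nn_integral) auto
qed

text \<open>Since \<open>exp (- c)\<close> is the integral of \<open>exp (- u)\<close> over \<open>u \<ge>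
  c\<close>, a sum of exponentials is an integral of the counting function. This is how
  information on the number of parts enters.\<close>

lemma layer_cake_exp:
  fixes f :: "'k \<Rightarrow> real"
  assumes "finite S" "\<And>k. k \<in> S \<Longrightarrow> f k \<ge> 0"
  shows "has_bochner_integral lborel (\<lambda>u. indicator {0..} u * (exp (- u) * card {k \<in> S. f k \<le> u}))
    (\<Sum>k\<in>S. exp (- f k))"
proof -
  have "has_bochner_integral lborel (\<lambda>u. \<Sum>k\<in>S. indicator {0..} u * (exp (- u) * indicator {f k..} u))
      (\<Sum>k\<in>S. exp (- f k))"
    using assms by (intro has_bochner_integral_sum integral_exp_minus_atLeast)
  also have "(\<lambda>u. \<Sum>k\<in>S. indicator {0..} u * (exp (- u) * indicator {f k..} u)) =
      (\<lambda>u. indicator {0..} u * (exp (- u) * card {k \<in> S. f k \<le> u}))"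
  proof
    fix u
    have "real (card {k \<in> S. f k \<le> u}) = (\<Sum>k\<in>S. indicator {f k..} u)"
      using assms by (simp add: indicator_def sum.If_cases Int_def)
    thus "(\<Sum>k\<in>S. indicator {0..} u * (exp (- u) * indicator {f k..} u)) =
       indicator {0..} u * (exp (- u) * card {k \<in> S. f k \<le> u})"
      by (simp add: sum_distrib_left)
  qed
  finally show ?thesis .
qed

lemma integral_power_exp_Ici:
  "has_bochner_integral lborel (\<lambda>u::real. indicator {0..} u * (exp (- u) * u ^ k)) (fact k)"
proof -
  have "(\<integral>\<^sup>+u. ennreal (indicator {0..} u * (exp (- u) * u ^ k)) \<partial>lborel) =
      (\<integral>\<^sup>+u. ennreal (u ^ k * exp (- u)) * indicator {0..} u \<partial>lborel)"
    by (intro nn_integral_cong) (auto simp: indicator_def mult.commute)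
  also have "\<dots> = ennreal (fact k)" using nn_intergal_power_times_exp_Ici[of k] by simp
  finally show ?thesis
    by (intro has_bochner_integral_nn_integral) (auto simp: indicator_def)
qed

lemma powr_le_one_plus:
  fixes u p :: real
  assumes "u \<ge> 0" "0 < p" "p \<le> 1"
  shows "u powr p \<le> 1 + u"
proof (cases "u \<le> 1")
  case True
  hence "u powr p \<le> 1" using assms by (intro powr_le1) auto
  thus ?thesis using assms by simp
next
  case False
  hence "u powr p \<le> u powr 1" using assms by (intro powr_mono) auto
  thus ?thesis using assms by simp
qed

text \<open>A concave function lies below its tangents. For \<open>t powr p\<close> this is the weighted
  arithmetic-geometric mean inequality for \<open>b / a\<close> and \<open>1\<close>.\<close>

lemma powr_concave_tangent:
  fixes a b p :: real
  assumes "a > 0" "b > 0" "0 < p" "p \<le> 1"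
  shows "b powr p - a powr p \<le> p * a powr (p - 1) * (b - a)"
proof -
  have "(b / a) powr p \<le> 1 + p * (b / a - 1)"
  proof -
    have "(1 + (b / a - 1)) powr p \<le> 1 + p * (b / a - 1)"
      using Youngs_inequality_0[of p "1 - p" "b / a" 1] assms by (simp add: algebra_simps)
    thus ?thesis by simp
  qed
  hence "a powr p * (b / a) powr p \<le> a powr p * (1 + p * (b / a - 1))"
    using assms by (intro mult_left_mono) auto
  moreover have "a powr p * (b / a) powr p = b powr p" using assms by (simp add: powr_divide)
  moreover have "a powr p * (1 + p * (b / a - 1)) = a powr p + p * a powr (p - 1) * (b - a)"
    using assms by (simp add: powr_diff field_simps)
  ultimately show ?thesis by simp
qed

text \<open>What the limit law uses about the dimensions \<open>A k\<close>: they are positive integers,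
  their counting function is \<open>C * t powr \<kappa>\<close> with a one-sided error that saves
  a power \<open>\<delta>\<close>, and they include all binomial coefficients \<open>(m + e)
  choose e\<close>. The last property is the arithmetic input: it keeps the total weight from
  concentrating on a proper sublattice or near one.\<close>

locale dimension_family =
  fixes W :: "'k set" and A :: "'k \<Rightarrow> nat" and \<kappa> C \<delta> K :: real and fam :: "nat \<Rightarrow> 'k" and e :: nat
  assumes A_pos: "\<And>k. k \<in> W \<Longrightarrow> A k > 0"
    and finite_below: "\<And>t. finite {k \<in> W. real (A k) \<le> t}"
    and \<kappa>: "0 < \<kappa>" "\<kappa> < 1" and C: "C > 0" and \<delta>: "\<delta> > 0" "\<delta> < \<kappa>" and K: "K \<ge> 0"
    and count_le: "\<And>t. t > 0 \<Longrightarrow> card {k \<in> W. real (A k) \<le> t} \<le> C * t powr \<kappa>"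
    and count_ge: "\<And>t. t \<ge> 1 \<Longrightarrow> C * t powr \<kappa> - K * t powr (\<kappa> - \<delta>) \<le> card {k \<in> W. real (A k) \<le> t}"
    and fam: "inj fam" "\<And>m. fam m \<in> W" "\<And>m. A (fam m) = (m + e) choose e"
    and e: "e \<ge> 1"
begin

definition below :: "real \<Rightarrow> 'k set" where
  "below t = {k \<in> W. real (A k) \<le> t}"

lemma finite_below' [simp, intro]: "finite (below t)"
  using finite_below by (simp add: below_def)

text \<open>By the layer cake formula the sum is at most the integral of \<open>exp (- u) * C * (u /
  \<beta>) powr \<kappa>\<close>; the bound \<open>u powr \<kappa> \<le> 1 + u\<close> avoids the
  Gamma function.\<close>

lemma sum_exp_le:
  fixes \<beta> :: real
  assumes "finite S" "S \<subseteq> W" "\<beta> > 0"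
  shows "(\<Sum>k\<in>S. exp (- (\<beta> * A k))) \<le> 2 * C * \<beta> powr - \<kappa>"
proof -
  have hb: "has_bochner_integral lborel (\<lambda>u. indicator {0..} u * (exp (- u) * card {k \<in> S. \<beta> * A k \<le> u}))
    (\<Sum>k\<in>S. exp (- (\<beta> * A k)))"
    using assms by (intro layer_cake_exp) auto
  have hb2: "has_bochner_integral lborel (\<lambda>u. C * \<beta> powr - \<kappa> * (indicator {0..} u * (exp (- u) * u ^ 0) + indicator {0..} u * (exp (- u) * u ^ 1)))
     (C * \<beta> powr - \<kappa> * (fact 0 + fact 1))"
    by (intro has_bochner_integral_mult_right has_bochner_integral_add integral_power_exp_Ici)
  have "(\<Sum>k\<in>S. exp (- (\<beta> * A k))) = (\<integral>u. indicator {0..} u * (exp (- u) * card {k \<in> S. \<beta> * A k \<le> u}) \<partial>lborel)"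
    using hb by (simp add: has_bochner_integral_iff)
  also have "\<dots> \<le> (\<integral>u. C * \<beta> powr - \<kappa> * (indicator {0..} u * (exp (- u) * u ^ 0) + indicator {0..} u * (exp (- u) * u ^ 1)) \<partial>lborel)"
  proof (rule integral_mono)
    fix u :: real
    show "indicator {0..} u * (exp (- u) * card {k \<in> S. \<beta> * A k \<le> u}) \<le>
      C * \<beta> powr - \<kappa> * (indicator {0..} u * (exp (- u) * u ^ 0) + indicator {0..} u * (exp (- u) * u ^ 1))"
    proof (cases "u > 0")
      case True
      have "card {k \<in> S. \<beta> * A k \<le> u} \<le> card {k \<in> W. real (A k) \<le> u / \<beta>}"
        using assms by (intro card_mono finite_below) (auto simp: field_simps)
      also have "real \<dots> \<le> C * (u / \<beta>) powr \<kappa>" using True assms by (intro count_le) auto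
      also have "\<dots> = C * \<beta> powr - \<kappa> * u powr \<kappa>"
        using True assms by (simp add: powr_divide powr_minus field_simps)
      also have "\<dots> \<le> C * \<beta> powr - \<kappa> * (1 + u)"
        using True C \<kappa> by (intro mult_left_mono powr_le_one_plus) auto
      finally have "exp (- u) * card {k \<in> S. \<beta> * A k \<le> u} \<le> exp (- u) * (C * \<beta> powr - \<kappa> * (1 + u))"
        by (intro mult_left_mono) auto
      thus ?thesis using True by (simp add: algebra_simps)
    next
      case False
      have "{k \<in> S. \<beta> * A k \<le> 0} = {}"
        using assms A_pos by (force simp: mult_le_0_iff not_le)
      hence "card {k \<in> S. \<beta> * A k \<le> 0} = 0" by (simp only: card.empty)
      thus ?thesis using False C by (cases "u = 0") auto
    qed
  qed (use hb hb2 in \<open>auto simp: has_bochner_integral_iff\<close>)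
  also have "\<dots> = C * \<beta> powr - \<kappa> * (fact 0 + fact 1)"
    using hb2 by (simp add: has_bochner_integral_iff)
  finally show ?thesis by simp
qed

text \<open>The main term \<open>C * t powr \<kappa>\<close> is bounded by its tangents at the two ends of
  the interval. As the counting function never exceeds the main term, the error term enters only
  at one end, the lower end for the upper bound and the upper end for the lower bound.\<close>

lemma count_increment:
  fixes b d :: real
  assumes "1 \<le> d" "d \<le> b"
  shows "card {k \<in> W. d < A k \<and> A k \<le> b} \<le> C * \<kappa> * d powr (\<kappa> - 1) * (b - d) + K * d powr (\<kappa> - \<delta>)"
    and "card {k \<in> W. d < A k \<and> A k \<le> b} \<ge> C * \<kappa> * b powr (\<kappa> - 1) * (b - d) - K * b powr (\<kappa> - \<delta>)"
proof -
  have "{k \<in> W. real (A k) \<le> b} = {k \<in> W. real (A k) \<le> d} \<union> {k \<in> W. d < A k \<and> A k \<le> b}"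
    using assms by auto
  moreover have "finite {k \<in> W. d < A k \<and> A k \<le> b}"
    by (rule finite_subset[OF _ finite_below[of b]]) auto
  ultimately have "card {k \<in> W. real (A k) \<le> b} = card {k \<in> W. real (A k) \<le> d} + card {k \<in> W. d < A k \<and> A k \<le> b}"
    using finite_below by (simp add: card_Un_disjoint disjoint_iff)
  hence eq: "real (card {k \<in> W. d < A k \<and> A k \<le> b}) = real (card {k \<in> W. real (A k) \<le> b}) - card {k \<in> W. real (A k) \<le> d}"
    by simp
  have "C * (b powr \<kappa> - d powr \<kappa>) \<le> C * (\<kappa> * d powr (\<kappa> - 1) * (b - d))"
    using assms \<kappa> C by (intro mult_left_mono powr_concave_tangent) auto
  thus "card {k \<in> W. d < A k \<and> A k \<le> b} \<le> C * \<kappa> * d powr (\<kappa> - 1) * (b - d) + K * d powr (\<kappa> - \<delta>)"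
    using eq count_le[of b] count_ge[of d] assms by (simp add: algebra_simps)
  have "C * (d powr \<kappa> - b powr \<kappa>) \<le> C * (\<kappa> * b powr (\<kappa> - 1) * (d - b))"
    using assms \<kappa> C by (intro mult_left_mono powr_concave_tangent) auto
  thus "card {k \<in> W. d < A k \<and> A k \<le> b} \<ge> C * \<kappa> * b powr (\<kappa> - 1) * (b - d) - K * b powr (\<kappa> - \<delta>)"
    using eq count_le[of d] count_ge[of b] assms by (simp add: algebra_simps)
qed

text \<open>With \<open>A k = d + v / \<beta>\<close> the sum is the integral of \<open>exp (- u) * G n
  u\<close>, where \<open>G n u\<close> is \<open>exp (- \<beta> * d)\<close> times the number of
  \<open>k\<close> with \<open>v \<le> u\<close>. By \<open>count_increment\<close> that number is
  close to \<open>u\<close> times the density of dimensions near \<open>d\<close>, so \<open>G n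
  u\<close> tends to \<open>y * u\<close>, and the integral of \<open>u * exp (- u)\<close> is
  \<open>1\<close>. The upper bound in \<open>count_increment\<close> is linear in
  \<open>u\<close> and serves as the dominating function.\<close>

lemma tail_sum_tendsto:
  fixes \<beta> d T :: "nat \<Rightarrow> real"
  assumes \<beta>: "\<And>n. \<beta> n > 0" and d: "\<And>n. 1 \<le> d n" and T: "\<And>n. d n \<le> T n"
    and F: "(\<lambda>n. C * \<kappa> * d n powr (\<kappa> - 1) / \<beta> n * exp (- (\<beta> n * d n))) \<longlonglongrightarrow> y"
    and E: "(\<lambda>n. K * d n powr (\<kappa> - \<delta>) * exp (- (\<beta> n * d n))) \<longlonglongrightarrow> 0"
    and \<beta>d: "filterlim (\<lambda>n. \<beta> n * d n) at_top sequentially"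
    and \<beta>T: "filterlim (\<lambda>n. \<beta> n * (T n - d n)) at_top sequentially"
  shows "(\<lambda>n. \<Sum>k\<in>{k \<in> W. d n < A k \<and> A k \<le> T n}. exp (- (\<beta> n * A k))) \<longlonglongrightarrow> y"
proof -
  define S where "S n = {k \<in> W. d n < A k \<and> A k \<le> T n}" for n
  define f where "f n = C * \<kappa> * d n powr (\<kappa> - 1) / \<beta> n * exp (- (\<beta> n * d n))" for n
  define g where "g n = K * d n powr (\<kappa> - \<delta>) * exp (- (\<beta> n * d n))" for n
  define G where "G n u = exp (- (\<beta> n * d n)) * card {k \<in> S n. \<beta> n * (A k - d n) \<le> u}" for n u
  have finS: "finite (S n)" for n
    by (rule finite_subset[OF _ finite_below[of "T n"]]) (auto simp: S_def)
  have hb: "has_bochner_integral lborel (\<lambda>u. indicator {0..} u * (exp (- u) * G n u))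
      (\<Sum>k\<in>S n. exp (- (\<beta> n * A k)))" for n
  proof -
    have "has_bochner_integral lborel (\<lambda>u. exp (- (\<beta> n * d n)) *
        (indicator {0..} u * (exp (- u) * card {k \<in> S n. \<beta> n * (A k - d n) \<le> u})))
        (exp (- (\<beta> n * d n)) * (\<Sum>k\<in>S n. exp (- (\<beta> n * (A k - d n)))))"
      using \<beta>[of n] finS by (intro has_bochner_integral_mult_right layer_cake_exp) (auto simp: S_def)
    thus ?thesis by (simp add: G_def sum_distrib_left exp_add[symmetric] algebra_simps)
  qed
  have setle: "{k \<in> S n. \<beta> n * (A k - d n) \<le> u} \<subseteq> {k \<in> W. d n < A k \<and> A k \<le> d n + u / \<beta> n}" for n u
    using \<beta>[of n] by (auto simp: S_def field_simps)
  have G_le: "G n u \<le> f n * u + g n" if "u \<ge> 0" for n u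
  proof -
    have "card {k \<in> S n. \<beta> n * (A k - d n) \<le> u} \<le> card {k \<in> W. d n < A k \<and> A k \<le> d n + u / \<beta> n}"
      using setle by (intro card_mono finite_subset[OF _ finite_below[of "d n + u / \<beta> n"]]) auto
    also have "real \<dots> \<le> C * \<kappa> * d n powr (\<kappa> - 1) * (d n + u / \<beta> n - d n) + K * d n powr (\<kappa> - \<delta>)"
      using that \<beta>[of n] d[of n] by (intro count_increment) auto
    finally have "G n u \<le> exp (- (\<beta> n * d n)) * (C * \<kappa> * d n powr (\<kappa> - 1) * (d n + u / \<beta> n - d n) + K * d n powr (\<kappa> - \<delta>))"
      unfolding G_def by (intro mult_left_mono) auto
    thus ?thesis by (simp add: f_def g_def algebra_simps)
  qed
  have G_nonneg: "G n u \<ge> 0" for n u by (simp add: G_def)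
  have fg_nonneg: "f n \<ge> 0" "g n \<ge> 0" for n
    using C K \<kappa> \<beta>[of n] by (auto simp: f_def g_def intro!: mult_nonneg_nonneg divide_nonneg_nonneg)
  have flim: "f \<longlonglongrightarrow> y" and glim: "g \<longlonglongrightarrow> 0" using F E by (auto simp: f_def[abs_def] g_def[abs_def])
  obtain Bf where Bf: "\<And>n. f n \<le> Bf" "Bf > 0"
    using convergent_imp_Bseq[of f] flim unfolding convergent_def Bseq_def by (metis abs_le_D1 real_norm_def)
  obtain Bg where Bg: "\<And>n. g n \<le> Bg" "Bg > 0"
    using convergent_imp_Bseq[of g] glim unfolding convergent_def Bseq_def by (metis abs_le_D1 real_norm_def)
  have Glim: "(\<lambda>n. G n u) \<longlonglongrightarrow> y * u" if u: "u \<ge> 0" for u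
  proof (rule tendsto_sandwich)
    \<comment> \<open>The ratio of the two ends of the window \<open>(d n, d n + u / \<beta> n]\<close>.\<close>
    define b where "b n = 1 + u / (\<beta> n * d n)" for n
    have b1: "b n \<ge> 1" for n using \<beta>[of n] d[of n] u by (simp add: b_def)
    have "(\<lambda>n. u / (\<beta> n * d n)) \<longlonglongrightarrow> 0"
      by (rule real_tendsto_divide_at_top[OF tendsto_const \<beta>d])
    hence blim: "b \<longlonglongrightarrow> 1" unfolding b_def using tendsto_add[OF tendsto_const[of 1]] by fastforce
    show "\<forall>\<^sub>F n in sequentially. f n * u * b n powr (\<kappa> - 1) - g n * b n powr (\<kappa> - \<delta>) \<le> G n u"
      using filterlim_at_top[THEN iffD1, OF \<beta>T, rule_format, of u]
    proof eventually_elim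
      case (elim n)
      have bn: "d n + u / \<beta> n = d n * b n" using \<beta>[of n] d[of n] by (simp add: b_def field_simps)
      have "u / \<beta> n \<le> T n - d n" using elim \<beta>[of n] by (simp add: field_simps)
      hence le: "d n + u / \<beta> n \<le> T n" by simp
      have iff: "\<beta> n * (a - d n) \<le> u \<longleftrightarrow> a \<le> d n + u / \<beta> n" for a
        using \<beta>[of n] by (simp add: field_simps)
      have seteq: "{k \<in> S n. \<beta> n * (A k - d n) \<le> u} = {k \<in> W. d n < A k \<and> A k \<le> d n + u / \<beta> n}"
        using le unfolding iff S_def by auto
      have "C * \<kappa> * (d n + u / \<beta> n) powr (\<kappa> - 1) * (d n + u / \<beta> n - d n) - K * (d n + u / \<beta> n) powr (\<kappa> - \<delta>)
          \<le> card {k \<in> W. d n < A k \<and> A k \<le> d n + u / \<beta> n}"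
        using u \<beta>[of n] d[of n] by (intro count_increment) auto
      hence "exp (- (\<beta> n * d n)) * (C * \<kappa> * (d n * b n) powr (\<kappa> - 1) * (u / \<beta> n) - K * (d n * b n) powr (\<kappa> - \<delta>)) \<le> G n u"
        unfolding G_def seteq bn by (intro mult_left_mono) (auto simp: bn[symmetric])
      moreover have "exp (- (\<beta> n * d n)) * (C * \<kappa> * (d n * b n) powr (\<kappa> - 1) * (u / \<beta> n) - K * (d n * b n) powr (\<kappa> - \<delta>))
          = f n * u * b n powr (\<kappa> - 1) - g n * b n powr (\<kappa> - \<delta>)"
        using d[of n] b1[of n] by (simp add: f_def g_def powr_mult algebra_simps)
      ultimately show ?case by simp
    qed
    show "\<forall>\<^sub>F n in sequentially. G n u \<le> f n * u + g n" using G_le[OF u] by simp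
    have "(\<lambda>n. f n * u * b n powr (\<kappa> - 1) - g n * b n powr (\<kappa> - \<delta>)) \<longlonglongrightarrow> y * u * 1 powr (\<kappa> - 1) - 0 * 1 powr (\<kappa> - \<delta>)"
      by (intro tendsto_intros flim glim blim) auto
    thus "(\<lambda>n. f n * u * b n powr (\<kappa> - 1) - g n * b n powr (\<kappa> - \<delta>)) \<longlonglongrightarrow> y * u" by simp
    have "(\<lambda>n. f n * u + g n) \<longlonglongrightarrow> y * u + 0" by (intro tendsto_intros flim glim)
    thus "(\<lambda>n. f n * u + g n) \<longlonglongrightarrow> y * u" by simp
  qed
  have hbl: "has_bochner_integral lborel (\<lambda>u. indicator {0..} u * (exp (- u) * (y * u))) y"
    using has_bochner_integral_mult_right[OF integral_power_exp_Ici[of 1], of y] by (simp add: mult_ac)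
  have hbw: "has_bochner_integral lborel (\<lambda>u. Bf * (indicator {0..} u * (exp (- u) * u ^ 1)) + Bg * (indicator {0..} u * (exp (- u) * u ^ 0)))
      (Bf * fact 1 + Bg * fact 0)"
    by (intro has_bochner_integral_add has_bochner_integral_mult_right integral_power_exp_Ici)
  have "(\<lambda>n. \<integral>u. indicator {0..} u * (exp (- u) * G n u) \<partial>lborel) \<longlonglongrightarrow>
      (\<integral>u. indicator {0..} u * (exp (- u) * (y * u)) \<partial>lborel)"
  proof (rule integral_dominated_convergence)
    show "(\<lambda>u. indicator {0..} u * (exp (- u) * (y * u))) \<in> borel_measurable lborel"
      using hbl by (auto simp: has_bochner_integral_iff)
    show "(\<lambda>u. indicator {0..} u * (exp (- u) * G n u)) \<in> borel_measurable lborel" for n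
      using hb[of n] by (auto simp: has_bochner_integral_iff)
    show "integrable lborel (\<lambda>u. Bf * (indicator {0..} u * (exp (- u) * u ^ 1)) + Bg * (indicator {0..} u * (exp (- u) * u ^ 0)))"
      using hbw by (auto simp: has_bochner_integral_iff)
    show "AE u in lborel. (\<lambda>n. indicator {0..} u * (exp (- u) * G n u)) \<longlonglongrightarrow> indicator {0..} u * (exp (- u) * (y * u))"
    proof (rule AE_I2)
      fix u :: real
      show "(\<lambda>n. indicator {0..} u * (exp (- u) * G n u)) \<longlonglongrightarrow> indicator {0..} u * (exp (- u) * (y * u))"
        using Glim[of u] by (cases "u \<ge> 0") (auto intro!: tendsto_intros)
    qed
    show "AE u in lborel. norm (indicator {0..} u * (exp (- u) * G n u)) \<le>
        Bf * (indicator {0..} u * (exp (- u) * u ^ 1)) + Bg * (indicator {0..} u * (exp (- u) * u ^ 0))" for n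
    proof (rule AE_I2)
      fix u :: real
      show "norm (indicator {0..} u * (exp (- u) * G n u)) \<le>
        Bf * (indicator {0..} u * (exp (- u) * u ^ 1)) + Bg * (indicator {0..} u * (exp (- u) * u ^ 0))"
      proof (cases "u \<ge> 0")
        case True
        have "G n u \<le> Bf * u + Bg"
          using G_le[OF True, of n] Bf(1)[of n] Bg(1)[of n] mult_right_mono[OF Bf(1)[of n] True] by linarith
        hence "exp (- u) * G n u \<le> exp (- u) * (Bf * u + Bg)" by (intro mult_left_mono) auto
        thus ?thesis using True G_nonneg[of n u] by (simp add: abs_mult algebra_simps)
      qed auto
    qed
  qed
  thus ?thesis using hb hbl by (simp add: has_bochner_integral_iff S_def)
qed

end

section \<open>Decay of the characteristic function\<close>

lemma norm_char_denominator:
  "(norm (1 - of_real m * (cis x - 1)))\<^sup>2 = 1 + 2 * (m * (m + 1)) * (1 - cos x)"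
proof -
  have "(norm (1 - of_real m * (cis x - 1)))\<^sup>2 = (1 - m * (cos x - 1))\<^sup>2 + (m * sin x)\<^sup>2"
    by (simp add: cmod_power2)
  also have "(m * sin x)\<^sup>2 = m\<^sup>2 * (1 - (cos x)\<^sup>2)" by (simp add: power_mult_distrib sin_squared_eq)
  also have "(1 - m * (cos x - 1))\<^sup>2 + m\<^sup>2 * (1 - (cos x)\<^sup>2) = 1 + 2 * (m * (m + 1)) * (1 - cos x)"
    by (simp add: power2_eq_square algebra_simps)
  finally show ?thesis .
qed

text \<open>The factor of \<open>k\<close> has absolute value \<open>(1 + 2 * v * (1 - cos (A k *
  \<theta>))) powr (- 1 / 2)\<close>, where \<open>v\<close> is the variance. Halving the number
  of factors takes care of the square root.\<close>

lemma norm_boltzmann_char_le: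
  assumes "finite S" "D \<subseteq> S" "\<eta> \<ge> 0" "\<beta> > 0" "\<And>k. k \<in> S \<Longrightarrow> A k > 0"
    and "\<And>k. k \<in> D \<Longrightarrow> \<eta> \<le> 2 * var_mult \<beta> (A k) * (1 - cos (A k * \<theta>))"
  shows "norm (boltzmann_char A \<beta> S \<theta>) \<le> 1 / (1 + \<eta>) ^ (card D div 2)"
proof -
  define g where "g k = 1 + 2 * var_mult \<beta> (A k) * (1 - cos (A k * \<theta>))" for k
  have g1: "g k \<ge> 1" if "k \<in> S" for k
    using var_mult_nonneg[of \<beta> "A k"] assms(4) assms(5)[OF that] cos_le_one[of "A k * \<theta>"]
    by (simp add: g_def)
  have "(norm (boltzmann_char A \<beta> S \<theta>))\<^sup>2 = (\<Prod>k\<in>S. 1 / g k)"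
    unfolding boltzmann_char_def
    by (simp add: prod_norm[symmetric] norm_divide prod_power_distrib power_divide norm_char_denominator g_def var_mult_def)
  also have "\<dots> = (\<Prod>k\<in>D. 1 / g k) * (\<Prod>k\<in>S - D. 1 / g k)"
    using assms by (subst prod.subset_diff[of D]) (auto simp: mult.commute)
  also have "\<dots> \<le> (\<Prod>k\<in>D. 1 / (1 + \<eta>)) * 1"
  proof (intro mult_mono prod_mono prod_le_1 conjI)
    fix k assume k: "k \<in> D"
    show "1 / g k \<le> 1 / (1 + \<eta>)" using assms(6)[OF k] assms(3)
      by (intro divide_left_mono) (auto simp: g_def)
  qed (use g1 assms(2,3) in \<open>force intro!: prod_nonneg\<close>)+
  also have "\<dots> = 1 / (1 + \<eta>) ^ card D" by (simp add: power_one_over)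
  also have "\<dots> \<le> 1 / (1 + \<eta>) ^ (2 * (card D div 2))"
    using assms(3) by (intro divide_left_mono power_increasing) auto
  also have "\<dots> = (1 / (1 + \<eta>) ^ (card D div 2))\<^sup>2"
    by (simp add: power_divide power_mult[symmetric] mult.commute)
  finally show ?thesis
    by (rule power2_le_imp_le) (use assms(3) in auto)
qed

text \<open>Since \<open>(n + 1 choose Suc j) - (n choose Suc j) = n choose j\<close>, taking differences of
  consecutive phases lowers \<open>j\<close> by one and at most doubles the bound; for \<open>j =
  0\<close> the binomial coefficient is \<open>1\<close>.\<close>

lemma binomial_difference_bound:
  assumes "\<And>i. i \<le> j \<Longrightarrow> norm (cis (real ((m + i) choose j) * \<theta>) - 1) < \<epsilon>"
  shows "norm (cis \<theta> - 1) < 2 ^ j * \<epsilon>"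
  using assms
proof (induction j arbitrary: \<epsilon>)
  case 0
  thus ?case by simp
next
  case (Suc j)
  have "norm (cis (real ((m + i) choose j) * \<theta>) - 1) < 2 * \<epsilon>" if "i \<le> j" for i
  proof -
    define x y where "x = real ((m + Suc i) choose Suc j) * \<theta>" and "y = real ((m + i) choose Suc j) * \<theta>"
    have "real ((m + i) choose j) * \<theta> = x - y" by (simp add: x_def y_def algebra_simps)
    moreover have "norm (cis (x - y) - 1) = norm ((cis x - 1) - (cis y - 1))"
    proof -
      have "cis x - cis y = cis y * (cis (x - y) - 1)" by (simp add: algebra_simps cis_mult)
      thus ?thesis by (simp add: norm_mult)
    qed
    moreover have "norm ((cis x - 1) - (cis y - 1)) \<le> norm (cis x - 1) + norm (cis y - 1)"
      by (rule norm_triangle_ineq4)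
    moreover have "norm (cis x - 1) < \<epsilon>" "norm (cis y - 1) < \<epsilon>"
      using Suc.prems[of "Suc i"] Suc.prems[of i] that by (simp_all add: x_def y_def)
    ultimately show ?thesis by simp
  qed
  from Suc.IH[OF this] show ?case by simp
qed

context dimension_family
begin

definition sigma2 :: "real \<Rightarrow> 'k set \<Rightarrow> real" where
  "sigma2 \<beta> S = (\<Sum>k\<in>S. (real (A k))\<^sup>2 * var_mult \<beta> (A k))"

lemma sigma2_le:
  assumes "finite S" "S \<subseteq> W" "\<beta> > 0"
  shows "sigma2 \<beta> S \<le> 64 * C / \<beta>\<^sup>2 * \<beta> powr - \<kappa>"
proof -
  have "sigma2 \<beta> S \<le> (\<Sum>k\<in>S. 16 / \<beta>\<^sup>2 * exp (- (\<beta> / 2 * A k)))"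
    unfolding sigma2_def
  proof (rule sum_mono)
    fix k assume "k \<in> S"
    thus "(real (A k))\<^sup>2 * var_mult \<beta> (A k) \<le> 16 / \<beta>\<^sup>2 * exp (- (\<beta> / 2 * A k))"
      using var_mult_bounds(1)[of \<beta> "A k"] A_pos[of k] assms by auto
  qed
  also have "\<dots> = 16 / \<beta>\<^sup>2 * (\<Sum>k\<in>S. exp (- (\<beta> / 2 * A k)))" by (simp add: sum_distrib_left)
  also have "\<dots> \<le> 16 / \<beta>\<^sup>2 * (2 * C * (\<beta> / 2) powr - \<kappa>)"
    using assms by (intro mult_left_mono sum_exp_le) auto
  also have "(\<beta> / 2) powr - \<kappa> = 2 powr \<kappa> * \<beta> powr - \<kappa>"
    using assms by (simp add: powr_divide powr_minus field_simps)
  also have "16 / \<beta>\<^sup>2 * (2 * C * (2 powr \<kappa> * \<beta> powr - \<kappa>)) \<le> 16 / \<beta>\<^sup>2 * (2 * C * (2 powr 1 * \<beta> powr - \<kappa>))"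
    using \<kappa> C by (intro mult_left_mono mult_right_mono powr_mono) auto
  finally show ?thesis by simp
qed

lemma third_moment_le:
  assumes "finite S" "S \<subseteq> W" "\<beta> > 0"
  shows "(\<Sum>k\<in>S. real (A k) ^ 3 * var_mult \<beta> (A k)) \<le> 512 * C / \<beta> ^ 3 * \<beta> powr - \<kappa>"
proof -
  have "(\<Sum>k\<in>S. real (A k) ^ 3 * var_mult \<beta> (A k)) \<le> (\<Sum>k\<in>S. 64 / \<beta> ^ 3 * exp (- (\<beta> / 4 * A k)))"
  proof (rule sum_mono)
    fix k assume "k \<in> S"
    thus "real (A k) ^ 3 * var_mult \<beta> (A k) \<le> 64 / \<beta> ^ 3 * exp (- (\<beta> / 4 * A k))"
      using var_mult_bounds(2)[of \<beta> "A k"] A_pos[of k] assms by auto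
  qed
  also have "\<dots> = 64 / \<beta> ^ 3 * (\<Sum>k\<in>S. exp (- (\<beta> / 4 * A k)))" by (simp add: sum_distrib_left)
  also have "\<dots> \<le> 64 / \<beta> ^ 3 * (2 * C * (\<beta> / 4) powr - \<kappa>)"
    using assms by (intro mult_left_mono sum_exp_le) auto
  also have "(\<beta> / 4) powr - \<kappa> = 4 powr \<kappa> * \<beta> powr - \<kappa>"
    using assms by (simp add: powr_divide powr_minus field_simps)
  also have "64 / \<beta> ^ 3 * (2 * C * (4 powr \<kappa> * \<beta> powr - \<kappa>)) \<le> 64 / \<beta> ^ 3 * (2 * C * (4 powr 1 * \<beta> powr - \<kappa>))"
    using \<kappa> C assms by (intro mult_left_mono mult_right_mono powr_mono) auto
  finally show ?thesis by simp
qed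

text \<open>For large \<open>t\<close> the error term is at most half of the main term.\<close>

lemma count_ge_half:
  obtains t0 where "t0 \<ge> 1" "\<And>t. t \<ge> t0 \<Longrightarrow> C / 2 * t powr \<kappa> \<le> card (below t)"
proof -
  have "eventually (\<lambda>t. K * t powr (- \<delta>) < C / 2) at_top"
  proof -
    have "((\<lambda>t. K * t powr (- \<delta>)) \<longlongrightarrow> K * 0) at_top"
      using \<delta> by (intro tendsto_intros tendsto_neg_powr filterlim_ident) auto
    thus ?thesis using C by (auto dest!: order_tendstoD(2)[where a = "C / 2"])
  qed
  then obtain t1 where t1: "\<And>t. t \<ge> t1 \<Longrightarrow> K * t powr (- \<delta>) < C / 2"
    by (auto simp: eventually_at_top_linorder)
  show ?thesis
  proof (rule that[of "max 1 t1"])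
    fix t assume t: "t \<ge> max 1 t1"
    have "K * t powr (- \<delta>) * t powr \<kappa> \<le> C / 2 * t powr \<kappa>"
      using t1[of t] t by (intro mult_right_mono) auto
    moreover have "t powr (\<kappa> - \<delta>) = t powr (- \<delta>) * t powr \<kappa>"
      by (simp add: powr_add[symmetric])
    ultimately have "K * t powr (\<kappa> - \<delta>) \<le> C / 2 * t powr \<kappa>" by (simp only: mult.assoc)
    thus "C / 2 * t powr \<kappa> \<le> card (below t)"
      using count_ge[of t] t unfolding below_def by simp
  qed auto
qed

text \<open>Each part of size at most \<open>1 / \<beta>\<close> contributes at least \<open>1 / (3 *
  \<beta>\<^sup>2)\<close>.\<close>

lemma sigma2_ge:
  assumes "finite S" "S \<subseteq> W" "\<beta> > 0" "below (1 / \<beta>) \<subseteq> S"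
  shows "sigma2 \<beta> S \<ge> 1 / (3 * \<beta>\<^sup>2) * card (below (1 / \<beta>))"
proof -
  have "1 / (3 * \<beta>\<^sup>2) * card (below (1 / \<beta>)) = (\<Sum>k\<in>below (1 / \<beta>). 1 / (3 * \<beta>\<^sup>2))" by simp
  also have "\<dots> \<le> (\<Sum>k\<in>below (1 / \<beta>). (real (A k))\<^sup>2 * var_mult \<beta> (A k))"
  proof (rule sum_mono)
    fix k assume k: "k \<in> below (1 / \<beta>)"
    hence "\<beta> * A k \<le> 1" using assms(3) by (simp add: below_def field_simps)
    thus "1 / (3 * \<beta>\<^sup>2) \<le> (real (A k))\<^sup>2 * var_mult \<beta> (A k)"
      using var_mult_bounds(3)[of \<beta> "A k"] A_pos[of k] k assms(3) by (auto simp: below_def)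
  qed
  also have "\<dots> \<le> sigma2 \<beta> S" unfolding sigma2_def
  proof (rule sum_mono2[OF assms(1,4)])
    fix k assume "k \<in> S - below (1 / \<beta>)"
    thus "0 \<le> (real (A k))\<^sup>2 * var_mult \<beta> (A k)"
      using var_mult_nonneg[of \<beta> "A k"] A_pos[of k] assms by auto
  qed
  finally show ?thesis .
qed

text \<open>For the parts with \<open>A k * max \<beta> \<bar>\<theta>\<bar> \<le> 1\<close> the phase
  \<open>A k * \<theta>\<close> is at most \<open>1\<close>, so that \<open>1 - cos\<close> is
  comparable with its square, and the variance is at least \<open>1 / (3 * (\<beta> * A
  k)\<^sup>2)\<close>. The size \<open>A k\<close> cancels in the product of the two.\<close>

lemma char_decay_by_small_dimensions:
  assumes S: "finite S" "S \<subseteq> W" "\<beta> > 0" "below (1 / \<beta>) \<subseteq> S"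
  shows "norm (boltzmann_char A \<beta> S \<theta>) \<le>
    1 / (1 + \<theta>\<^sup>2 / (60 * \<beta>\<^sup>2)) ^ (card (below (1 / max \<beta> \<bar>\<theta>\<bar>)) div 2)"
proof (rule norm_boltzmann_char_le)
  define \<tau> where "\<tau> = max \<beta> \<bar>\<theta>\<bar>"
  have \<tau>: "\<tau> \<ge> \<beta>" "\<tau> \<ge> \<bar>\<theta>\<bar>" "\<tau> > 0" using S(3) by (auto simp: \<tau>_def)
  have "1 / \<tau> \<le> 1 / \<beta>" using \<tau> S(3) by (intro divide_left_mono) auto
  hence "below (1 / \<tau>) \<subseteq> below (1 / \<beta>)" by (auto simp: below_def)
  thus "below (1 / max \<beta> \<bar>\<theta>\<bar>) \<subseteq> S" using S(4) by (auto simp: \<tau>_def)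
  fix k assume "k \<in> below (1 / max \<beta> \<bar>\<theta>\<bar>)"
  hence k: "k \<in> W" "A k * \<tau> \<le> 1" using \<tau> by (auto simp: below_def \<tau>_def field_simps)
  have "A k * \<beta> \<le> 1" "A k * \<bar>\<theta>\<bar> \<le> 1"
    using mult_left_mono[OF \<tau>(1), of "A k"] mult_left_mono[OF \<tau>(2), of "A k"] k by auto
  hence "1 - cos (A k * \<theta>) \<ge> (A k * \<theta>)\<^sup>2 / 40" "(A k)\<^sup>2 * var_mult \<beta> (A k) \<ge> 1 / (3 * \<beta>\<^sup>2)"
    using one_minus_cos_ge[of "A k * \<theta>"] pi_gt3 var_mult_bounds(3)[of \<beta> "A k"] S(3) A_pos[OF k(1)]
    by (auto simp: abs_mult mult.commute)
  moreover have "var_mult \<beta> (A k) \<ge> 0" using var_mult_nonneg[of \<beta> "A k"] S(3) A_pos[OF k(1)] by simp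
  ultimately have "\<theta>\<^sup>2 / 20 * (1 / (3 * \<beta>\<^sup>2)) \<le> \<theta>\<^sup>2 / 20 * ((A k)\<^sup>2 * var_mult \<beta> (A k))"
    and "2 * var_mult \<beta> (A k) * ((A k * \<theta>)\<^sup>2 / 40) \<le> 2 * var_mult \<beta> (A k) * (1 - cos (A k * \<theta>))"
    by (auto simp only: intro!: mult_left_mono mult_nonneg_nonneg zero_le_power2 divide_nonneg_nonneg zero_le_numeral)
  moreover have "\<theta>\<^sup>2 / 20 * (1 / (3 * \<beta>\<^sup>2)) = \<theta>\<^sup>2 / (60 * \<beta>\<^sup>2)" by simp
  moreover have "\<theta>\<^sup>2 / 20 * ((A k)\<^sup>2 * var_mult \<beta> (A k)) = 2 * var_mult \<beta> (A k) * ((A k * \<theta>)\<^sup>2 / 40)"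
    by (simp add: power_mult_distrib)
  ultimately show "\<theta>\<^sup>2 / (60 * \<beta>\<^sup>2) \<le> 2 * var_mult \<beta> (A k) * (1 - cos (A k * \<theta>))" by linarith
qed (use S A_pos in auto)

text \<open>Divide the first \<open>M * (e + 1)\<close> binomial coefficients into blocks of \<open>e +
  1\<close>. By \<open>binomial_difference_bound\<close> each block has a member whose phase
  factor differs from \<open>1\<close> by at least a constant times
  \<open>\<bar>\<theta>\<bar>\<close>. The assumption on \<open>M\<close> keeps the parts below
  \<open>1 / sqrt \<beta>\<close>, where the variance is at least \<open>1 / (3 *
  \<beta>)\<close>; this makes up for \<open>\<theta>\<^sup>2\<close>, which is only known to be
  at least \<open>\<beta>\<close>, and each block contributes a constant factor.\<close>

lemma char_decay_by_binomials:
  assumes S: "finite S" "S \<subseteq> W" "0 < \<beta>" "\<beta> \<le> 1" "below (1 / \<beta>) \<subseteq> S"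
    and \<theta>: "sqrt \<beta> \<le> \<bar>\<theta>\<bar>" "\<bar>\<theta>\<bar> \<le> pi"
    and M: "real ((M + 1) * (e + 1)) ^ e \<le> 1 / sqrt \<beta>"
  shows "norm (boltzmann_char A \<beta> S \<theta>) \<le> 1 / (1 + 1 / (60 * 4 ^ e)) ^ (M div 2)"
proof -
  have "\<exists>i\<le>e. norm (cis \<theta> - 1) / 2 ^ e \<le> norm (cis (A (fam (b * (e + 1) + i)) * \<theta>) - 1)" for b
  proof (rule ccontr)
    assume "\<not> ?thesis"
    hence "norm (cis (real ((b * (e + 1) + e + i) choose e) * \<theta>) - 1) < norm (cis \<theta> - 1) / 2 ^ e" if "i \<le> e" for i
    proof -
      have "b * (e + 1) + i + e = b * (e + 1) + e + i" by simp
      hence "A (fam (b * (e + 1) + i)) = (b * (e + 1) + e + i) choose e" by (simp only: fam(3))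
      thus ?thesis using \<open>\<not> _\<close> that by (metis not_le)
    qed
    from binomial_difference_bound[OF this] show False by simp
  qed
  then obtain i where i: "\<And>b. i b \<le> e"
    "\<And>b. norm (cis \<theta> - 1) / 2 ^ e \<le> norm (cis (A (fam (b * (e + 1) + i b)) * \<theta>) - 1)" by metis
  define k where "k b = fam (b * (e + 1) + i b)" for b
  define D where "D = k ` {..<M}"
  have "inj k"
  proof
    fix b c assume "k b = k c"
    hence "b * (e + 1) + i b = c * (e + 1) + i c" using fam(1) by (auto simp: k_def dest: injD)
    moreover have "(b * (e + 1) + i b) div (e + 1) = b" for b
    proof -
      have "(i b + b * (e + 1)) div (e + 1) = b + i b div (e + 1)" by (rule div_mult_self1) simp
      moreover have "i b div (e + 1) = 0" using i(1)[of b] by (intro div_less) simp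
      ultimately show ?thesis by (metis add.commute add.right_neutral)
    qed
    ultimately show "b = c" by metis
  qed
  hence card: "card D = M" by (simp add: D_def card_image inj_on_subset)
  have small: "A (k b) \<le> 1 / sqrt \<beta>" if "b < M" for b
  proof -
    define N where "N = b * (e + 1) + i b + e"
    have "A (k b) \<le> N ^ e" by (simp add: k_def fam N_def binomial_le_pow2 binomial_le_pow)
    moreover have "N \<le> (M + 1) * (e + 1)"
    proof -
      have "b * (e + 1) + (e + 1) \<le> M * (e + 1)" using that mult_le_mono1[of "Suc b" M "e + 1"] by simp
      thus ?thesis using i(1)[of b] by (simp add: N_def)
    qed
    hence "N ^ e \<le> ((M + 1) * (e + 1)) ^ e" by (rule power_mono) simp
    ultimately have "A (k b) \<le> ((M + 1) * (e + 1)) ^ e" by simp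
    hence "real (A (k b)) \<le> real (((M + 1) * (e + 1)) ^ e)" by (rule of_nat_mono)
    also have "\<dots> = real ((M + 1) * (e + 1)) ^ e" by (rule of_nat_power)
    finally show ?thesis using M by (rule order.trans)
  qed
  have sqrt_le: "\<beta> \<le> sqrt \<beta>" using S(3,4) by (simp add: real_le_rsqrt power2_eq_square mult_left_le)
  have "norm (boltzmann_char A \<beta> S \<theta>) \<le> 1 / (1 + 1 / (60 * 4 ^ e)) ^ (card D div 2)"
  proof (rule norm_boltzmann_char_le)
    have "1 / sqrt \<beta> \<le> 1 / \<beta>" using sqrt_le S(3) by (intro divide_left_mono) auto
    hence "D \<subseteq> below (1 / \<beta>)"
      using small by (force simp: D_def below_def k_def fam)
    thus "D \<subseteq> S" using S(5) by auto
    fix x assume "x \<in> D"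
    then obtain b where b: "b < M" "x = k b" by (auto simp: D_def)
    define a where "a = real (A x)"
    have "x \<in> W" using b by (simp add: k_def fam)
    hence a: "a > 0" using A_pos by (simp add: a_def)
    have as: "a \<le> 1 / sqrt \<beta>" using small b by (simp add: a_def)
    hence "a\<^sup>2 \<le> (1 / sqrt \<beta>)\<^sup>2" using a by (intro power_mono) auto
    hence a2: "a\<^sup>2 * \<beta> \<le> 1" using S(3) by (simp add: power_divide field_simps)
    have "\<beta> * a \<le> sqrt \<beta> * (1 / sqrt \<beta>)" using sqrt_le as a S(3) by (intro mult_mono) auto
    hence "\<beta> * a \<le> 1" using S(3) by simp
    hence "1 / (3 * \<beta>\<^sup>2) \<le> a\<^sup>2 * var_mult \<beta> a" using a S(3) by (intro var_mult_bounds) auto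
    hence "\<beta> * (1 / (3 * \<beta>\<^sup>2)) \<le> \<beta> * (a\<^sup>2 * var_mult \<beta> a)" using S(3) by (intro mult_left_mono) auto
    also have "\<dots> = (a\<^sup>2 * \<beta>) * var_mult \<beta> a" by simp
    also have "\<dots> \<le> 1 * var_mult \<beta> a"
      using a2 var_mult_nonneg[of \<beta> a] a S(3) by (intro mult_right_mono) auto
    finally have v: "1 / (3 * \<beta>) \<le> var_mult \<beta> a" using S(3) by (simp add: power2_eq_square)
    have "\<beta> = (sqrt \<beta>)\<^sup>2" using S(3) by simp
    also have "\<dots> \<le> \<theta>\<^sup>2" using \<theta>(1) S(3) by (metis abs_ge_zero power2_abs power_mono real_sqrt_ge_zero less_imp_le)
    finally have "\<beta> / 20 \<le> 2 * (1 - cos \<theta>)" using one_minus_cos_ge[OF \<theta>(2)] by simp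
    also have "\<dots> = (norm (cis \<theta> - 1))\<^sup>2" by (simp add: norm_cis_minus_1)
    also have "\<dots> = 4 ^ e * (norm (cis \<theta> - 1) / 2 ^ e)\<^sup>2"
    proof -
      have "((2::real) ^ e)\<^sup>2 = 4 ^ e" by (simp add: power2_eq_square power_mult_distrib[symmetric])
      thus ?thesis by (simp add: power_divide)
    qed
    also have "\<dots> \<le> 4 ^ e * (norm (cis (a * \<theta>) - 1))\<^sup>2"
      using i(2)[of b] b by (intro mult_left_mono power_mono) (auto simp: a_def k_def)
    also have "\<dots> = 4 ^ e * (2 * (1 - cos (a * \<theta>)))" by (simp add: norm_cis_minus_1)
    finally have "\<beta> / (20 * 4 ^ e) \<le> 2 * (1 - cos (a * \<theta>))" by (simp add: field_simps)
    hence "1 / (3 * \<beta>) * (\<beta> / (20 * 4 ^ e)) \<le> var_mult \<beta> a * (2 * (1 - cos (a * \<theta>)))"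
      using v S(3) var_mult_nonneg[of \<beta> a] a by (intro mult_mono) auto
    thus "1 / (60 * 4 ^ e) \<le> 2 * var_mult \<beta> (A x) * (1 - cos (A x * \<theta>))"
      using S(3) by (simp add: a_def algebra_simps)
  qed (use S A_pos in auto)
  thus ?thesis by (simp add: card)
qed

end

text \<open>The slack \<open>- 2\<close> allows for \<open>J\<close> being obtained by rounding.\<close>

lemma exponential_beats_power:
  fixes b c p s H :: real
  assumes "b > 1" "c > 0" "p > 0" "s > 0" "H \<ge> 0"
  shows "\<forall>\<^sub>F \<beta> in at_right 0. \<forall>J::nat. c * \<beta> powr - p - 2 \<le> J \<longrightarrow> 1 + H * \<beta> powr - s \<le> b ^ (J div 2)"
proof -
  define a where "a = ln b / 2"
  have a: "a > 0" using assms by (simp add: a_def)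
  have "\<forall>\<^sub>F \<beta> in at_right 0. 1 + H * \<beta> powr - s \<le> exp (a * (c * \<beta> powr - p - 3))"
    using a assms by real_asymp
  thus ?thesis
  proof eventually_elim
    case (elim \<beta>)
    show ?case
    proof (intro allI impI)
      fix J :: nat assume J: "c * \<beta> powr - p - 2 \<le> J"
      have "real J \<le> 2 * (J div 2) + 1" by linarith
      hence "a * (c * \<beta> powr - p - 3) \<le> a * (2 * (J div 2))" using J a by (intro mult_left_mono) auto
      hence "exp (a * (c * \<beta> powr - p - 3)) \<le> exp (a * (2 * (J div 2)))" by simp
      also have "\<dots> = exp (ln b * (J div 2))" by (simp add: a_def)
      also have "\<dots> = b ^ (J div 2)" using assms by (simp add: exp_of_nat2_mult)
      finally show "1 + H * \<beta> powr - s \<le> b ^ (J div 2)" using elim by simp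
    qed
  qed
qed

context dimension_family
begin

text \<open>The bound is exactly what dominated convergence wants after the substitution \<open>\<theta> = t
  / \<sigma>\<close>. For \<open>\<bar>\<theta>\<bar> \<le> \<beta>\<close> it follows from
  Bernoulli's inequality, because \<open>sigma2\<close> is at most a constant times the number of
  parts below \<open>1 / \<beta>\<close> divided by \<open>\<beta>\<^sup>2\<close>. For larger
  \<open>\<theta>\<close> the number of factors bounded away from \<open>1\<close> is at least a
  power of \<open>1 / \<beta>\<close>, which beats the polynomial size of \<open>pi\<^sup>2 *
  sigma2\<close>.\<close>

lemma char_decay:
  obtains c \<beta>0 where "c > 0" "c \<le> 1" "\<beta>0 > 0"
    "\<And>\<beta> S \<theta>. 0 < \<beta> \<Longrightarrow> \<beta> < \<beta>0 \<Longrightarrow> finite S \<Longrightarrow> S \<subseteq> W \<Longrightarrow> below (1 / \<beta>) \<subseteq> S \<Longrightarrow> \<bar>\<theta>\<bar> \<le> pi \<Longrightarrow>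
       norm (boltzmann_char A \<beta> S \<theta>) \<le> 1 / (1 + c * (\<theta>\<^sup>2 * sigma2 \<beta> S))"
proof -
  obtain t0 where t0: "t0 \<ge> 1" "\<And>t. t \<ge> t0 \<Longrightarrow> C / 2 * t powr \<kappa> \<le> card (below t)"
    by (rule count_ge_half) blast
  \<comment> \<open>The upper bound \<open>64 * C\<close> for the scaled variance against the lower bound \<open>C
    / 8\<close> for half the number of parts and the factor \<open>1 / 60\<close> from
    \<open>char_decay_by_small_dimensions\<close>: \<open>30720 = 64 * 8 * 60\<close>.\<close>
  define c :: real where "c = 1 / 30720"
  define H where "H = c * (pi\<^sup>2 * (64 * C))"
  have H: "H \<ge> 0" using C by (simp add: H_def c_def)
  define good where "good \<beta> \<longleftrightarrow> \<beta> \<le> 1 / t0\<^sup>2 \<and> 1 \<le> C / 4 * \<beta> powr - \<kappa> \<and>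
     1 \<le> 1 / real (e + 1) * \<beta> powr - (1 / (2 * e)) \<and>
     (\<forall>J::nat. C / 2 * \<beta> powr - (\<kappa> / 2) - 2 \<le> J \<longrightarrow> 1 + H * \<beta> powr - (2 + \<kappa>) \<le> (61/60) ^ (J div 2)) \<and>
     (\<forall>J::nat. 1 / real (e + 1) * \<beta> powr - (1 / (2 * e)) - 2 \<le> J \<longrightarrow>
        1 + H * \<beta> powr - (2 + \<kappa>) \<le> (1 + 1 / (60 * 4 ^ e)) ^ (J div 2))" for \<beta>
  have "\<forall>\<^sub>F \<beta> in at_right 0. good \<beta>"
    unfolding good_def
  proof (intro eventually_conj)
    show "\<forall>\<^sub>F \<beta> in at_right 0. \<beta> \<le> 1 / t0\<^sup>2"
      using t0(1) by (intro eventually_at_rightI[of 0 "1 / t0\<^sup>2"]) auto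
    show "\<forall>\<^sub>F \<beta> in at_right 0. 1 \<le> C / 4 * \<beta> powr - \<kappa>"
      using C \<kappa> by real_asymp
    have "1 / (2 * real e) > 0" using e by simp
    thus "\<forall>\<^sub>F \<beta> in at_right 0. 1 \<le> 1 / real (e + 1) * \<beta> powr - (1 / (2 * e))"
      by real_asymp
    show "\<forall>\<^sub>F \<beta> in at_right 0. \<forall>J::nat. C / 2 * \<beta> powr - (\<kappa> / 2) - 2 \<le> J \<longrightarrow> 1 + H * \<beta> powr - (2 + \<kappa>) \<le> (61/60) ^ (J div 2)"
      using C \<kappa> H by (intro exponential_beats_power) auto
    show "\<forall>\<^sub>F \<beta> in at_right 0. \<forall>J::nat. 1 / real (e + 1) * \<beta> powr - (1 / (2 * e)) - 2 \<le> J \<longrightarrow>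
        1 + H * \<beta> powr - (2 + \<kappa>) \<le> (1 + 1 / (60 * 4 ^ e)) ^ (J div 2)"
      using e \<kappa> H by (intro exponential_beats_power) auto
  qed
  then obtain \<beta>0 where \<beta>0: "\<beta>0 > 0" and good: "\<And>\<beta>. 0 < \<beta> \<Longrightarrow> \<beta> < \<beta>0 \<Longrightarrow> good \<beta>"
    unfolding eventually_at_right_field by auto
  show ?thesis
  proof (rule that[of c \<beta>0])
    show "c > 0" "c \<le> 1" by (simp_all add: c_def)
    show "\<beta>0 > 0" by fact
    fix \<beta> S \<theta> assume *: "0 < \<beta>" "\<beta> < \<beta>0" "finite S" "S \<subseteq> W" "below (1 / \<beta>) \<subseteq> S" "\<bar>\<theta>\<bar> \<le> pi"
    have \<beta>: "\<beta> \<le> 1 / t0\<^sup>2" "1 \<le> C / 4 * \<beta> powr - \<kappa>" "1 \<le> 1 / real (e + 1) * \<beta> powr - (1 / (2 * e))"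
     "\<And>J::nat. C / 2 * \<beta> powr - (\<kappa> / 2) - 2 \<le> J \<Longrightarrow> 1 + H * \<beta> powr - (2 + \<kappa>) \<le> (61/60) ^ (J div 2)"
     "\<And>J::nat. 1 / real (e + 1) * \<beta> powr - (1 / (2 * e)) - 2 \<le> J \<Longrightarrow>
        1 + H * \<beta> powr - (2 + \<kappa>) \<le> (1 + 1 / (60 * 4 ^ e)) ^ (J div 2)"
      using good[OF *(1,2)] unfolding good_def by blast+
    have t0sq: "t0\<^sup>2 \<ge> 1" using t0(1) by simp
    have "1 / t0\<^sup>2 \<le> 1 / 1" using t0sq t0(1) by (intro divide_left_mono) auto
    hence \<beta>1: "\<beta> \<le> 1" using \<beta>(1) by linarith
    have sqrt_t0: "sqrt \<beta> \<le> 1 / t0"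
      using real_sqrt_le_mono[OF \<beta>(1)] t0(1) by (simp add: real_sqrt_divide)
    have sqrt_le: "\<beta> \<le> sqrt \<beta>" using *(1) \<beta>1 by (simp add: real_le_rsqrt power2_eq_square mult_left_le)
    have sig_pos: "sigma2 \<beta> S \<ge> 0"
      using sigma2_ge[OF *(3,4,1,5)] *(1) by (meson divide_nonneg_nonneg mult_nonneg_nonneg of_nat_0_le_iff order.trans zero_le_numeral zero_le_one zero_le_power2)
    have sig_up: "sigma2 \<beta> S \<le> 64 * C * \<beta> powr - (2 + \<kappa>)"
    proof -
      have "\<beta> powr - (2 + \<kappa>) = \<beta> powr - 2 * \<beta> powr - \<kappa>" by (simp add: powr_add[symmetric])
      also have "\<beta> powr - 2 = 1 / \<beta>\<^sup>2" using *(1) by (simp add: powr_minus divide_simps)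
      finally show ?thesis using sigma2_le[OF *(3,4,1)] by simp
    qed
    have trivial: "1 + c * (\<theta>\<^sup>2 * sigma2 \<beta> S) \<le> 1 + H * \<beta> powr - (2 + \<kappa>)"
    proof -
      have "\<theta>\<^sup>2 \<le> pi\<^sup>2" using power_mono[OF *(6), of 2] by simp
      hence "\<theta>\<^sup>2 * sigma2 \<beta> S \<le> pi\<^sup>2 * (64 * C * \<beta> powr - (2 + \<kappa>))"
        using sig_pos sig_up by (intro mult_mono) auto
      hence "c * (\<theta>\<^sup>2 * sigma2 \<beta> S) \<le> c * (pi\<^sup>2 * (64 * C * \<beta> powr - (2 + \<kappa>)))"
        by (intro mult_left_mono) (auto simp: c_def)
      thus ?thesis by (simp add: H_def mult_ac)
    qed
    have den_pos: "1 + c * (\<theta>\<^sup>2 * sigma2 \<beta> S) > 0" using sig_pos by (simp add: c_def add_pos_nonneg)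
    consider "\<bar>\<theta>\<bar> \<le> \<beta>" | "\<beta> < \<bar>\<theta>\<bar>" "\<bar>\<theta>\<bar> \<le> sqrt \<beta>" | "sqrt \<beta> < \<bar>\<theta>\<bar>" by linarith
    thus "norm (boltzmann_char A \<beta> S \<theta>) \<le> 1 / (1 + c * (\<theta>\<^sup>2 * sigma2 \<beta> S))"
    proof cases
      case 1
      define J where "J = card (below (1 / \<beta>))"
      have "1 / \<beta> \<ge> t0" using sqrt_t0 sqrt_le t0(1) *(1) by (simp add: field_simps) (metis mult.commute mult_left_mono order.trans zero_le_one)
      hence "C / 2 * (1 / \<beta>) powr \<kappa> \<le> J" unfolding J_def by (rule t0(2))
      hence J: "C / 2 * \<beta> powr - \<kappa> \<le> J" using *(1) by (simp add: powr_divide powr_minus divide_simps)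
      have "real J \<le> 2 * (J div 2) + 1" by linarith
      hence J2: "C / 8 * \<beta> powr - \<kappa> \<le> (J div 2)" using J \<beta>(2) by linarith
      define y where "y = \<theta>\<^sup>2 / (60 * \<beta>\<^sup>2)"
      have "c * (\<theta>\<^sup>2 * sigma2 \<beta> S) \<le> c * (\<theta>\<^sup>2 * (64 * C / \<beta>\<^sup>2 * \<beta> powr - \<kappa>))"
        using sigma2_le[OF *(3,4,1)] by (intro mult_left_mono) (auto simp: c_def)
      also have "\<dots> = C / 8 * \<beta> powr - \<kappa> * y" by (simp add: c_def y_def)
      also have "\<dots> \<le> (J div 2) * y" using J2 by (intro mult_right_mono) (auto simp: y_def)
      also have "1 + \<dots> \<le> (1 + y) ^ (J div 2)" by (rule Bernoulli_inequality) (simp add: y_def add_nonneg_nonneg order.trans[of "-1" 0])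
      finally have "1 + c * (\<theta>\<^sup>2 * sigma2 \<beta> S) \<le> (1 + y) ^ (J div 2)" by simp
      hence "1 / (1 + y) ^ (J div 2) \<le> 1 / (1 + c * (\<theta>\<^sup>2 * sigma2 \<beta> S))"
        using den_pos by (intro divide_left_mono) auto
      moreover have "max \<beta> \<bar>\<theta>\<bar> = \<beta>" using 1 by simp
      ultimately show ?thesis
        using char_decay_by_small_dimensions[OF *(3,4,1,5), of \<theta>] by (simp add: J_def y_def)
    next
      case 2
      define J where "J = card (below (1 / \<bar>\<theta>\<bar>))"
      have pos: "\<bar>\<theta>\<bar> > 0" using 2 *(1) by linarith
      have "t0 \<le> 1 / \<bar>\<theta>\<bar>" using 2(2) sqrt_t0 t0(1) pos by (simp add: field_simps) (metis mult.commute mult_left_mono order.trans zero_le_one)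
      hence "C / 2 * (1 / \<bar>\<theta>\<bar>) powr \<kappa> \<le> J" unfolding J_def by (rule t0(2))
      moreover have "C / 2 * (1 / sqrt \<beta>) powr \<kappa> \<le> C / 2 * (1 / \<bar>\<theta>\<bar>) powr \<kappa>"
        using C 2 pos \<kappa> *(1) by (intro mult_left_mono powr_mono2 divide_left_mono) auto
      moreover have "(1 / sqrt \<beta>) powr \<kappa> = \<beta> powr - (\<kappa> / 2)"
        using *(1) by (simp add: powr_half_sqrt[symmetric] powr_divide powr_powr powr_minus divide_simps)
      ultimately have "C / 2 * \<beta> powr - (\<kappa> / 2) - 2 \<le> J"
        by simp
      from \<beta>(4)[OF this] have "1 + c * (\<theta>\<^sup>2 * sigma2 \<beta> S) \<le> (61/60) ^ (J div 2)" using trivial by simp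
      also have "\<dots> \<le> (1 + \<theta>\<^sup>2 / (60 * \<beta>\<^sup>2)) ^ (J div 2)"
      proof (rule power_mono)
        have "\<beta>\<^sup>2 \<le> \<theta>\<^sup>2" using 2(1) *(1) by (metis abs_of_pos abs_le_square_iff less_imp_le)
        thus "61 / 60 \<le> 1 + \<theta>\<^sup>2 / (60 * \<beta>\<^sup>2)" using *(1) by (simp add: field_simps)
      qed simp
      finally have "1 / (1 + \<theta>\<^sup>2 / (60 * \<beta>\<^sup>2)) ^ (J div 2) \<le> 1 / (1 + c * (\<theta>\<^sup>2 * sigma2 \<beta> S))"
        using den_pos by (intro divide_left_mono) (auto intro!: mult_pos_pos zero_less_power add_pos_nonneg)
      moreover have "max \<beta> \<bar>\<theta>\<bar> = \<bar>\<theta>\<bar>" using 2 by simp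
      ultimately show ?thesis
        using char_decay_by_small_dimensions[OF *(3,4,1,5), of \<theta>] by (simp add: J_def)
    next
      case 3
      define X where "X = \<beta> powr - (1 / (2 * e))"
      \<comment> \<open>The largest number of blocks that \<open>char_decay_by_binomials\<close> permits, up to
        rounding.\<close>
      define M where "M = nat \<lfloor>1 / real (e + 1) * X\<rfloor> - 1"
      have "1 \<le> nat \<lfloor>1 / real (e + 1) * X\<rfloor>" using \<beta>(3) unfolding X_def by linarith
      hence M1: "real (M + 1) \<le> 1 / real (e + 1) * X" and M2: "1 / real (e + 1) * X - 2 \<le> M"
        unfolding M_def by linarith+
      have "real ((M + 1) * (e + 1)) \<le> X" using M1 by (simp add: field_simps)
      hence "real ((M + 1) * (e + 1)) ^ e \<le> X ^ e" by (intro power_mono) auto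
      also have "X ^ e = \<beta> powr - (1 / 2)" using *(1) e by (simp add: X_def powr_power)
      also have "\<dots> = 1 / sqrt \<beta>" using *(1) by (simp add: powr_minus powr_half_sqrt divide_simps)
      finally have "norm (boltzmann_char A \<beta> S \<theta>) \<le> 1 / (1 + 1 / (60 * 4 ^ e)) ^ (M div 2)"
        using 3 by (intro char_decay_by_binomials[OF *(3,4,1) \<beta>1 *(5) _ *(6)]) auto
      also have "\<dots> \<le> 1 / (1 + c * (\<theta>\<^sup>2 * sigma2 \<beta> S))"
        using \<beta>(5)[of M] M2 trivial den_pos unfolding X_def
        by (intro divide_left_mono mult_pos_pos zero_less_power) (auto intro!: add_pos_nonneg)
      finally show ?thesis .
    qed
  qed
qed

end

section \<open>The local limit theorem\<close>

lemma cis_sum: "cis (\<Sum>k\<in>S. f k) = (\<Prod>k\<in>S. cis (f k))"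
proof (cases "finite S")
  case True
  thus ?thesis by (induction S rule: finite_induct) (auto simp: cis_mult[symmetric])
qed simp

context dimension_family
begin

definition mean_dim :: "real \<Rightarrow> 'k set \<Rightarrow> real" where
  "mean_dim \<beta> S = (\<Sum>k\<in>S. A k * mean_mult \<beta> (A k))"

lemma sigma2_ge_powr:
  assumes "finite S" "S \<subseteq> W" "\<beta> > 0" "below (1 / \<beta>) \<subseteq> S" "C / 2 * \<beta> powr - \<kappa> \<le> card (below (1 / \<beta>))"
  shows "\<beta>\<^sup>2 * sigma2 \<beta> S \<ge> C / 6 * \<beta> powr - \<kappa>"
proof -
  have "C / 6 * \<beta> powr - \<kappa> \<le> card (below (1 / \<beta>)) / 3" using assms(5) by simp
  also have "\<dots> = \<beta>\<^sup>2 * (1 / (3 * \<beta>\<^sup>2) * card (below (1 / \<beta>)))" using assms(3) by simp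
  also have "\<dots> \<le> \<beta>\<^sup>2 * sigma2 \<beta> S" using sigma2_ge[OF assms(1-4)] by (intro mult_left_mono) auto
  finally show ?thesis .
qed

text \<open>Here \<open>w\<close> is the product over \<open>k\<close> of the reciprocal centred
  characteristic functions, each divided by its Gaussian counterpart \<open>B k\<close>. The
  deviations of the factors from \<open>1\<close> add up to a Lyapunov quotient: the third moments
  are at most a constant times \<open>sigma2 / \<beta>\<close>, so the quotient is of order
  \<open>1 / (\<beta> * \<sigma>)\<close>, and \<open>\<beta> * \<sigma>\<close> tends to
  infinity. Stating the bound for \<open>w\<close>, a product of reciprocals, avoids complex
  logarithms.\<close>

lemma boltzmann_char_near_gaussian:
  fixes t :: real
  assumes S: "finite S" "S \<subseteq> W" "\<beta> > 0" "below (1 / \<beta>) \<subseteq> S"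
    and card: "C / 2 * \<beta> powr - \<kappa> \<le> card (below (1 / \<beta>))"
  defines "\<sigma> \<equiv> sqrt (sigma2 \<beta> S)"
  assumes t: "4 * \<bar>t\<bar> \<le> \<beta> * \<sigma>"
  obtains w :: complex where
    "norm (w - 1) \<le> exp (6146 * \<bar>t\<bar> ^ 3 / (\<beta> * \<sigma>) + 16 * t ^ 4 / (\<beta> * \<sigma>)\<^sup>2) - 1"
    "w * boltzmann_char A \<beta> S (t / \<sigma>) = cis (mean_dim \<beta> S * (t / \<sigma>)) * of_real (exp (- t\<^sup>2 / 2))"
proof -
  have s2: "\<beta>\<^sup>2 * sigma2 \<beta> S \<ge> C / 6 * \<beta> powr - \<kappa>" by (rule sigma2_ge_powr[OF S card])
  moreover have "C / 6 * \<beta> powr - \<kappa> > 0" using C S(3) by simp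
  ultimately have "\<beta>\<^sup>2 * sigma2 \<beta> S > 0" by linarith
  hence sig: "sigma2 \<beta> S > 0" using S(3) by (simp add: zero_less_mult_iff)
  hence \<sigma>: "\<sigma> > 0" "\<sigma>\<^sup>2 = sigma2 \<beta> S" by (simp_all add: \<sigma>_def)
  have \<beta>\<sigma>: "\<beta> * \<sigma> > 0" using \<sigma> S(3) by simp
  define \<theta> where "\<theta> = t / \<sigma>"
  define \<rho> where "\<rho> = \<bar>t\<bar> / (\<beta> * \<sigma>)"
  have \<rho>: "0 \<le> \<rho>" "\<rho> \<le> 1 / 4" using t \<beta>\<sigma> by (auto simp: \<rho>_def field_simps)
  have \<theta>\<rho>: "\<bar>\<theta>\<bar> = \<beta> * \<rho>" using \<sigma> S(3) by (simp add: \<theta>_def \<rho>_def abs_divide)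
  define m where "m k = mean_mult \<beta> (A k)" for k
  define a where "a k = real (A k)" for k
  define v where "v k = var_mult \<beta> (A k)" for k
  have v_eq: "v k = m k * (m k + 1)" for k by (simp add: v_def m_def var_mult_def)
  define F where "F k = 1 - of_real (m k) * (cis (a k * \<theta>) - 1)" for k
  define P where "P k = cis (m k * (a k * \<theta>)) * F k" for k
  define B where "B k = exp (v k * (a k * \<theta>)\<^sup>2 / 2)" for k
  define z where "z k = P k / of_real (B k) - 1" for k
  have kS: "a k > 0" "\<beta> * a k > 0" "m k \<ge> 0" "v k \<ge> 0" "m k * \<bar>a k * \<theta>\<bar> \<le> 1" "v k * (a k * \<theta>)\<^sup>2 \<le> 16 * \<rho>\<^sup>2"
    if "k \<in> S" for k
  proof -
    show a: "a k > 0" using A_pos that S(2) by (auto simp: a_def)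
    show ba: "\<beta> * a k > 0" using a S(3) by simp
    show m: "m k \<ge> 0" "v k \<ge> 0"
      using mean_mult_bounds(1)[OF ba] var_mult_nonneg[OF ba] by (auto simp: m_def v_def a_def)
    have "\<beta> * a k * m k \<le> 1" using mean_mult_bounds(2)[OF ba] by (simp add: m_def a_def)
    hence "(\<beta> * a k * m k) * \<rho> \<le> 1 * \<rho>" using \<rho> by (intro mult_right_mono) auto
    moreover have "m k * \<bar>a k * \<theta>\<bar> = (\<beta> * a k * m k) * \<rho>" using a \<theta>\<rho> by (simp add: abs_mult)
    ultimately show "m k * \<bar>a k * \<theta>\<bar> \<le> 1" using \<rho> by linarith
    have "(a k)\<^sup>2 * v k \<le> 16 / \<beta>\<^sup>2 * exp (- (\<beta> * a k) / 2)"
      using var_mult_bounds(1)[OF S(3) a] by (simp add: v_def a_def)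
    also have "\<dots> \<le> 16 / \<beta>\<^sup>2 * 1" using ba by (intro mult_left_mono) auto
    finally have "((a k)\<^sup>2 * v k) * \<theta>\<^sup>2 \<le> 16 / \<beta>\<^sup>2 * \<theta>\<^sup>2" by (intro mult_right_mono) auto
    also have "\<theta>\<^sup>2 = \<beta>\<^sup>2 * \<rho>\<^sup>2" using \<theta>\<rho> by (metis power2_abs power_mult_distrib)
    finally show "v k * (a k * \<theta>)\<^sup>2 \<le> 16 * \<rho>\<^sup>2" using S(3) \<theta>\<rho>
      by (simp add: power_mult_distrib \<open>\<theta>\<^sup>2 = \<beta>\<^sup>2 * \<rho>\<^sup>2\<close> mult_ac)
  qed
  have sum_v: "(\<Sum>k\<in>S. v k * (a k * \<theta>)\<^sup>2) = t\<^sup>2"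
  proof -
    have "(\<Sum>k\<in>S. v k * (a k * \<theta>)\<^sup>2) = \<theta>\<^sup>2 * sigma2 \<beta> S"
      by (simp add: sigma2_def sum_distrib_left a_def v_def power_mult_distrib mult_ac)
    also have "\<dots> = t\<^sup>2"
      unfolding \<sigma>(2)[symmetric] \<theta>_def using \<sigma>(1) by (simp add: power_divide)
    finally show ?thesis .
  qed
  have z_le: "norm (z k) \<le> 2 * (v k * (m k + 1) * \<bar>a k * \<theta>\<bar> ^ 3) + 4 * \<rho>\<^sup>2 * (v k * (a k * \<theta>)\<^sup>2)" if k: "k \<in> S" for k
  proof -
    define y where "y = v k * (a k * \<theta>)\<^sup>2 / 2"
    have "\<rho>\<^sup>2 \<le> (1/4)\<^sup>2" using \<rho> by (intro power_mono) auto
    hence y: "0 \<le> y" "y \<le> 8 * \<rho>\<^sup>2" "y \<le> 1" using kS(4,6)[OF k] by (auto simp: y_def power2_eq_square)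
    have B1: "B k \<ge> 1" using y by (simp add: B_def y_def)
    have "norm (P k - of_real (1 + y)) \<le> 2 * (v k * (m k + 1) * \<bar>a k * \<theta>\<bar> ^ 3)"
      using centered_char_inverse_expansion[OF kS(3)[OF k] kS(5)[OF k]]
      by (simp add: P_def F_def y_def v_eq power2_eq_square mult_ac)
    moreover have "norm (of_real (1 + y) - of_real (B k) :: complex) \<le> y\<^sup>2"
    proof -
      have "norm (of_real (1 + y) - of_real (B k) :: complex) = \<bar>1 + y - B k\<bar>"
        by (simp only: of_real_diff[symmetric] norm_of_real)
      moreover have "B k \<le> 1 + y + y\<^sup>2" using exp_bound[OF y(1,3)] by (simp add: B_def y_def)
      moreover have "B k \<ge> 1 + y" using exp_ge_add_one_self[of y] by (simp add: B_def y_def)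
      ultimately show ?thesis by simp
    qed
    moreover have "y\<^sup>2 \<le> 8 * \<rho>\<^sup>2 * y" using y by (simp add: power2_eq_square mult_right_mono)
    moreover have "norm (P k - of_real (B k)) \<le> norm (P k - of_real (1 + y)) + norm (of_real (1 + y) - of_real (B k) :: complex)"
      using norm_triangle_ineq[of "P k - of_real (1 + y)" "of_real (1 + y) - of_real (B k)"] by simp
    ultimately have "norm (P k - of_real (B k)) \<le> 2 * (v k * (m k + 1) * \<bar>a k * \<theta>\<bar> ^ 3) + 8 * \<rho>\<^sup>2 * y" by linarith
    moreover have "norm (z k) = norm (P k - of_real (B k)) / B k"
    proof -
      have "z k = (P k - of_real (B k)) / of_real (B k)" using B1 by (simp add: z_def field_simps)
      thus ?thesis using B1 by (simp add: norm_divide)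
    qed
    moreover have "norm (P k - of_real (B k)) / B k \<le> norm (P k - of_real (B k)) / 1"
      using B1 by (intro divide_left_mono) auto
    moreover have "8 * \<rho>\<^sup>2 * y = 4 * \<rho>\<^sup>2 * (v k * (a k * \<theta>)\<^sup>2)" by (simp add: y_def)
    ultimately show ?thesis by linarith
  qed
  have third: "v k * (m k + 1) * \<bar>a k * \<theta>\<bar> ^ 3 \<le> \<bar>\<theta>\<bar> ^ 3 * ((a k)\<^sup>2 * v k / \<beta> + (a k) ^ 3 * v k)" if k: "k \<in> S" for k
  proof -
    have "\<beta> * a k * (m k + 1) \<le> 1 + \<beta> * a k"
      using mean_mult_bounds(4)[OF kS(2)[OF k]] by (simp add: m_def a_def)
    hence "a k * (m k + 1) \<le> 1 / \<beta> + a k" using S(3) by (simp add: field_simps)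
    hence le: "(q * ((a k)\<^sup>2 * v k)) * (a k * (m k + 1)) \<le> (q * ((a k)\<^sup>2 * v k)) * (1 / \<beta> + a k)"
      if "q \<ge> 0" for q using kS[OF k] that by (intro mult_left_mono) auto
    define q where "q = \<bar>\<theta>\<bar> ^ 3"
    have q: "\<bar>a k * \<theta>\<bar> ^ 3 = q * a k ^ 3" "q \<ge> 0"
      using kS(1)[OF k] by (simp_all add: abs_mult power_mult_distrib q_def)
    have "v k * (m k + 1) * (q * a k ^ 3) = (q * ((a k)\<^sup>2 * v k)) * (a k * (m k + 1))"
      by (simp add: power2_eq_square power3_eq_cube algebra_simps)
    also have "\<dots> \<le> (q * ((a k)\<^sup>2 * v k)) * (1 / \<beta> + a k)" by (rule le[OF q(2)])
    also have "\<dots> = q * ((a k)\<^sup>2 * v k / \<beta> + (a k) ^ 3 * v k)"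
      by (simp add: power2_eq_square power3_eq_cube algebra_simps)
    finally show ?thesis unfolding q(1) unfolding q_def .
  qed
  have "(\<Sum>k\<in>S. norm (z k)) \<le> (\<Sum>k\<in>S. 2 * (\<bar>\<theta>\<bar> ^ 3 * ((a k)\<^sup>2 * v k / \<beta> + (a k) ^ 3 * v k)) + 4 * \<rho>\<^sup>2 * (v k * (a k * \<theta>)\<^sup>2))"
  proof (rule sum_mono)
    fix k assume "k \<in> S"
    thus "norm (z k) \<le> 2 * (\<bar>\<theta>\<bar> ^ 3 * ((a k)\<^sup>2 * v k / \<beta> + (a k) ^ 3 * v k)) + 4 * \<rho>\<^sup>2 * (v k * (a k * \<theta>)\<^sup>2)"
      using z_le[of k] third[of k] by linarith
  qed
  also have "\<dots> = 2 * \<bar>\<theta>\<bar> ^ 3 * (sigma2 \<beta> S / \<beta> + (\<Sum>k\<in>S. (a k) ^ 3 * v k)) + 4 * \<rho>\<^sup>2 * t\<^sup>2"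
    unfolding sum.distrib sum_distrib_left[symmetric] sum_v sigma2_def sum_divide_distrib
    by (simp add: sum.distrib sum_distrib_left sum_divide_distrib a_def v_def mult.assoc)
  also have "\<dots> \<le> 2 * \<bar>\<theta>\<bar> ^ 3 * (sigma2 \<beta> S / \<beta> + 3072 * sigma2 \<beta> S / \<beta>) + 4 * \<rho>\<^sup>2 * t\<^sup>2"
  proof -
    have "(\<Sum>k\<in>S. (a k) ^ 3 * v k) \<le> 512 * C / \<beta> ^ 3 * \<beta> powr - \<kappa>"
      using third_moment_le[OF S(1-3)] by (simp add: a_def v_def)
    also have "\<dots> = 3072 / \<beta> ^ 3 * (C / 6 * \<beta> powr - \<kappa>)" by simp
    also have "\<dots> \<le> 3072 / \<beta> ^ 3 * (\<beta>\<^sup>2 * sigma2 \<beta> S)" using s2 S(3) by (intro mult_left_mono) auto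
    also have "\<dots> = 3072 * sigma2 \<beta> S / \<beta>" using S(3) by (simp add: power2_eq_square power3_eq_cube)
    finally show ?thesis by (intro add_right_mono mult_left_mono add_left_mono) auto
  qed
  also have "\<dots> = 6146 * \<bar>t\<bar> ^ 3 / (\<beta> * \<sigma>) + 4 * \<rho>\<^sup>2 * t\<^sup>2"
    using \<sigma> S(3) unfolding \<sigma>(2)[symmetric] \<theta>_def
    by (simp add: abs_divide power_divide field_simps power2_eq_square power3_eq_cube)
  also have "4 * \<rho>\<^sup>2 * t\<^sup>2 = 4 * t ^ 4 / (\<beta> * \<sigma>)\<^sup>2"
  proof -
    have "t ^ 4 = t\<^sup>2 * t\<^sup>2" by (simp add: power_add[symmetric])
    thus ?thesis by (simp add: \<rho>_def power_divide)
  qed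
  also have "\<dots> \<le> 16 * t ^ 4 / (\<beta> * \<sigma>)\<^sup>2" by (intro divide_right_mono mult_right_mono) auto
  finally have zsum: "(\<Sum>k\<in>S. norm (z k)) \<le> 6146 * \<bar>t\<bar> ^ 3 / (\<beta> * \<sigma>) + 16 * t ^ 4 / (\<beta> * \<sigma>)\<^sup>2" by simp
  show ?thesis
  proof (rule that[of "\<Prod>k\<in>S. 1 + z k"])
    show "norm ((\<Prod>k\<in>S. 1 + z k) - 1) \<le> exp (6146 * \<bar>t\<bar> ^ 3 / (\<beta> * \<sigma>) + 16 * t ^ 4 / (\<beta> * \<sigma>)\<^sup>2) - 1"
    proof -
      have "exp (\<Sum>k\<in>S. norm (z k)) \<le> exp (6146 * \<bar>t\<bar> ^ 3 / (\<beta> * \<sigma>) + 16 * t ^ 4 / (\<beta> * \<sigma>)\<^sup>2)"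
        using zsum by (simp only: exp_le_cancel_iff)
      thus ?thesis using norm_prod_minus_1_le_exp[of z S] by linarith
    qed
    have F: "F k \<noteq> 0" if "k \<in> S" for k
    proof -
      have "(norm (F k))\<^sup>2 = 1 + 2 * v k * (1 - cos (a k * \<theta>))"
        by (simp add: F_def norm_char_denominator v_eq)
      also have "\<dots> > 0" using kS(4)[OF that] cos_le_one[of "a k * \<theta>"] by (intro add_pos_nonneg mult_nonneg_nonneg) auto
      finally show ?thesis by auto
    qed
    have "(\<Prod>k\<in>S. 1 + z k) * boltzmann_char A \<beta> S \<theta> = (\<Prod>k\<in>S. cis (m k * (a k * \<theta>)) * of_real (exp (- (v k * (a k * \<theta>)\<^sup>2 / 2))))"
      unfolding boltzmann_char_def prod.distrib[symmetric]
    proof (intro prod.cong refl)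
      fix k assume k: "k \<in> S"
      have "(1 + z k) * (1 / F k) = cis (m k * (a k * \<theta>)) / of_real (B k)"
        using F[OF k] by (simp add: z_def P_def)
      also have "\<dots> = cis (m k * (a k * \<theta>)) * of_real (exp (- (v k * (a k * \<theta>)\<^sup>2 / 2)))"
        unfolding B_def exp_minus of_real_inverse divide_inverse[of "cis _"] by (rule refl)
      finally show "(1 + z k) * (1 / (1 - of_real (mean_mult \<beta> (A k)) * (cis (A k * \<theta>) - 1))) =
          cis (m k * (a k * \<theta>)) * of_real (exp (- (v k * (a k * \<theta>)\<^sup>2 / 2)))"
        by (simp add: F_def m_def a_def)
    qed
    also have "\<dots> = cis (\<Sum>k\<in>S. m k * (a k * \<theta>)) * of_real (exp (\<Sum>k\<in>S. - (v k * (a k * \<theta>)\<^sup>2 / 2)))"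
      using S(1) by (simp add: prod.distrib cis_sum exp_sum)
    also have "(\<Sum>k\<in>S. m k * (a k * \<theta>)) = mean_dim \<beta> S * \<theta>"
      unfolding mean_dim_def sum_distrib_right by (intro sum.cong) (auto simp: m_def a_def)
    also have "(\<Sum>k\<in>S. - (v k * (a k * \<theta>)\<^sup>2 / 2)) = - t\<^sup>2 / 2"
      by (simp add: sum_negf sum_divide_distrib[symmetric] sum_v)
    finally show "(\<Prod>k\<in>S. 1 + z k) * boltzmann_char A \<beta> S (t / \<sigma>) = cis (mean_dim \<beta> S * (t / \<sigma>)) * of_real (exp (- t\<^sup>2 / 2))"
      by (simp add: \<theta>_def)
  qed
qed

end

lemma integrable_inverse_one_plus_square: "integrable lborel (\<lambda>x::real. 1 / (1 + x\<^sup>2))"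
  using integrable_inverse_1_plus_square
  by (simp add: set_integrable_def einterval_eq_UNIV inverse_eq_divide)

lemma integral_gaussian: "(\<integral>x. exp (- (x::real)\<^sup>2 / 2) \<partial>lborel) = sqrt (2 * pi)"
proof -
  have "(\<integral>x. std_normal_density x \<partial>lborel) = 1"
    using std_normal_moment_even[of 0] by (simp add: has_bochner_integral_iff)
  moreover have "(\<integral>x. std_normal_density x \<partial>lborel) = 1 / sqrt (2 * pi) * (\<integral>x. exp (- (x::real)\<^sup>2 / 2) \<partial>lborel)"
    unfolding std_normal_density_def by (rule integral_mult_right_zero)
  ultimately show ?thesis by (simp add: field_simps)
qed

lemma cis_measurable [measurable]: "cis \<in> borel_measurable borel"
  unfolding cis_conv_exp[abs_def] by (intro borel_measurable_continuous_onI continuous_intros)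

lemma boltzmann_char_measurable [measurable]: "boltzmann_char A \<beta> S \<in> borel_measurable borel"
  unfolding boltzmann_char_def[abs_def] by measurable

context dimension_family
begin

text \<open>Substituting \<open>\<theta> = t / \<sigma>\<close> in the Fourier integral gives an integrand
  that converges pointwise to \<open>exp (- t\<^sup>2 / 2)\<close> by
  \<open>boltzmann_char_near_gaussian\<close>, as the mean differs from \<open>N n\<close> by
  \<open>o(\<sigma>)\<close>; it is dominated by a multiple of \<open>1 / (1 + t\<^sup>2)\<close>
  by \<open>char_decay\<close>.\<close>

lemma local_limit:
  fixes \<beta> :: "nat \<Rightarrow> real" and S :: "nat \<Rightarrow> 'k set" and N :: "nat \<Rightarrow> nat"
  assumes \<beta>: "\<And>n. \<beta> n > 0" "\<beta> \<longlonglongrightarrow> 0"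
    and S: "\<And>n. finite (S n)" "\<And>n. S n \<subseteq> W" "\<And>n. below (1 / \<beta> n) \<subseteq> S n"
    and mean: "(\<lambda>n. (N n - mean_dim (\<beta> n) (S n)) / sqrt (sigma2 (\<beta> n) (S n))) \<longlonglongrightarrow> 0"
  shows "(\<lambda>n. sqrt (sigma2 (\<beta> n) (S n)) * (card (partitions_into A (S n) (N n)) *
     exp (- \<beta> n * N n) * (\<Prod>k\<in>S n. 1 - exp (- \<beta> n * A k)))) \<longlonglongrightarrow> 1 / sqrt (2 * pi)"
proof -
  define \<sigma> where "\<sigma> n = sqrt (sigma2 (\<beta> n) (S n))" for n
  define X where "X n = card (partitions_into A (S n) (N n)) * exp (- \<beta> n * N n) * (\<Prod>k\<in>S n. 1 - exp (- \<beta> n * A k))" for n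
  define g where "g n t = indicator {-pi..pi} (t / \<sigma> n) *\<^sub>R (boltzmann_char A (\<beta> n) (S n) (t / \<sigma> n) * cis (- (N n * (t / \<sigma> n))))" for n t
  obtain c \<beta>0 where c: "c > 0" "c \<le> 1" and \<beta>0: "\<beta>0 > 0" and decay:
    "\<And>\<beta> S \<theta>. 0 < \<beta> \<Longrightarrow> \<beta> < \<beta>0 \<Longrightarrow> finite S \<Longrightarrow> S \<subseteq> W \<Longrightarrow> below (1 / \<beta>) \<subseteq> S \<Longrightarrow> \<bar>\<theta>\<bar> \<le> pi \<Longrightarrow>
       norm (boltzmann_char A \<beta> S \<theta>) \<le> 1 / (1 + c * (\<theta>\<^sup>2 * sigma2 \<beta> S))"
    by (rule char_decay) blast
  obtain t0 where t0: "t0 \<ge> 1" "\<And>t. t \<ge> t0 \<Longrightarrow> C / 2 * t powr \<kappa> \<le> card (below t)"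
    by (rule count_ge_half) blast
  have "\<forall>\<^sub>F n in sequentially. \<beta> n < min \<beta>0 (1 / t0)"
    using \<beta>(2) \<beta>0 t0(1) by (intro order_tendstoD) auto
  then obtain n0 where n0: "\<And>n. n \<ge> n0 \<Longrightarrow> \<beta> n < min \<beta>0 (1 / t0)"
    by (auto simp: eventually_sequentially)
  have card: "C / 2 * \<beta> n powr - \<kappa> \<le> card (below (1 / \<beta> n))" if "n \<ge> n0" for n
  proof -
    have "t0 \<le> 1 / \<beta> n" using n0[OF that] t0(1) \<beta>(1)[of n] by (simp add: field_simps)
    from t0(2)[OF this] show ?thesis using \<beta>(1)[of n] by (simp add: powr_divide powr_minus divide_simps)
  qed
  have \<beta>\<sigma>: "C / 6 * \<beta> n powr - \<kappa> \<le> (\<beta> n * \<sigma> n)\<^sup>2" "\<sigma> n > 0" if "n \<ge> n0" for n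
  proof -
    have s2: "\<beta> n ^ 2 * sigma2 (\<beta> n) (S n) \<ge> C / 6 * \<beta> n powr - \<kappa>"
      by (rule sigma2_ge_powr[OF S(1,2) \<beta>(1) S(3) card[OF that]])
    moreover have "C / 6 * \<beta> n powr - \<kappa> > 0" using C \<beta>(1)[of n] by simp
    ultimately have "\<beta> n ^ 2 * sigma2 (\<beta> n) (S n) > 0" by linarith
    hence "sigma2 (\<beta> n) (S n) > 0" by (simp add: zero_less_mult_iff)
    thus "\<sigma> n > 0" "C / 6 * \<beta> n powr - \<kappa> \<le> (\<beta> n * \<sigma> n)\<^sup>2" using s2 by (simp_all add: \<sigma>_def power_mult_distrib)
  qed
  have \<beta>\<sigma>_lim: "filterlim (\<lambda>n. \<beta> n * \<sigma> n) at_top sequentially"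
  proof -
    have "filterlim \<beta> (at_right 0) sequentially"
      using \<beta> by (intro tendsto_imp_filterlim_at_right) auto
    moreover have "filterlim (\<lambda>b. sqrt (C / 6 * b powr - \<kappa>)) at_top (at_right 0)"
      using C \<kappa> by real_asymp
    ultimately have "filterlim (\<lambda>n. sqrt (C / 6 * \<beta> n powr - \<kappa>)) at_top sequentially"
      by (rule filterlim_compose[rotated])
    moreover have "\<forall>\<^sub>F n in sequentially. sqrt (C / 6 * \<beta> n powr - \<kappa>) \<le> \<beta> n * \<sigma> n"
      using eventually_ge_at_top[of n0]
    proof eventually_elim
      case (elim n)
      thus ?case using \<beta>\<sigma>[OF elim] \<beta>(1)[of n] by (intro real_le_lsqrt) auto
    qed
    ultimately show ?thesis by (rule filterlim_at_top_mono)
  qed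
  have int_g: "(\<integral>t. g n t \<partial>lborel) = of_real (2 * pi * (\<sigma> n * X n))" if "n \<ge> n0" for n
  proof -
    have \<sigma>: "\<sigma> n > 0" using \<beta>\<sigma>[OF that] by simp
    have "complex_of_real (2 * pi * X n) = (\<integral>\<theta>. indicator {-pi..pi} \<theta> *\<^sub>R (boltzmann_char A (\<beta> n) (S n) \<theta> * cis (- (N n * \<theta>))) \<partial>lborel)"
      using S(1,2) A_pos \<beta>(1)[of n]
      by (subst partitions_into_eq_boltzmann_integral) (auto simp: X_def subset_iff)
    also have "\<dots> = \<bar>1 / \<sigma> n\<bar> *\<^sub>R (\<integral>t. g n t \<partial>lborel)"
      using \<sigma> by (subst lborel_integral_real_affine[where c = "1 / \<sigma> n" and t = 0]) (auto simp: g_def[abs_def])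
    finally show ?thesis using \<sigma> by (simp add: scaleR_conv_of_real field_simps)
  qed
  have g_lim: "(\<lambda>n. g n t) \<longlonglongrightarrow> complex_of_real (exp (- t\<^sup>2 / 2))" for t
  proof -
    define E where "E n = exp (6146 * \<bar>t\<bar> ^ 3 / (\<beta> n * \<sigma> n) + 16 * t ^ 4 / (\<beta> n * \<sigma> n)\<^sup>2) - 1" for n
    have E_lim: "E \<longlonglongrightarrow> 0"
    proof -
      have "filterlim (\<lambda>n. (\<beta> n * \<sigma> n)\<^sup>2) at_top sequentially"
        using \<beta>\<sigma>_lim by (intro filterlim_pow_at_top) auto
      hence "(\<lambda>n. exp (6146 * \<bar>t\<bar> ^ 3 / (\<beta> n * \<sigma> n) + 16 * t ^ 4 / (\<beta> n * \<sigma> n)\<^sup>2) - 1) \<longlonglongrightarrow> exp (0 + 0) - 1"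
        using \<beta>\<sigma>_lim by (intro tendsto_intros real_tendsto_divide_at_top[OF tendsto_const])
      thus ?thesis by (simp add: E_def[abs_def])
    qed
    have big: "\<forall>\<^sub>F n in sequentially. n \<ge> n0 \<and> 4 * \<bar>t\<bar> \<le> \<beta> n * \<sigma> n"
      using \<beta>\<sigma>_lim by (intro eventually_conj eventually_ge_at_top) (auto simp: filterlim_at_top)
    define w where "w n = (SOME w. norm (w - 1) \<le> E n \<and>
       w * boltzmann_char A (\<beta> n) (S n) (t / \<sigma> n) = cis (mean_dim (\<beta> n) (S n) * (t / \<sigma> n)) * of_real (exp (- t\<^sup>2 / 2)))" for n
    have w: "norm (w n - 1) \<le> E n \<and>
       w n * boltzmann_char A (\<beta> n) (S n) (t / \<sigma> n) = cis (mean_dim (\<beta> n) (S n) * (t / \<sigma> n)) * of_real (exp (- t\<^sup>2 / 2))"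
      if "n \<ge> n0" "4 * \<bar>t\<bar> \<le> \<beta> n * \<sigma> n" for n
      unfolding w_def
    proof (rule someI_ex)
      show "\<exists>w. norm (w - 1) \<le> E n \<and>
       w * boltzmann_char A (\<beta> n) (S n) (t / \<sigma> n) = cis (mean_dim (\<beta> n) (S n) * (t / \<sigma> n)) * of_real (exp (- t\<^sup>2 / 2))"
        using boltzmann_char_near_gaussian[OF S(1,2) \<beta>(1) S(3) card[OF that(1)] that(2)[unfolded \<sigma>_def]]
        unfolding E_def \<sigma>_def by metis
    qed
    have "(\<lambda>n. w n - 1) \<longlonglongrightarrow> 0"
      by (rule Lim_null_comparison[OF _ E_lim]) (use big w in \<open>auto elim!: eventually_mono\<close>)
    hence w_lim: "w \<longlonglongrightarrow> 1" by (simp add: LIM_zero_iff)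
    have "(\<lambda>n. t * ((N n - mean_dim (\<beta> n) (S n)) / \<sigma> n)) \<longlonglongrightarrow> t * 0"
      using mean by (intro tendsto_intros) (simp add: \<sigma>_def)
    hence cis_lim: "(\<lambda>n. cis (- (t * ((N n - mean_dim (\<beta> n) (S n)) / \<sigma> n)))) \<longlonglongrightarrow> cis (- 0)"
      by (intro tendsto_intros) auto
    have lim: "(\<lambda>n. cis (- (t * ((N n - mean_dim (\<beta> n) (S n)) / \<sigma> n))) * of_real (exp (- t\<^sup>2 / 2)) / w n) \<longlonglongrightarrow> cis (- 0) * of_real (exp (- t\<^sup>2 / 2)) / 1"
      by (intro tendsto_divide[OF tendsto_mult[OF cis_lim tendsto_const] w_lim]) auto
    have ev: "\<forall>\<^sub>F n in sequentially. cis (- (t * ((N n - mean_dim (\<beta> n) (S n)) / \<sigma> n))) * of_real (exp (- t\<^sup>2 / 2)) / w n = g n t"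
      using big tendsto_imp_eventually_ne[OF w_lim, of 0, simplified]
    proof eventually_elim
      case (elim n)
      have \<sigma>: "\<sigma> n > 0" using \<beta>\<sigma> elim by auto
      have "\<beta> n \<le> 1"
      proof -
        have "1 / t0 \<le> 1 / 1" using t0(1) by (intro divide_left_mono) auto
        thus ?thesis using n0[of n] elim by auto
      qed
      hence "\<beta> n * \<sigma> n \<le> 1 * \<sigma> n" using \<sigma> by (intro mult_right_mono) auto
      hence "\<bar>t\<bar> \<le> \<sigma> n" using elim by linarith
      hence "\<bar>t / \<sigma> n\<bar> \<le> 1" using \<sigma> by (simp add: abs_divide)
      hence ind: "t / \<sigma> n \<in> {-pi..pi}" unfolding atLeastAtMost_iff using pi_gt3 by linarith
      have "boltzmann_char A (\<beta> n) (S n) (t / \<sigma> n) = cis (mean_dim (\<beta> n) (S n) * (t / \<sigma> n)) * of_real (exp (- t\<^sup>2 / 2)) / w n"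
        using w[of n] elim by (simp add: field_simps)
      hence "g n t = (cis (mean_dim (\<beta> n) (S n) * (t / \<sigma> n)) * cis (- (N n * (t / \<sigma> n)))) * of_real (exp (- t\<^sup>2 / 2)) / w n"
        using ind by (simp add: g_def)
      also have "cis (mean_dim (\<beta> n) (S n) * (t / \<sigma> n)) * cis (- (N n * (t / \<sigma> n))) = cis (- (t * ((N n - mean_dim (\<beta> n) (S n)) / \<sigma> n)))"
        using \<sigma> by (simp add: cis_mult diff_divide_distrib algebra_simps)
      finally show ?case by simp
    qed
    from Lim_transform_eventually[OF lim ev] show ?thesis by simp
  qed
  have "(\<lambda>n. \<integral>t. g (n + n0) t \<partial>lborel) \<longlonglongrightarrow> (\<integral>t. complex_of_real (exp (- t\<^sup>2 / 2)) \<partial>lborel)"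
  proof (rule integral_dominated_convergence)
    show "integrable lborel (\<lambda>t::real. 1 / c * (1 / (1 + t\<^sup>2)))"
      by (intro integrable_mult_right integrable_inverse_one_plus_square)
    show "AE t in lborel. (\<lambda>n. g (n + n0) t) \<longlonglongrightarrow> complex_of_real (exp (- t\<^sup>2 / 2))"
      using g_lim by (intro AE_I2 LIMSEQ_ignore_initial_segment)
    show "AE t in lborel. norm (g (n + n0) t) \<le> 1 / c * (1 / (1 + t\<^sup>2))" for n
    proof (rule AE_I2)
      fix t :: real
      define k where "k = n + n0"
      have k: "k \<ge> n0" by (simp add: k_def)
      have \<sigma>: "\<sigma> k > 0" using \<beta>\<sigma>[OF k] by simp
      show "norm (g (n + n0) t) \<le> 1 / c * (1 / (1 + t\<^sup>2))"
      proof (cases "\<bar>t / \<sigma> k\<bar> \<le> pi")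
        case True
        have "norm (boltzmann_char A (\<beta> k) (S k) (t / \<sigma> k)) \<le> 1 / (1 + c * ((t / \<sigma> k)\<^sup>2 * sigma2 (\<beta> k) (S k)))"
          using n0[OF k] by (intro decay \<beta> S True) auto
        also have "(t / \<sigma> k)\<^sup>2 * sigma2 (\<beta> k) (S k) = t\<^sup>2"
        proof -
          have "sigma2 (\<beta> k) (S k) = (\<sigma> k)\<^sup>2" using \<sigma> by (simp add: \<sigma>_def)
          thus ?thesis using \<sigma> by (simp add: power_divide)
        qed
        also have "1 / (1 + c * t\<^sup>2) \<le> 1 / (c * (1 + t\<^sup>2))"
          using c by (intro divide_left_mono mult_pos_pos) (auto simp: algebra_simps intro!: add_pos_nonneg)
        finally have "norm (boltzmann_char A (\<beta> k) (S k) (t / \<sigma> k)) \<le> 1 / (c * (1 + t\<^sup>2))" .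
        moreover have "t / \<sigma> k \<in> {-pi..pi}" unfolding atLeastAtMost_iff using True by linarith
        ultimately show ?thesis unfolding k_def[symmetric] by (simp add: g_def norm_mult)
      next
        case False
        hence "t / \<sigma> k \<notin> {-pi..pi}" by (auto simp: abs_le_iff)
        thus ?thesis using c unfolding k_def[symmetric] by (simp add: g_def add_nonneg_nonneg)
      qed
    qed
  qed (auto simp: g_def)
  also have "(\<integral>t. complex_of_real (exp (- t\<^sup>2 / 2)) \<partial>lborel) = of_real (sqrt (2 * pi))"
    by (subst integral_complex_of_real) (simp only: integral_gaussian)
  also have "(\<lambda>n. \<integral>t. g (n + n0) t \<partial>lborel) = (\<lambda>n. of_real (2 * pi * (\<sigma> (n + n0) * X (n + n0))))"
    using int_g by auto
  finally have "(\<lambda>n. 2 * pi * (\<sigma> (n + n0) * X (n + n0))) \<longlonglongrightarrow> sqrt (2 * pi)"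
    by (subst (asm) tendsto_of_real_iff)
  hence "(\<lambda>n. 2 * pi * (\<sigma> n * X n)) \<longlonglongrightarrow> sqrt (2 * pi)" by (rule LIMSEQ_offset)
  hence "(\<lambda>n. 2 * pi * (\<sigma> n * X n) / (2 * pi)) \<longlonglongrightarrow> sqrt (2 * pi) / (2 * pi)" by (intro tendsto_intros) auto
  moreover have "sqrt (2 * pi) / (2 * pi) = 1 / sqrt (2 * pi)" by (simp add: field_simps)
  ultimately show ?thesis by (simp add: \<sigma>_def X_def)
qed

end

section \<open>The Gumbel law for the largest part\<close>

text \<open>From \<open>- w - 2 * w\<^sup>2 \<le> ln (1 - w) \<le> - w\<close>, where the squares add up to
  at most \<open>s n\<close> times the sum.\<close>

lemma prod_one_minus_tendsto:
  fixes w :: "nat \<Rightarrow> 'k \<Rightarrow> real"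
  assumes "\<And>n. finite (F n)" "\<And>n k. k \<in> F n \<Longrightarrow> 0 \<le> w n k \<and> w n k \<le> s n" "s \<longlonglongrightarrow> 0"
    and "(\<lambda>n. \<Sum>k\<in>F n. w n k) \<longlonglongrightarrow> y"
  shows "(\<lambda>n. \<Prod>k\<in>F n. 1 - w n k) \<longlonglongrightarrow> exp (- y)"
proof (rule tendsto_sandwich)
  have "\<forall>\<^sub>F n in sequentially. s n < 1 / 2" using assms(3) by (rule order_tendstoD) simp
  thus "\<forall>\<^sub>F n in sequentially. exp (- (\<Sum>k\<in>F n. w n k) - 2 * s n * (\<Sum>k\<in>F n. w n k)) \<le> (\<Prod>k\<in>F n. 1 - w n k)"
  proof eventually_elim
    case (elim n)
    have "exp (- (\<Sum>k\<in>F n. w n k) - 2 * s n * (\<Sum>k\<in>F n. w n k)) = (\<Prod>k\<in>F n. exp (- w n k - 2 * s n * w n k))"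
      by (simp add: exp_sum[OF assms(1), symmetric] sum_subtractf sum_negf sum_distrib_left)
    also have "\<dots> \<le> (\<Prod>k\<in>F n. 1 - w n k)"
    proof (rule prod_mono, intro conjI)
      fix k assume k: "k \<in> F n"
      have w: "0 \<le> w n k" "w n k \<le> s n" "w n k \<le> 1 / 2" using assms(2)[OF k] elim by auto
      have "(w n k)\<^sup>2 \<le> s n * w n k" using w by (simp add: power2_eq_square mult_right_mono)
      hence "- w n k - 2 * s n * w n k \<le> ln (1 - w n k)"
        using ln_one_minus_pos_lower_bound[OF w(1,3)] by linarith
      thus "exp (- w n k - 2 * s n * w n k) \<le> 1 - w n k"
        using w by (subst (asm) ln_ge_iff) auto
    qed auto
    finally show ?case .
  qed
  show "\<forall>\<^sub>F n in sequentially. (\<Prod>k\<in>F n. 1 - w n k) \<le> exp (- (\<Sum>k\<in>F n. w n k))"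
    using \<open>\<forall>\<^sub>F n in sequentially. s n < 1 / 2\<close>
  proof eventually_elim
    case (elim n)
    have "(\<Prod>k\<in>F n. 1 - w n k) \<le> (\<Prod>k\<in>F n. exp (- w n k))"
    proof (rule prod_mono, intro conjI)
      fix k assume k: "k \<in> F n"
      show "0 \<le> 1 - w n k" using assms(2)[OF k] elim by auto
      show "1 - w n k \<le> exp (- w n k)" using exp_ge_add_one_self[of "- w n k"] by simp
    qed
    thus ?case by (simp add: exp_sum[OF assms(1), symmetric] sum_negf)
  qed
  show "(\<lambda>n. exp (- (\<Sum>k\<in>F n. w n k))) \<longlonglongrightarrow> exp (- y)" by (intro tendsto_intros assms)
  have "(\<lambda>n. exp (- (\<Sum>k\<in>F n. w n k) - 2 * s n * (\<Sum>k\<in>F n. w n k))) \<longlonglongrightarrow> exp (- y - 2 * 0 * y)"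
    by (intro tendsto_intros assms)
  thus "(\<lambda>n. exp (- (\<Sum>k\<in>F n. w n k) - 2 * s n * (\<Sum>k\<in>F n. w n k))) \<longlonglongrightarrow> exp (- y)" by simp
qed

context dimension_family
begin

text \<open>Of the decay \<open>exp (- 3 / 4 * \<beta> * A k)\<close> of a term, five eighths are extracted
  at \<open>A k \<ge> T\<close> and one eighth is left for the convergence of the sum. What
  matters later is that five eighths exceed one half.\<close>

lemma mean_tail_le:
  fixes T \<beta> :: real
  assumes "finite F" "F \<subseteq> W" "\<And>k. k \<in> F \<Longrightarrow> A k \<ge> T" "\<beta> > 0"
  shows "(\<Sum>k\<in>F. A k * mean_mult \<beta> (A k)) \<le> 8 * C / \<beta> * exp (- (5 / 8) * (\<beta> * T)) * (\<beta> / 8) powr - \<kappa>"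
proof -
  have "(\<Sum>k\<in>F. A k * mean_mult \<beta> (A k)) \<le> (\<Sum>k\<in>F. 4 / \<beta> * exp (- (5 / 8) * (\<beta> * T)) * exp (- (\<beta> / 8 * A k)))"
  proof (rule sum_mono)
    fix k assume k: "k \<in> F"
    have "A k * mean_mult \<beta> (A k) \<le> 4 / \<beta> * exp (- (3 / 4) * (\<beta> * A k))"
      using A_pos[of k] k assms by (intro mean_mult_le) auto
    also have "\<dots> \<le> 4 / \<beta> * exp (- (5 / 8) * (\<beta> * T) - \<beta> / 8 * A k)"
    proof -
      have "\<beta> * T \<le> \<beta> * A k" using assms(3)[OF k] assms(4) by (intro mult_left_mono) auto
      thus ?thesis using assms(4) by (intro mult_left_mono) (auto simp: field_simps)
    qed
    also have "\<dots> = 4 / \<beta> * exp (- (5 / 8) * (\<beta> * T)) * exp (- (\<beta> / 8 * A k))"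
      by (simp add: exp_add[symmetric])
    finally show "A k * mean_mult \<beta> (A k) \<le> 4 / \<beta> * exp (- (5 / 8) * (\<beta> * T)) * exp (- (\<beta> / 8 * A k))" .
  qed
  also have "\<dots> = 4 / \<beta> * exp (- (5 / 8) * (\<beta> * T)) * (\<Sum>k\<in>F. exp (- (\<beta> / 8 * A k)))"
    by (simp add: sum_distrib_left)
  also have "\<dots> \<le> 4 / \<beta> * exp (- (5 / 8) * (\<beta> * T)) * (2 * C * (\<beta> / 8) powr - \<kappa>)"
    using assms by (intro mult_left_mono sum_exp_le) auto
  finally show ?thesis by (simp add: mult_ac)
qed

lemma mean_term_nonneg: "k \<in> W \<Longrightarrow> \<beta> > 0 \<Longrightarrow> A k * mean_mult \<beta> (A k) \<ge> 0"
  using mean_mult_bounds(1)[of \<beta> "A k"] A_pos[of k] by simp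

lemma mean_gap:
  assumes "\<beta> > 0" "((\<lambda>k. A k * mean_mult \<beta> (A k)) has_sum x) W"
  shows "mean_dim \<beta> (below T) \<le> x"
    and "x - mean_dim \<beta> (below T) \<le> 8 * C / \<beta> * exp (- (5 / 8) * (\<beta> * T)) * (\<beta> / 8) powr - \<kappa>"
proof -
  define f where "f k = A k * mean_mult \<beta> (A k)" for k
  define B where "B = 8 * C / \<beta> * exp (- (5 / 8) * (\<beta> * T)) * (\<beta> / 8) powr - \<kappa>"
  have nonneg: "f k \<ge> 0" if "k \<in> W" for k using mean_term_nonneg[OF that assms(1)] by (simp add: f_def)
  have hs: "(f has_sum x) W" using assms(2) by (simp add: f_def[abs_def])
  have md: "mean_dim \<beta> (below T) = sum f (below T)" by (simp add: mean_dim_def f_def)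
  show "mean_dim \<beta> (below T) \<le> x"
    unfolding md using nonneg by (intro finite_sum_le_has_sum[OF hs]) (auto simp: below_def finite_below)
  have "x \<le> sum f (below T) + B"
  proof (rule has_sum_le_finite_sums[OF hs])
    fix F assume F: "finite F" "F \<subseteq> W"
    have "sum f F = sum f (F \<inter> below T) + sum f (F - below T)"
      using F by (simp add: sum.Int_Diff)
    also have "sum f (F \<inter> below T) \<le> sum f (below T)"
      using nonneg by (intro sum_mono2) (auto simp: below_def finite_below)
    also have "sum f (F - below T) \<le> B"
      unfolding f_def B_def using F assms by (intro mean_tail_le) (auto simp: below_def)
    finally show "sum f F \<le> sum f (below T) + B" by simp
  qed
  thus "x - mean_dim \<beta> (below T) \<le> 8 * C / \<beta> * exp (- (5 / 8) * (\<beta> * T)) * (\<beta> / 8) powr - \<kappa>"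
    by (simp add: md B_def)
qed

text \<open>The expected total weight is bounded as long as \<open>\<beta>\<close> stays away from
  \<open>0\<close>.\<close>

lemma temperature_tendsto_0:
  fixes \<beta> :: "nat \<Rightarrow> real"
  assumes "\<And>n. \<beta> n > 0" "\<And>n. n \<ge> 1 \<Longrightarrow> ((\<lambda>k. A k * mean_mult (\<beta> n) (A k)) has_sum real n) W"
  shows "\<beta> \<longlonglongrightarrow> 0"
proof (rule order_tendstoI)
  fix \<epsilon> :: real assume \<epsilon>: "0 < \<epsilon>"
  define U where "U = 8 * C / \<epsilon> * (\<epsilon> / 8) powr - \<kappa>"
  show "\<forall>\<^sub>F n in sequentially. \<beta> n < \<epsilon>"
    using eventually_gt_at_top[of "nat \<lceil>U\<rceil>"]
  proof eventually_elim
    case (elim n)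
    show ?case
    proof (rule ccontr)
      assume "\<not> \<beta> n < \<epsilon>"
      hence ge: "\<beta> n \<ge> \<epsilon>" by simp
      have "below 0 = {}" using A_pos by (force simp: below_def)
      hence "real n \<le> 8 * C / \<beta> n * (\<beta> n / 8) powr - \<kappa>"
        using mean_gap(2)[OF assms(1) assms(2)[of n], of 0] elim by (simp add: mean_dim_def)
      also have "\<dots> \<le> U" unfolding U_def
        using ge \<epsilon> C \<kappa> by (intro mult_mono divide_left_mono powr_mono2') auto
      finally show False using elim by linarith
    qed
  qed
next
  fix a :: real assume "a < 0"
  thus "\<forall>\<^sub>F n in sequentially. a < \<beta> n" using assms(1) by (intro always_eventually allI) (meson less_trans)
qed

text \<open>Each part of size at most \<open>1 / \<beta>\<close> contributes at least \<open>exp (-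
  1)\<close>. Hence the total weight is larger than \<open>1 / \<beta>\<close> by a factor of
  order \<open>\<beta> powr - \<kappa>\<close>, and truncation at the total weight itself is
  harmless.\<close>

lemma mean_dim_ge:
  assumes "\<beta> > 0"
  shows "\<beta> * mean_dim \<beta> (below (1 / \<beta>)) \<ge> card (below (1 / \<beta>)) / 3"
proof -
  have "card (below (1 / \<beta>)) / 3 = (\<Sum>k\<in>below (1 / \<beta>). 1 / 3)" by simp
  also have "\<dots> \<le> (\<Sum>k\<in>below (1 / \<beta>). \<beta> * (A k * mean_mult \<beta> (A k)))"
  proof (rule sum_mono)
    fix k assume k: "k \<in> below (1 / \<beta>)"
    define x where "x = \<beta> * A k"
    have x: "\<beta> * real (A k) > 0" "x \<le> 1" using k assms A_pos by (auto simp: below_def field_simps x_def)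
    have "1 / 3 \<le> exp (- 1 :: real)" using exp_le by (simp add: exp_minus field_simps)
    also have "\<dots> \<le> exp (- x)" using x by simp
    also have "\<dots> \<le> exp (- x) * (x * (mean_mult \<beta> (A k) + 1))"
      using mean_mult_bounds(3)[OF x(1)] by (simp add: x_def)
    also have "\<dots> = x * mean_mult \<beta> (A k)"
      using mean_mult_bounds(5)[OF x(1)] by (simp add: x_def)
    finally show "1 / 3 \<le> \<beta> * (A k * mean_mult \<beta> (A k))" by (simp add: x_def)
  qed
  also have "\<dots> = \<beta> * mean_dim \<beta> (below (1 / \<beta>))" by (simp add: mean_dim_def sum_distrib_left)
  finally show ?thesis .
qed

lemma count_ge_half_at_right:
  "\<forall>\<^sub>F \<beta> in at_right 0. C / 2 * \<beta> powr - \<kappa> \<le> card (below (1 / \<beta>))"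
proof -
  obtain t0 where t0: "t0 \<ge> 1" "\<And>t. t \<ge> t0 \<Longrightarrow> C / 2 * t powr \<kappa> \<le> card (below t)"
    by (rule count_ge_half) blast
  show ?thesis
  proof (rule eventually_at_rightI[of 0 "1 / t0"])
    fix \<beta> assume \<beta>: "\<beta> \<in> {0<..<1 / t0}"
    hence "t0 \<le> 1 / \<beta>" using t0(1) by (simp add: field_simps)
    from t0(2)[OF this] show "C / 2 * \<beta> powr - \<kappa> \<le> card (below (1 / \<beta>))"
      using \<beta> by (simp add: powr_divide powr_minus divide_simps)
  qed (use t0 in auto)
qed

text \<open>The expected total weight of all parts is \<open>N n\<close>, so only the mean beyond \<open>T
  n\<close> has to be compared with the standard deviation. By \<open>mean_gap\<close> the former
  is of order at most \<open>\<beta> powr (- 1 - 7 / 16 * \<kappa>)\<close> and the latter is of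
  order at least \<open>\<beta> powr (- 1 - \<kappa> / 2)\<close>. The exponent \<open>9 /
  10\<close> could be any number between \<open>4 / 5\<close> and \<open>1\<close>; it is below
  \<open>1\<close> to cover the logarithmic factor in the threshold for the largest part.\<close>

lemma truncated_local_limit:
  fixes \<beta> T :: "nat \<Rightarrow> real" and N :: "nat \<Rightarrow> nat"
  assumes \<beta>: "\<And>n. \<beta> n > 0" "\<beta> \<longlonglongrightarrow> 0"
    and N: "\<And>n. ((\<lambda>k. A k * mean_mult (\<beta> n) (A k)) has_sum real (N n)) W"
    and count: "\<And>n. C / 2 * \<beta> n powr - \<kappa> \<le> card (below (1 / \<beta> n))"
    and T: "\<And>n. 1 / \<beta> n \<le> T n" "\<And>n. exp (- (\<beta> n * T n)) \<le> \<beta> n powr (9 / 10 * \<kappa>)"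
  shows "(\<lambda>n. sqrt (sigma2 (\<beta> n) (below (T n))) * (card (partitions_into A (below (T n)) (N n)) *
     exp (- \<beta> n * N n) * (\<Prod>k\<in>below (T n). 1 - exp (- \<beta> n * A k)))) \<longlonglongrightarrow> 1 / sqrt (2 * pi)"
proof (rule local_limit[OF \<beta>])
  show sub: "below (1 / \<beta> n) \<subseteq> below (T n)" for n using T(1)[of n] by (auto simp: below_def)
  show W: "below (T n) \<subseteq> W" for n by (auto simp: below_def)
  define G where "G b = (8 * C / b * (b powr (9 / 10 * \<kappa>)) powr (5 / 8) * (b / 8) powr - \<kappa>) / (sqrt (C / 6 * b powr - \<kappa>) / b)" for b
  have "filterlim \<beta> (at_right 0) sequentially"
    using \<beta> by (intro tendsto_imp_filterlim_at_right) auto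
  moreover have "(G \<longlongrightarrow> 0) (at_right 0)"
    unfolding G_def using C \<kappa> by real_asymp
  ultimately have G: "(\<lambda>n. G (\<beta> n)) \<longlonglongrightarrow> 0" by (rule filterlim_compose[rotated])
  show "(\<lambda>n. (real (N n) - mean_dim (\<beta> n) (below (T n))) / sqrt (sigma2 (\<beta> n) (below (T n)))) \<longlonglongrightarrow> 0"
  proof (rule Lim_null_comparison[OF always_eventually G], intro allI)
    fix n
    define b where "b = \<beta> n"
    have b: "b > 0" using \<beta> by (simp add: b_def)
    have s2: "b\<^sup>2 * sigma2 b (below (T n)) \<ge> C / 6 * b powr - \<kappa>"
      unfolding b_def using \<beta> sub W count by (intro sigma2_ge_powr) auto
    have den: "sqrt (C / 6 * b powr - \<kappa>) / b \<le> sqrt (sigma2 b (below (T n)))"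
    proof -
      have "sqrt (C / 6 * b powr - \<kappa>) \<le> sqrt (b\<^sup>2 * sigma2 b (below (T n)))" using s2 by (rule real_sqrt_le_mono)
      also have "\<dots> = b * sqrt (sigma2 b (below (T n)))" using b by (simp add: real_sqrt_mult)
      finally show ?thesis using b by (simp add: field_simps)
    qed
    have "exp (- (5 / 8) * (b * T n)) = exp (- (b * T n)) powr (5 / 8)" by (simp add: powr_def)
    also have "\<dots> \<le> (b powr (9 / 10 * \<kappa>)) powr (5 / 8)"
      using T(2)[of n] by (intro powr_mono2) (auto simp: b_def)
    finally have "8 * C / b * exp (- (5 / 8) * (b * T n)) * (b / 8) powr - \<kappa> \<le>
        8 * C / b * (b powr (9 / 10 * \<kappa>)) powr (5 / 8) * (b / 8) powr - \<kappa>"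
      using b C by (intro mult_right_mono mult_left_mono) auto
    hence num: "real (N n) - mean_dim b (below (T n)) \<le> 8 * C / b * (b powr (9 / 10 * \<kappa>)) powr (5 / 8) * (b / 8) powr - \<kappa>"
      using mean_gap(2)[OF \<beta>(1) N[of n], of "T n"] by (simp add: b_def)
    have num0: "real (N n) - mean_dim b (below (T n)) \<ge> 0"
      using mean_gap(1)[OF \<beta>(1) N[of n], of "T n"] by (simp add: b_def)
    have "sqrt (C / 6 * b powr - \<kappa>) / b > 0" using C b by simp
    hence "(real (N n) - mean_dim b (below (T n))) / sqrt (sigma2 b (below (T n))) \<le> G b"
      unfolding G_def using num num0 den by (intro frac_le) auto
    moreover have "(real (N n) - mean_dim b (below (T n))) / sqrt (sigma2 b (below (T n))) \<ge> 0"
      using num0 \<open>sqrt (C / 6 * b powr - \<kappa>) / b > 0\<close> den by (intro divide_nonneg_nonneg) linarith+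
    ultimately show "norm ((real (N n) - mean_dim (\<beta> n) (below (T n))) / sqrt (sigma2 (\<beta> n) (below (T n)))) \<le> G (\<beta> n)"
      by (simp add: b_def)
  qed
qed auto

text \<open>The parts above \<open>d n\<close> contribute to the variance only a fraction of order
  \<open>exp (- \<beta> * d / 4)\<close>.\<close>

lemma sigma2_ratio_tendsto:
  fixes \<beta> d T :: "nat \<Rightarrow> real"
  assumes \<beta>: "\<And>n. \<beta> n > 0"
    and count: "\<And>n. C / 2 * \<beta> n powr - \<kappa> \<le> card (below (1 / \<beta> n))"
    and d: "\<And>n. 1 / \<beta> n \<le> d n" "\<And>n. d n \<le> T n" "filterlim (\<lambda>n. \<beta> n * d n) at_top sequentially"
  shows "(\<lambda>n. sqrt (sigma2 (\<beta> n) (below (T n))) / sqrt (sigma2 (\<beta> n) (below (d n)))) \<longlonglongrightarrow> 1"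
proof -
  define D where "D n = sigma2 (\<beta> n) (below (T n)) - sigma2 (\<beta> n) (below (d n))" for n
  have s2: "(\<beta> n)\<^sup>2 * sigma2 (\<beta> n) (below (d n)) \<ge> C / 6 * \<beta> n powr - \<kappa>" for n
    using \<beta> count d(1)[of n] by (intro sigma2_ge_powr) (auto simp: below_def finite_below)
  have pos: "sigma2 (\<beta> n) (below (d n)) > 0" for n
  proof -
    have "C / 6 * \<beta> n powr - \<kappa> > 0" using C \<beta>[of n] by simp
    hence "(\<beta> n)\<^sup>2 * sigma2 (\<beta> n) (below (d n)) > 0" using s2[of n] by linarith
    thus ?thesis by (simp add: zero_less_mult_iff)
  qed
  have D: "0 \<le> D n \<and> (\<beta> n)\<^sup>2 * D n \<le> 128 * C * exp (- (\<beta> n * d n) / 4) * \<beta> n powr - \<kappa>" for n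
  proof
    have sub: "below (d n) \<subseteq> below (T n)" using d(2)[of n] by (auto simp: below_def)
    have eq: "D n = (\<Sum>k\<in>below (T n) - below (d n). (real (A k))\<^sup>2 * var_mult (\<beta> n) (A k))"
      unfolding D_def sigma2_def using sub by (subst sum_diff) auto
    have W: "below (T n) - below (d n) \<subseteq> W" by (auto simp: below_def)
    show "0 \<le> D n" unfolding eq
      using W A_pos \<beta>[of n] by (intro sum_nonneg mult_nonneg_nonneg var_mult_nonneg) auto
    have "D n \<le> (\<Sum>k\<in>below (T n) - below (d n). 16 / (\<beta> n)\<^sup>2 * exp (- (\<beta> n * d n) / 4) * exp (- (\<beta> n / 4 * A k)))"
      unfolding eq
    proof (rule sum_mono)
      fix k assume k: "k \<in> below (T n) - below (d n)"
      hence "k \<in> W" "d n \<le> A k" by (auto simp: below_def)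
      have "(real (A k))\<^sup>2 * var_mult (\<beta> n) (A k) \<le> 16 / (\<beta> n)\<^sup>2 * exp (- (\<beta> n * A k) / 2)"
        using A_pos[OF \<open>k \<in> W\<close>] \<beta>[of n] by (intro var_mult_bounds) auto
      also have "\<dots> \<le> 16 / (\<beta> n)\<^sup>2 * exp (- (\<beta> n * d n) / 4 - \<beta> n / 4 * A k)"
      proof -
        have "\<beta> n * d n \<le> \<beta> n * A k" using \<open>d n \<le> A k\<close> \<beta>[of n] by (intro mult_left_mono) auto
        thus ?thesis by (intro mult_left_mono) auto
      qed
      also have "\<dots> = 16 / (\<beta> n)\<^sup>2 * exp (- (\<beta> n * d n) / 4) * exp (- (\<beta> n / 4 * A k))"
        by (simp add: exp_add[symmetric])
      finally show "(real (A k))\<^sup>2 * var_mult (\<beta> n) (A k) \<le> 16 / (\<beta> n)\<^sup>2 * exp (- (\<beta> n * d n) / 4) * exp (- (\<beta> n / 4 * A k))" .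
    qed
    also have "\<dots> = 16 / (\<beta> n)\<^sup>2 * exp (- (\<beta> n * d n) / 4) * (\<Sum>k\<in>below (T n) - below (d n). exp (- (\<beta> n / 4 * A k)))"
      by (simp add: sum_distrib_left)
    also have "\<dots> \<le> 16 / (\<beta> n)\<^sup>2 * exp (- (\<beta> n * d n) / 4) * (2 * C * (\<beta> n / 4) powr - \<kappa>)"
      using W \<beta>[of n] by (intro mult_left_mono sum_exp_le) auto
    also have "(\<beta> n / 4) powr - \<kappa> = 4 powr \<kappa> * \<beta> n powr - \<kappa>"
      using \<beta>[of n] by (simp add: powr_divide powr_minus field_simps)
    also have "16 / (\<beta> n)\<^sup>2 * exp (- (\<beta> n * d n) / 4) * (2 * C * (4 powr \<kappa> * \<beta> n powr - \<kappa>)) \<le>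
        16 / (\<beta> n)\<^sup>2 * exp (- (\<beta> n * d n) / 4) * (2 * C * (4 powr 1 * \<beta> n powr - \<kappa>))"
      using \<kappa> C by (intro mult_left_mono mult_right_mono powr_mono) auto
    finally show "(\<beta> n)\<^sup>2 * D n \<le> 128 * C * exp (- (\<beta> n * d n) / 4) * \<beta> n powr - \<kappa>"
      using \<beta>[of n] by (simp add: field_simps)
  qed
  have "(\<lambda>n. D n / sigma2 (\<beta> n) (below (d n))) \<longlonglongrightarrow> 0"
  proof (rule Lim_null_comparison)
    have "((\<lambda>x::real. exp (- x / 4)) \<longlongrightarrow> 0) at_top" by real_asymp
    hence "(\<lambda>n. exp (- (\<beta> n * d n) / 4)) \<longlonglongrightarrow> 0"
      using d(3) by (rule filterlim_compose)
    thus "(\<lambda>n. 768 * exp (- (\<beta> n * d n) / 4)) \<longlonglongrightarrow> 0" by (intro tendsto_mult_right_zero)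
    show "\<forall>\<^sub>F n in sequentially. norm (D n / sigma2 (\<beta> n) (below (d n))) \<le> 768 * exp (- (\<beta> n * d n) / 4)"
    proof (intro always_eventually allI)
      fix n
      have "(\<beta> n)\<^sup>2 * D n \<le> 768 * exp (- (\<beta> n * d n) / 4) * (C / 6 * \<beta> n powr - \<kappa>)" using D[of n] by (simp add: mult_ac)
      also have "\<dots> \<le> 768 * exp (- (\<beta> n * d n) / 4) * ((\<beta> n)\<^sup>2 * sigma2 (\<beta> n) (below (d n)))"
        using s2[of n] by (intro mult_left_mono) auto
      finally have "(\<beta> n)\<^sup>2 * D n \<le> (\<beta> n)\<^sup>2 * (768 * exp (- (\<beta> n * d n) / 4) * sigma2 (\<beta> n) (below (d n)))"
        by (simp add: mult_ac)
      hence "D n \<le> 768 * exp (- (\<beta> n * d n) / 4) * sigma2 (\<beta> n) (below (d n))"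
        using \<beta>[of n] by (subst (asm) mult_le_cancel_left_pos) auto
      thus "norm (D n / sigma2 (\<beta> n) (below (d n))) \<le> 768 * exp (- (\<beta> n * d n) / 4)"
        using pos[of n] D[of n] by (simp add: abs_divide divide_le_eq)
    qed
  qed
  hence "(\<lambda>n. sqrt (1 + D n / sigma2 (\<beta> n) (below (d n)))) \<longlonglongrightarrow> sqrt (1 + 0)" by (intro tendsto_intros)
  moreover have "sqrt (1 + D n / sigma2 (\<beta> n) (below (d n))) = sqrt (sigma2 (\<beta> n) (below (T n))) / sqrt (sigma2 (\<beta> n) (below (d n)))" for n
    using pos[of n] by (simp add: D_def real_sqrt_divide[symmetric] field_simps)
  ultimately show ?thesis by simp
qed

end

text \<open>The threshold for the largest part, multiplied by \<open>\<beta> = b\<close>. The terms without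
  \<open>x\<close> are the centring constants of the limit law, with \<open>ln (b powr -
  \<kappa>)\<close> written as \<open>- \<kappa> * ln b\<close>.\<close>

definition gumbel_level :: "real \<Rightarrow> real \<Rightarrow> real \<Rightarrow> real \<Rightarrow> real" where
  "gumbel_level \<kappa> C x b = x + (- \<kappa> * ln b) - (1 - \<kappa>) * ln (- \<kappa> * ln b) + ln (\<kappa> * C)"

text \<open>The second limit is the reason for the shape of the level \<open>L\<close>: near \<open>d = L b
  / b\<close> there are about \<open>C * \<kappa> * d powr (\<kappa> - 1) / b\<close> dimensions
  in a window of length \<open>1 / b\<close>, and the logarithmic term in \<open>L\<close>
  compensates the factor \<open>L powr (\<kappa> - 1)\<close>. The third limit is where the power
  saving \<open>\<delta>\<close> is consumed.\<close>

lemma gumbel_level_asymptotics: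
  fixes \<kappa> C x \<delta> K :: real
  assumes "0 < \<kappa>" "\<kappa> < 1" "0 < C" "0 < \<delta>" "\<delta> < \<kappa>"
  defines "L \<equiv> gumbel_level \<kappa> C x"
  shows "filterlim L at_top (at_right 0)"
    and "((\<lambda>b. C * \<kappa> * (L b / b) powr (\<kappa> - 1) / b * exp (- L b)) \<longlongrightarrow> exp (- x)) (at_right 0)"
    and "((\<lambda>b. K * (L b / b) powr (\<kappa> - \<delta>) * exp (- L b)) \<longlongrightarrow> 0) (at_right 0)"
    and "\<forall>\<^sub>F b in at_right 0. exp (- L b) \<le> b powr (9 / 10 * \<kappa>)"
    and "filterlim (\<lambda>b. C / 6 * b powr - \<kappa> - L b) at_top (at_right 0)"
    and "\<forall>\<^sub>F b in at_right 0. exp (- (C / 6 * b powr - \<kappa>)) \<le> b powr (9 / 10 * \<kappa>)"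
proof -
  have pos: "\<kappa> * C > 0" "1 - \<kappa> > 0" "\<kappa> - \<delta> > 0" using assms by auto
  have eq: "C * \<kappa> * \<kappa> powr (\<kappa> - 1) * exp ((1 - \<kappa>) * ln \<kappa> - x - ln (\<kappa> * C)) = exp (- x)"
  proof -
    have "\<kappa> powr (\<kappa> - 1) * exp ((1 - \<kappa>) * ln \<kappa> - x - ln (\<kappa> * C)) = exp (- x - ln (\<kappa> * C))"
      using assms(1) by (simp add: powr_def exp_add[symmetric] algebra_simps)
    also have "\<dots> = exp (- x) / (\<kappa> * C)" using pos(1) by (simp only: exp_diff exp_ln)
    finally show ?thesis using assms by (simp add: mult.assoc)
  qed
  show "filterlim L at_top (at_right 0)"
    unfolding L_def gumbel_level_def using assms(1-5) pos by real_asymp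
  show "((\<lambda>b. C * \<kappa> * (L b / b) powr (\<kappa> - 1) / b * exp (- L b)) \<longlongrightarrow> exp (- x)) (at_right 0)"
    unfolding L_def gumbel_level_def using assms(1-5) pos by real_asymp (rule eq)
  show "((\<lambda>b. K * (L b / b) powr (\<kappa> - \<delta>) * exp (- L b)) \<longlongrightarrow> 0) (at_right 0)"
    unfolding L_def gumbel_level_def using assms(1-5) pos by real_asymp
  show "\<forall>\<^sub>F b in at_right 0. exp (- L b) \<le> b powr (9 / 10 * \<kappa>)"
    unfolding L_def gumbel_level_def using assms(1-5) pos by real_asymp
  show "filterlim (\<lambda>b. C / 6 * b powr - \<kappa> - L b) at_top (at_right 0)"
    unfolding L_def gumbel_level_def using assms(1-5) pos by real_asymp
  show "\<forall>\<^sub>F b in at_right 0. exp (- (C / 6 * b powr - \<kappa>)) \<le> b powr (9 / 10 * \<kappa>)"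
    using assms(1-5) pos by real_asymp
qed

context dimension_family
begin

text \<open>Dividing the local limit theorems for the parts up to \<open>d n\<close> and for all parts up to
  the total weight, the probabilities and the factors \<open>exp (- \<beta> * n)\<close> cancel.
  What is left of the normalizing products is the product over the parts in between, to which
  \<open>tail_sum_tendsto\<close> and \<open>prod_one_minus_tendsto\<close> apply.\<close>

theorem partitions_max_part_gumbel:
  fixes \<beta> :: "nat \<Rightarrow> real" and x :: real
  assumes \<beta>: "\<And>n. \<beta> n > 0"
    and mean: "\<And>n. n \<ge> 1 \<Longrightarrow> ((\<lambda>k. A k * mean_mult (\<beta> n) (A k)) has_sum real n) W"
  shows "(\<lambda>n. card (partitions_into A (below (gumbel_level \<kappa> C x (\<beta> n) / \<beta> n)) n) /
     card (partitions_into A (below n) n)) \<longlonglongrightarrow> exp (- exp (- x))"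
proof -
  define L where "L = gumbel_level \<kappa> C x"
  note L = gumbel_level_asymptotics(1-5)[where x = x, OF \<kappa> C \<delta>, folded L_def]
  note L6 = gumbel_level_asymptotics(6)[OF \<kappa> C \<delta>]
  have \<beta>_lim: "\<beta> \<longlonglongrightarrow> 0" using \<beta> mean by (rule temperature_tendsto_0)
  have \<beta>_right: "filterlim \<beta> (at_right 0) sequentially"
    using \<beta>_lim \<beta> by (intro tendsto_imp_filterlim_at_right) auto
  define good where "good b \<longleftrightarrow> C / 2 * b powr - \<kappa> \<le> card (below (1 / b)) \<and> b < 1 \<and> 1 \<le> L b \<and>
     exp (- L b) \<le> b powr (9 / 10 * \<kappa>) \<and> 0 \<le> C / 6 * b powr - \<kappa> - L b \<and>
     exp (- (C / 6 * b powr - \<kappa>)) \<le> b powr (9 / 10 * \<kappa>)" for b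
  have "\<forall>\<^sub>F b in at_right 0. good b"
    unfolding good_def
  proof (intro eventually_conj count_ge_half_at_right L(4) L6)
    show "\<forall>\<^sub>F b in at_right 0. 1 \<le> L b" using L(1) unfolding filterlim_at_top by blast
    show "\<forall>\<^sub>F b in at_right 0. 0 \<le> C / 6 * b powr - \<kappa> - L b"
      using L(5) unfolding filterlim_at_top by blast
    show "\<forall>\<^sub>F b in at_right 0. b < (1::real)" by (rule eventually_at_rightI[of 0 1]) auto
  qed
  from eventually_compose_filterlim[OF this \<beta>_right]
  have "\<forall>\<^sub>F n in sequentially. n \<ge> 1 \<and> good (\<beta> n)"
    by (rule eventually_conj[OF eventually_ge_at_top])
  then obtain n0 where n0: "n \<ge> n0 \<Longrightarrow> n \<ge> 1 \<and> good (\<beta> n)" for n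
    by (auto simp: eventually_sequentially)
  \<comment> \<open>Shifting the index makes the eventual properties hold for every \<open>n\<close>.\<close>
  define b where "b n = \<beta> (n + n0)" for n
  define N where "N n = n + n0" for n
  define d where "d n = L (b n) / b n" for n
  have b: "b n > 0" for n using \<beta> by (simp add: b_def)
  have b_lim: "b \<longlonglongrightarrow> 0" unfolding b_def using \<beta>_lim by (rule LIMSEQ_ignore_initial_segment)
  have b_right: "filterlim b (at_right 0) sequentially"
    using b_lim b by (intro tendsto_imp_filterlim_at_right) auto
  have N: "((\<lambda>k. A k * mean_mult (b n) (A k)) has_sum real (N n)) W" for n
    using n0[of "n + n0"] mean[of "n + n0"] by (simp add: b_def N_def)
  have count: "C / 2 * b n powr - \<kappa> \<le> card (below (1 / b n))" and b1: "b n < 1" and L1: "1 \<le> L (b n)"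
    and eL: "exp (- L (b n)) \<le> b n powr (9 / 10 * \<kappa>)" and LC: "L (b n) \<le> C / 6 * b n powr - \<kappa>"
    and eC: "exp (- (C / 6 * b n powr - \<kappa>)) \<le> b n powr (9 / 10 * \<kappa>)" for n
    using n0[of "n + n0"] by (simp_all add: b_def good_def)
  have bd: "b n * d n = L (b n)" for n using b[of n] by (simp add: d_def)
  have d_ge: "1 / b n \<le> d n" for n using L1[of n] b[of n] by (simp add: d_def divide_right_mono)
  have d1: "1 \<le> d n" for n
  proof -
    have "1 \<le> 1 / b n" using b[of n] b1[of n] by simp
    thus ?thesis using d_ge[of n] by linarith
  qed
  have bN: "C / 6 * b n powr - \<kappa> \<le> b n * N n" for n
  proof -
    have "C / 6 * b n powr - \<kappa> \<le> card (below (1 / b n)) / 3" using count[of n] by simp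
    also have "\<dots> \<le> b n * mean_dim (b n) (below (1 / b n))" by (rule mean_dim_ge[OF b])
    also have "\<dots> \<le> b n * N n" using b[of n] mean_gap(1)[OF b N] by (intro mult_left_mono) auto
    finally show ?thesis .
  qed
  have dN: "d n \<le> N n" for n
  proof -
    have "b n * d n \<le> b n * N n" using bd[of n] LC[of n] bN[of n] by linarith
    thus ?thesis using b[of n] by simp
  qed
  have L_at_top: "filterlim (\<lambda>n. b n * d n) at_top sequentially"
    unfolding bd using L(1) b_right by (rule filterlim_compose)
  define X where "X T n = sqrt (sigma2 (b n) (below (T n))) * (card (partitions_into A (below (T n)) (N n)) *
     exp (- b n * N n) * (\<Prod>k\<in>below (T n). 1 - exp (- b n * A k)))" for T n
  have Xd: "X d \<longlonglongrightarrow> 1 / sqrt (2 * pi)"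
    unfolding X_def using b b_lim N count d_ge eL
    by (intro truncated_local_limit) (auto simp: bd)
  have XN: "X (\<lambda>n. real (N n)) \<longlonglongrightarrow> 1 / sqrt (2 * pi)"
    unfolding X_def
  proof (intro truncated_local_limit b b_lim N count)
    show "1 / b n \<le> real (N n)" for n using d_ge[of n] dN[of n] by linarith
    show "exp (- (b n * real (N n))) \<le> b n powr (9 / 10 * \<kappa>)" for n
    proof -
      have "exp (- (b n * real (N n))) \<le> exp (- (C / 6 * b n powr - \<kappa>))" using bN[of n] by simp
      thus ?thesis using eC[of n] by linarith
    qed
  qed
  have sig: "(\<lambda>n. sqrt (sigma2 (b n) (below (N n))) / sqrt (sigma2 (b n) (below (d n)))) \<longlonglongrightarrow> 1"
    by (rule sigma2_ratio_tendsto[OF b count d_ge dN L_at_top])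
  define F where "F n = {k \<in> W. d n < A k \<and> A k \<le> real (N n)}" for n
  have "(\<lambda>n. \<Sum>k\<in>F n. exp (- (b n * A k))) \<longlonglongrightarrow> exp (- x)"
    unfolding F_def
  proof (rule tail_sum_tendsto[OF b d1 dN])
    show "(\<lambda>n. C * \<kappa> * d n powr (\<kappa> - 1) / b n * exp (- (b n * d n))) \<longlonglongrightarrow> exp (- x)"
      unfolding bd unfolding d_def by (rule filterlim_compose[OF L(2) b_right])
    show "(\<lambda>n. K * d n powr (\<kappa> - \<delta>) * exp (- (b n * d n))) \<longlonglongrightarrow> 0"
      unfolding bd unfolding d_def by (rule filterlim_compose[OF L(3) b_right])
    show "filterlim (\<lambda>n. b n * d n) at_top sequentially" by (rule L_at_top)
    show "filterlim (\<lambda>n. b n * (real (N n) - d n)) at_top sequentially"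
    proof (rule filterlim_at_top_mono)
      show "filterlim (\<lambda>n. C / 6 * b n powr - \<kappa> - L (b n)) at_top sequentially"
        by (rule filterlim_compose[OF L(5) b_right])
      show "\<forall>\<^sub>F n in sequentially. C / 6 * b n powr - \<kappa> - L (b n) \<le> b n * (real (N n) - d n)"
        using bN bd by (simp add: right_diff_distrib)
    qed
  qed
  moreover have "finite (F n)" for n
    by (rule finite_subset[OF _ finite_below[of "N n"]]) (auto simp: F_def)
  moreover have "(\<lambda>n. exp (- (b n * d n))) \<longlonglongrightarrow> 0"
    by (rule filterlim_compose[OF exp_at_bot filterlim_compose[OF filterlim_uminus_at_bot_at_top L_at_top]])
  ultimately have Q: "(\<lambda>n. \<Prod>k\<in>F n. 1 - exp (- (b n * A k))) \<longlonglongrightarrow> exp (- exp (- x))"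
    using b by (intro prod_one_minus_tendsto[where s = "\<lambda>n. exp (- (b n * d n))"]) (auto simp: F_def)
  have "(\<lambda>n. X d n / X (\<lambda>n. real (N n)) n *
      ((sqrt (sigma2 (b n) (below (N n))) / sqrt (sigma2 (b n) (below (d n)))) * (\<Prod>k\<in>F n. 1 - exp (- (b n * A k)))))
      \<longlonglongrightarrow> (1 / sqrt (2 * pi)) / (1 / sqrt (2 * pi)) * (1 * exp (- exp (- x)))"
    by (intro tendsto_intros Xd XN sig Q) auto
  moreover have "X d n / X (\<lambda>n. real (N n)) n *
      ((sqrt (sigma2 (b n) (below (N n))) / sqrt (sigma2 (b n) (below (d n)))) * (\<Prod>k\<in>F n. 1 - exp (- (b n * A k)))) =
      card (partitions_into A (below (d n)) (N n)) / card (partitions_into A (below (N n)) (N n))" for n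
  proof -
    define P where "P S = (\<Prod>k\<in>S. 1 - exp (- b n * A k))" for S
    have Ppos: "P S > 0" if "S \<subseteq> W" for S
      unfolding P_def using that A_pos b[of n] by (intro prod_pos) auto
    have PN: "P (below (N n)) = P (below (d n)) * P (F n)"
    proof -
      have "below (N n) = below (d n) \<union> F n" using dN[of n] by (auto simp: below_def F_def)
      moreover have "below (d n) \<inter> F n = {}" by (auto simp: below_def F_def)
      ultimately show ?thesis unfolding P_def using \<open>\<And>n. finite (F n)\<close> by (simp add: prod.union_disjoint)
    qed
    have s: "sqrt (sigma2 (b n) (below T)) > 0" if "1 / b n \<le> T" for T
    proof -
      have "(b n)\<^sup>2 * sigma2 (b n) (below T) \<ge> C / 6 * b n powr - \<kappa>"
        using b count that by (intro sigma2_ge_powr) (auto simp: below_def finite_below)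
      moreover have "C / 6 * b n powr - \<kappa> > 0" using C b[of n] by simp
      ultimately have "(b n)\<^sup>2 * sigma2 (b n) (below T) > 0" by linarith
      thus ?thesis by (simp add: zero_less_mult_iff)
    qed
    have pos: "sqrt (sigma2 (b n) (below (d n))) > 0" "sqrt (sigma2 (b n) (below (N n))) > 0"
      "P (below (d n)) > 0" "P (F n) > 0" "exp (- b n * N n) > 0"
      using s[of "d n"] s[of "N n"] d_ge[of n] dN[of n] Ppos[of "below (d n)"] Ppos[of "F n"]
      by (auto simp: below_def F_def)
    have gen: "(s1 * (p1 * E * q1)) / (s2 * (p2 * E * (q1 * q2))) * ((s2 / s1) * q2) = p1 / p2"
      if "s1 > 0" "s2 > 0" "E > 0" "q1 > 0" "q2 > 0" for s1 s2 p1 p2 E q1 q2 :: real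
      using that by (simp add: field_simps)
    have "(\<Prod>k\<in>F n. 1 - exp (- (b n * A k))) = P (F n)" by (simp add: P_def)
    thus ?thesis
      unfolding X_def P_def[symmetric] PN using gen[OF pos(1,2,5,3,4)] by simp
  qed
  ultimately have "(\<lambda>n. card (partitions_into A (below (d n)) (N n)) / card (partitions_into A (below (N n)) (N n))) \<longlonglongrightarrow> exp (- exp (- x))"
    by simp
  hence "(\<lambda>n. card (partitions_into A (below (L (\<beta> (n + n0)) / \<beta> (n + n0))) (n + n0)) / card (partitions_into A (below (real (n + n0))) (n + n0))) \<longlonglongrightarrow> exp (- exp (- x))"
    by (simp only: d_def b_def N_def)
  thus ?thesis unfolding L_def[symmetric] by (rule LIMSEQ_offset)
qed

end

section \<open>Integrality of the Weyl dimension formula\<close>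

text \<open>The Newton basis polynomial of degree \<open>j\<close> with nodes \<open>x 0, ..., x (j -
  1)\<close>. For the nodes \<open>0, 1, 2, ...\<close> these are the falling factorials.\<close>

definition newton :: "(nat \<Rightarrow> int) \<Rightarrow> nat \<Rightarrow> int \<Rightarrow> int" where
  "newton x j t = (\<Prod>l<j. t - x l)"

text \<open>Multiplying by the next linear factor, use \<open>t - x j = (t - m) + (m - x j)\<close>: the
  first summand raises the degree of the falling factorial and the second one is an integer.\<close>

lemma newton_falling_factorial_expansion:
  "\<exists>u. u j = 1 \<and> (\<forall>t. newton x j t = (\<Sum>m\<le>j. u m * newton int m t))"
proof (induction j)
  case 0
  show ?case by (rule exI[of _ "\<lambda>_. 1"]) (simp add: newton_def)
next
  case (Suc j)
  then obtain u where u: "u j = 1" "\<And>t. newton x j t = (\<Sum>m\<le>j. u m * newton int m t)" by blast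
  define v where "v m = (if m = 0 then 0 else u (m - 1)) + (if m \<le> j then u m * (int m - x j) else 0)" for m
  have "newton x (Suc j) t = (\<Sum>m\<le>Suc j. v m * newton int m t)" for t
  proof -
    have "newton x (Suc j) t = newton x j t * (t - x j)"
      by (simp add: newton_def)
    also have "\<dots> = (\<Sum>m\<le>j. u m * newton int m t * (t - int m) + u m * (int m - x j) * newton int m t)"
      unfolding u(2) sum_distrib_right by (rule sum.cong) (auto simp: algebra_simps)
    also have "\<dots> = (\<Sum>m\<le>j. u m * newton int (Suc m) t) + (\<Sum>m\<le>j. u m * (int m - x j) * newton int m t)"
      by (simp add: sum.distrib newton_def mult.assoc)
    also have "(\<Sum>m\<le>j. u m * newton int (Suc m) t) =
        (\<Sum>m\<le>Suc j. (if m = 0 then 0 else u (m - 1)) * newton int m t)"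
      by (simp only: sum.atMost_Suc_shift[where n=j]) simp
    also have "(\<Sum>m\<le>j. u m * (int m - x j) * newton int m t) =
        (\<Sum>m\<le>Suc j. (if m \<le> j then u m * (int m - x j) else 0) * newton int m t)"
      by simp
    finally show ?thesis
      by (simp add: v_def sum.distrib[symmetric] algebra_simps)
  qed
  moreover have "v (Suc j) = 1" by (simp add: v_def u)
  ultimately show ?case by blast
qed

lemma newton_falling_factorial: "newton int m (int t) = int (t choose m) * fact m"
proof -
  have "real_of_int (newton int m (int t)) = (\<Prod>i<m. real t - real i)"
    by (simp add: newton_def)
  also have "\<dots> = of_nat (t choose m) * fact m"
    by (simp add: binomial_gbinomial gbinomial_mult_fact' lessThan_atLeast0)
  also have "\<dots> = real_of_int (int (t choose m) * fact m)" by simp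
  finally show ?thesis by linarith
qed

text \<open>The matrix of Newton polynomials evaluated at their own nodes is lower triangular, and its
  determinant is the Vandermonde product. Expanding them in falling factorials factors it into an
  integral matrix of binomial coefficients and an upper triangular matrix with diagonal
  \<open>fact 0, fact 1, ...\<close>.\<close>

lemma superfactorial_dvd_vandermonde:
  fixes x :: "nat \<Rightarrow> nat"
  shows "(\<Prod>i<n. fact i) dvd (\<Prod>j<n. \<Prod>l<j. int (x j) - int (x l))"
proof -
  have "\<exists>u. \<forall>j. u j j = 1 \<and> (\<forall>t. newton (int \<circ> x) j t = (\<Sum>m\<le>j. u j m * newton int m t))"
    using newton_falling_factorial_expansion[of _ "int \<circ> x"] by metis
  then obtain u where u: "\<And>j. u j j = 1"
    "\<And>j t. newton (int \<circ> x) j t = (\<Sum>m\<le>j. u j m * newton int m t)" by metis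
  define N where "N = mat n n (\<lambda>(i,j). newton (int \<circ> x) j (int (x i)))"
  define B where "B = mat n n (\<lambda>(i,j). int (x i choose j))"
  define U where "U = mat n n (\<lambda>(i,j). if i \<le> j then fact i * u j i else 0)"
  have carr: "N \<in> carrier_mat n n" "B \<in> carrier_mat n n" "U \<in> carrier_mat n n"
    by (auto simp: N_def B_def U_def)
  have "N = B * U"
  proof (rule eq_matI)
    fix i j assume "i < dim_row (B * U)" "j < dim_col (B * U)"
    hence ij: "i < n" "j < n" using carr by auto
    have "(B * U) $$ (i,j) = (\<Sum>m<n. int (x i choose m) * (if m \<le> j then fact m * u j m else 0))"
      using ij by (auto simp: B_def U_def scalar_prod_def lessThan_atLeast0 intro!: sum.cong)
    also have "\<dots> = (\<Sum>m\<le>j. u j m * newton int m (int (x i)))"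
      using ij by (intro sum.mono_neutral_cong_right) (auto simp: newton_falling_factorial)
    finally show "N $$ (i,j) = (B * U) $$ (i,j)"
      using ij u(2)[of j "int (x i)"] by (simp add: N_def)
  qed (use carr in auto)
  hence "Determinant.det N = Determinant.det B * Determinant.det U"
    using det_mult[OF carr(2,3)] by simp
  moreover have "Determinant.det U = (\<Prod>i<n. fact i)"
  proof -
    have "upper_triangular U" by (auto simp: upper_triangular_def U_def)
    hence "Determinant.det U = prod_list (diag_mat U)" using det_upper_triangular carr by blast
    also have "\<dots> = (\<Prod>i<n. fact i)"
      by (simp add: prod_list_diag_prod U_def u lessThan_atLeast0)
    finally show ?thesis .
  qed
  moreover have "Determinant.det N = (\<Prod>j<n. \<Prod>l<j. int (x j) - int (x l))"
  proof -
    have "Determinant.det N = prod_list (diag_mat N)"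
      by (rule det_lower_triangular[OF _ carr(1)]) (auto simp: N_def newton_def intro!: prod_zero)
    also have "\<dots> = (\<Prod>j<n. \<Prod>l<j. int (x j) - int (x l))"
      by (simp add: prod_list_diag_prod N_def newton_def lessThan_atLeast0)
    finally show ?thesis .
  qed
  ultimately show ?thesis by simp
qed

text \<open>The sums \<open>k l + ... + k j\<close> are the differences of the partial sums of
  \<open>k\<close>, so the numerator of Weyl's formula is a Vandermonde product.\<close>

lemma irrep_dim_eq_nat:
  obtains m :: nat where "irrep_dim r k = real m"
proof -
  define x where "x j = (\<Sum>i=1..j. k i)" for j
  have diff: "int (x j) - int (x l) = int (\<Sum>i=Suc l..j. k i)" if "l < j" for l j
  proof -
    have "{1..j} = {1..l} \<union> {Suc l..j}" "{1..l} \<inter> {Suc l..j} = {}" using that by auto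
    hence "x j = x l + (\<Sum>i=Suc l..j. k i)" unfolding x_def by (subst sum.union_disjoint[symmetric]) auto
    thus ?thesis by simp
  qed
  have "(\<Prod>j<Suc r. \<Prod>l<j. int (x j) - int (x l)) = (\<Prod>j=1..r. \<Prod>l=1..j. int (\<Sum>i = l..j. k i))"
  proof -
    have "(\<Prod>j<Suc r. \<Prod>l<j. int (x j) - int (x l)) = (\<Prod>j=1..r. \<Prod>l<j. int (x j) - int (x l))"
      by (rule prod.mono_neutral_right) (auto simp: less_Suc_eq_le not_le)
    also have "\<dots> = (\<Prod>j=1..r. \<Prod>l=1..j. int (\<Sum>i = l..j. k i))"
    proof (rule prod.cong[OF refl])
      fix j
      have "(\<Prod>l=1..j. int (\<Sum>i = l..j. k i)) = (\<Prod>l<j. int (\<Sum>i = Suc l..j. k i))"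
        by (rule prod.reindex_bij_witness[of _ Suc "\<lambda>l. l - 1"]) auto
      thus "(\<Prod>l<j. int (x j) - int (x l)) = (\<Prod>l=1..j. int (\<Sum>i = l..j. k i))"
        by (simp add: diff)
    qed
    finally show ?thesis .
  qed
  moreover have "(\<Prod>i<Suc r. fact i :: int) = (\<Prod>i=1..r. fact i)"
    by (rule prod.mono_neutral_right) (auto simp: less_Suc_eq_le not_le)
  ultimately have "(\<Prod>i=1..r. fact i :: int) dvd (\<Prod>j=1..r. \<Prod>l=1..j. int (\<Sum>i = l..j. k i))"
    using superfactorial_dvd_vandermonde[where n = "Suc r" and x = x] by simp
  then obtain m where m: "(\<Prod>j=1..r. \<Prod>l=1..j. int (\<Sum>i = l..j. k i)) = (\<Prod>i=1..r. fact i) * m"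
    by (auto simp: dvd_def)
  have "real_of_int (\<Prod>j=1..r. \<Prod>l=1..j. int (\<Sum>i = l..j. k i)) = c_const r * of_int m"
    unfolding m by (simp add: c_const_def)
  moreover have "c_const r \<noteq> 0" by (simp add: c_const_def)
  ultimately have "irrep_dim r k = of_int m"
    by (simp add: irrep_dim_def a_fun_def field_simps)
  moreover have "irrep_dim r k \<ge> 0"
    unfolding irrep_dim_def a_fun_def c_const_def
    by (intro divide_nonneg_nonneg prod_nonneg sum_nonneg ballI) auto
  ultimately have "irrep_dim r k = real (nat m)" by simp
  thus ?thesis by (rule that)
qed

section \<open>Counting dominant weights by volume\<close>

(* The simplifier is to leave intervals in the form {1..r}. *)
declare One_nat_def [simp del]

abbreviation vol :: "nat \<Rightarrow> (nat \<Rightarrow> real) measure" where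
  "vol r \<equiv> \<Pi>\<^sub>M i\<in>{1..r}. lborel"

definition region :: "nat \<Rightarrow> real \<Rightarrow> (nat \<Rightarrow> real) set" where
  "region r t = {y \<in> {1..r} \<rightarrow>\<^sub>E {0<..}. a_fun r y \<le> t}"

abbreviation num_pos_roots :: "nat \<Rightarrow> nat" where
  "num_pos_roots r \<equiv> \<Sum>{1..r}"

lemma c_const_ge_1: "c_const r \<ge> 1"
  unfolding c_const_def by (rule prod_ge_1) (auto simp: fact_ge_1)

lemma a_fun_scale: "a_fun r (\<lambda>i. c * y i) = c ^ num_pos_roots r * a_fun r y"
  by (simp add: a_fun_def sum_distrib_left[symmetric] prod.distrib power_sum)

lemma a_fun_cong: "(\<And>i. i \<in> {1..r} \<Longrightarrow> y i = z i) \<Longrightarrow> a_fun r y = a_fun r z"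
  unfolding a_fun_def by (intro arg_cong2[where f = "(/)"] prod.cong sum.cong refl) auto

lemma a_fun_mono:
  assumes "\<And>i. i \<in> {1..r} \<Longrightarrow> 0 \<le> y i \<and> y i \<le> z i"
  shows "a_fun r y \<le> a_fun r z"
  unfolding a_fun_def using c_const_ge_1[of r]
  by (intro divide_right_mono prod_mono conjI sum_mono sum_nonneg prod_nonneg ballI)
     (use assms in auto)

lemma a_fun_measurable [measurable]: "a_fun r \<in> borel_measurable (vol r)"
  unfolding a_fun_def
  by (intro borel_measurable_divide borel_measurable_const borel_measurable_prod borel_measurable_sum)
     (auto intro!: measurable_component_singleton simp: measurable_lborel2[symmetric] simp del: measurable_lborel2)

lemma component_measurable [measurable]: "i \<in> {1..r} \<Longrightarrow> (\<lambda>y. y i) \<in> borel_measurable (vol r)"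
  using measurable_component_singleton[of i "{1..r}" "\<lambda>_. lborel"] by simp

lemma positive_sets [measurable]: "({1..r} \<rightarrow>\<^sub>E {0<..}) \<in> sets (vol r)"
  by (rule sets_PiM_I_finite) auto

lemma region_alt: "region r t = ({1..r} \<rightarrow>\<^sub>E {0<..}) \<inter> {y \<in> space (vol r). a_fun r y \<le> t}"
  by (auto simp: region_def space_PiM PiE_def Pi_def)

lemma region_sets [measurable]: "region r t \<in> sets (vol r)"
  unfolding region_alt by measurable

lemma emeasure_lborel_scale:
  assumes "c > 0" "A \<in> sets borel"
  shows "emeasure lborel A = ennreal c * emeasure lborel ((*) c -` A)"
proof -
  have "emeasure lborel A = emeasure (density (distr lborel borel ((*) c)) (\<lambda>_. \<bar>c\<bar>)) A"
    using lborel_distr_mult'[of c] assms by simp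
  also have "\<dots> = ennreal c * emeasure (distr lborel borel ((*) c)) A"
    using assms by (subst emeasure_density_const) auto
  also have "emeasure (distr lborel borel ((*) c)) A = emeasure lborel ((*) c -` A)"
    using assms by (subst emeasure_distr) auto
  finally show ?thesis .
qed

text \<open>The measure on the right-hand side, as a function of \<open>A\<close>, agrees with Lebesgue
  measure on boxes.\<close>

lemma emeasure_vol_scale:
  assumes "c > 0" "A \<in> sets (vol r)"
  shows "emeasure (vol r) A = ennreal (c ^ r) * emeasure (vol r) {y \<in> space (vol r). (\<lambda>i\<in>{1..r}. c * y i) \<in> A}"
proof -
  interpret product_sigma_finite "\<lambda>_::nat. lborel :: real measure" by standard
  define S where "S y = (\<lambda>i\<in>{1..r}. c * y i)" for y :: "nat \<Rightarrow> real"
  have S: "S \<in> vol r \<rightarrow>\<^sub>M vol r"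
    unfolding S_def
    by (rule measurable_restrict)
       (unfold measurable_lborel1, intro borel_measurable_times borel_measurable_const component_measurable)
  define D where "D = density (distr (vol r) (vol r) S) (\<lambda>_. ennreal (c ^ r))"
  have emD: "emeasure D B = ennreal (c ^ r) * emeasure (vol r) (S -` B \<inter> space (vol r))"
    if "B \<in> sets (vol r)" for B
    unfolding D_def using that S by (subst emeasure_density_const) (auto simp: emeasure_distr)
  have "D = vol r"
  proof (rule PiM_eqI)
    show "sets D = sets (vol r)" by (simp add: D_def)
    fix B assume B: "\<And>i. i \<in> {1..r} \<Longrightarrow> B i \<in> sets (lborel :: real measure)"
    have "S -` Pi\<^sub>E {1..r} B \<inter> space (vol r) = Pi\<^sub>E {1..r} (\<lambda>i. (*) c -` B i)"
      by (auto simp: S_def space_PiM PiE_def Pi_def extensional_def)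
    moreover have "(*) c -` B i \<in> sets lborel" if "i \<in> {1..r}" for i
      using B[OF that] measurable_sets[of "(*) c" lborel borel "B i"] by simp
    ultimately have "emeasure D (Pi\<^sub>E {1..r} B) = ennreal (c ^ r) * (\<Prod>i\<in>{1..r}. emeasure lborel ((*) c -` B i))"
      using B by (subst emD) (auto intro!: sets_PiM_I_finite arg_cong2[where f = "(*)"] emeasure_PiM)
    also have "\<dots> = (\<Prod>i\<in>{1..r}. ennreal c * emeasure lborel ((*) c -` B i))"
      using assms by (simp add: prod.distrib ennreal_power)
    also have "\<dots> = (\<Prod>i\<in>{1..r}. emeasure lborel (B i))"
      using B assms by (intro prod.cong refl emeasure_lborel_scale[symmetric]) auto
    finally show "emeasure D (Pi\<^sub>E {1..r} B) = (\<Prod>i\<in>{1..r}. emeasure lborel (B i))" .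
  qed auto
  hence "emeasure (vol r) A = emeasure D A" by simp
  also have "\<dots> = ennreal (c ^ r) * emeasure (vol r) (S -` A \<inter> space (vol r))"
    using emD assms by simp
  also have "S -` A \<inter> space (vol r) = {y \<in> space (vol r). (\<lambda>i\<in>{1..r}. c * y i) \<in> A}"
    by (auto simp: S_def)
  finally show ?thesis .
qed

lemma emeasure_region_power:
  assumes "c > 0"
  shows "emeasure (vol r) (region r (c ^ num_pos_roots r)) = ennreal (c ^ r) * emeasure (vol r) (region r 1)"
proof -
  have "{y \<in> space (vol r). (\<lambda>i\<in>{1..r}. c * y i) \<in> region r (c ^ num_pos_roots r)} = region r 1"
  proof -
    have "a_fun r (\<lambda>i\<in>{1..r}. c * y i) = c ^ num_pos_roots r * a_fun r y" for y
      unfolding a_fun_scale[symmetric] by (rule a_fun_cong) simp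
    thus ?thesis using assms
      by (auto simp: region_def space_PiM PiE_def Pi_def extensional_def zero_less_mult_iff)
  qed
  thus ?thesis
    unfolding emeasure_vol_scale[OF assms region_sets[of r "c ^ num_pos_roots r"]] by (rule arg_cong)
qed

text \<open>For \<open>u > 0\<close> this is the minimum of \<open>u powr (- 3 / 4)\<close> and \<open>u
  powr (- 5 / 4)\<close>, integrable at \<open>0\<close> and at infinity.\<close>

definition root_tail :: "real \<Rightarrow> real" where
  "root_tail u = exp (- ln u - \<bar>ln u\<bar> / 4)"

lemma double_sum_symmetric_triangle:
  fixes f :: "nat \<Rightarrow> nat \<Rightarrow> real"
  assumes "\<And>i j. f i j = f j i"
  shows "2 * (\<Sum>j=1..r. \<Sum>l=1..j. f l j) = (\<Sum>j=1..r. \<Sum>l=1..r. f l j) + (\<Sum>j=1..r. f j j)"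
proof (induction r)
  case (Suc r)
  have "(\<Sum>j=1..Suc r. \<Sum>l=1..Suc r. f l j) =
      (\<Sum>j=1..r. \<Sum>l=1..r. f l j) + (\<Sum>j=1..r. f (Suc r) j) + (\<Sum>l=1..r. f l (Suc r)) + f (Suc r) (Suc r)"
    by (simp add: sum.distrib)
  also have "(\<Sum>j=1..r. f (Suc r) j) = (\<Sum>l=1..r. f l (Suc r))"
    using assms by (intro sum.cong) auto
  finally show ?case using Suc by simp
qed simp

text \<open>Bounding the factor \<open>y l + ... + y j\<close> below by the larger of \<open>y l\<close> and
  \<open>y j\<close> gives, in terms of \<open>v i = ln (y i)\<close>, the sum of \<open>max (v l)
  (v j) = (v l + v j) / 2 + \<bar>v l - v j\<bar> / 2\<close> over all positive roots. The first
  part is \<open>(r + 1) / 2\<close> times the sum of the \<open>v i\<close>, which alone would be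
  at the edge of integrability; the differences provide additional decay whenever the coordinates
  are of different size. On the region, \<open>S + A / 4\<close> is therefore bounded, where
  \<open>S\<close> is the sum of the \<open>v i\<close> and \<open>A\<close> that of their
  absolute values.\<close>

lemma region_subset_product_bound:
  assumes r: "r \<ge> 2" and y: "y \<in> region r 1"
  shows "1 \<le> c_const r ^ 2 * (\<Prod>i=1..r. root_tail (y i))"
proof -
  define v where "v i = ln (y i)" for i
  define b where "b = ln (c_const r)"
  have pos: "y i > 0" if "i \<in> {1..r}" for i
    using y that by (auto simp: region_def PiE_def Pi_def)
  have b0: "b \<ge> 0" using c_const_ge_1[of r] by (simp add: b_def)
  define S where "S = (\<Sum>i=1..r. v i)"
  define G where "G = (\<Sum>j=1..r. \<Sum>l=1..r. \<bar>v l - v j\<bar>)"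
  define A where "A = (\<Sum>i=1..r. \<bar>v i\<bar>)"
  have "(\<Prod>j=1..r. \<Prod>l=1..j. \<Sum>i=l..j. y i) \<le> c_const r"
    using y c_const_ge_1[of r] by (simp add: region_def a_fun_def field_simps)
  moreover have "(\<Prod>j=1..r. \<Prod>l=1..j. exp (max (v l) (v j))) \<le> (\<Prod>j=1..r. \<Prod>l=1..j. \<Sum>i=l..j. y i)"
  proof (intro prod_mono conjI prod_nonneg ballI)
    fix j l assume jl: "j \<in> {1..r}" "l \<in> {1..j}"
    have "y l \<le> (\<Sum>i=l..j. y i)" "y j \<le> (\<Sum>i=l..j. y i)"
      using jl pos by (auto intro!: member_le_sum order.strict_implies_order[of 0])
    thus "exp (max (v l) (v j)) \<le> (\<Sum>i=l..j. y i)"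
      using pos[of l] pos[of j] jl by (auto simp: max_def v_def)
  qed auto
  ultimately have "exp (\<Sum>j=1..r. \<Sum>l=1..j. max (v l) (v j)) \<le> c_const r"
    by (simp add: exp_sum)
  hence "(\<Sum>j=1..r. \<Sum>l=1..j. max (v l) (v j)) \<le> b"
    using c_const_ge_1[of r] by (simp add: b_def ln_ge_iff)
  moreover have "2 * (\<Sum>j=1..r. \<Sum>l=1..j. max (v l) (v j)) = (\<Sum>j=1..r. \<Sum>l=1..r. max (v l) (v j)) + S"
    using double_sum_symmetric_triangle[of "\<lambda>l j. max (v l) (v j)" r] by (simp add: S_def max.commute)
  moreover have "(\<Sum>j=1..r. \<Sum>l=1..r. max (v l) (v j)) = r * S + G / 2"
  proof -
    have "max (v l) (v j) = v l / 2 + v j / 2 + \<bar>v l - v j\<bar> / 2" for l j by (simp add: max_def field_simps)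
    hence "(\<Sum>j=1..r. \<Sum>l=1..r. max (v l) (v j)) =
        (\<Sum>j=1..r. (\<Sum>l=1..r. v l) / 2 + r * (v j / 2) + (\<Sum>l=1..r. \<bar>v l - v j\<bar>) / 2)"
      by (simp only: sum.distrib sum_divide_distrib) simp
    also have "\<dots> = r * (S / 2) + r * (S / 2) + G / 2"
      unfolding S_def G_def sum.distrib sum_divide_distrib[symmetric] sum_distrib_left[symmetric] by simp
    finally show ?thesis by simp
  qed
  \<comment> \<open>\<open>G\<close> runs over ordered pairs, which accounts for the factor \<open>2\<close>.\<close>
  ultimately have main: "(r + 1) * S + G / 2 \<le> 2 * b" by (simp add: algebra_simps)
  \<comment> \<open>Each \<open>r * v j\<close> differs from \<open>S\<close> by the sum of the differences
    \<open>v l - v j\<close>.\<close>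
  have "r * A \<le> r * \<bar>S\<bar> + G"
  proof -
    have "r * \<bar>v j\<bar> \<le> \<bar>S\<bar> + (\<Sum>l=1..r. \<bar>v l - v j\<bar>)" for j
    proof -
      have "r * v j = S - (\<Sum>l=1..r. v l - v j)" by (simp add: S_def sum_subtractf)
      hence "\<bar>r * v j\<bar> \<le> \<bar>S\<bar> + \<bar>\<Sum>l=1..r. v l - v j\<bar>" by linarith
      also have "\<dots> \<le> \<bar>S\<bar> + (\<Sum>l=1..r. \<bar>v l - v j\<bar>)" by (intro add_left_mono sum_abs)
      finally show ?thesis by (simp add: abs_mult)
    qed
    hence "(\<Sum>j=1..r. r * \<bar>v j\<bar>) \<le> (\<Sum>j=1..r. \<bar>S\<bar> + (\<Sum>l=1..r. \<bar>v l - v j\<bar>))"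
      by (intro sum_mono)
    thus ?thesis by (simp add: A_def G_def sum.distrib sum_distrib_left)
  qed
  moreover have "G \<ge> 0" by (auto simp: G_def intro!: sum_nonneg)
  ultimately have "r * (S + A / 4) \<le> 5 / 2 * b"
  proof (cases "S \<ge> 0")
    case True
    have "r * A \<le> r * S + G" "r * S + S + G / 2 \<le> 2 * b"
      using main \<open>r * A \<le> r * \<bar>S\<bar> + G\<close> True by (simp_all add: algebra_simps)
    thus ?thesis using True \<open>G \<ge> 0\<close> unfolding distrib_left by linarith
  next
    case False
    have "2 * S \<ge> r * S" using r False by (intro mult_right_mono_neg) auto
    moreover have "r * A \<le> G - r * S" "r * S + S + G / 2 \<le> 2 * b"
      using main \<open>r * A \<le> r * \<bar>S\<bar> + G\<close> False by (simp_all add: algebra_simps)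
    ultimately show ?thesis using b0 unfolding distrib_left by linarith
  qed
  also have "5 / 2 * b \<le> r * (2 * b)"
    using mult_right_mono[of 2 "real r" "2 * b"] r b0 by linarith
  finally have "S + A / 4 \<le> 2 * b" using r by simp
  hence "1 \<le> exp (2 * b - S - A / 4)" by simp
  also have "\<dots> = exp b ^ 2 * (\<Prod>i=1..r. root_tail (y i))"
  proof -
    have "(\<Prod>i=1..r. root_tail (y i)) = exp (- S - A / 4)"
      unfolding root_tail_def S_def A_def v_def
      by (simp add: exp_sum[symmetric] sum_subtractf sum_divide_distrib sum_negf)
    thus ?thesis by (simp add: exp_double[symmetric] exp_add[symmetric])
  qed
  also have "exp b = c_const r" using c_const_ge_1[of r] by (simp add: b_def)
  finally show ?thesis .
qed

lemma root_tail_measurable [measurable]: "root_tail \<in> borel_measurable borel"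
  unfolding root_tail_def by measurable

lemma root_tail_pos: "root_tail u > 0"
  by (simp add: root_tail_def)

lemma root_tail_le_1: "0 < u \<Longrightarrow> u \<le> 1 \<Longrightarrow> root_tail u = u powr (-3/4)"
  by (simp add: root_tail_def powr_def)

lemma root_tail_ge_1: "1 \<le> u \<Longrightarrow> root_tail u = u powr (-5/4)"
  by (simp add: root_tail_def powr_def)

lemma nn_integral_root_tail_near_0:
  assumes "0 < \<eta>" "\<eta> \<le> 1"
  shows "(\<integral>\<^sup>+u. ennreal (root_tail u) * indicator {0<..<\<eta>} u \<partial>lborel) \<le> ennreal (4 * \<eta> powr (1/4))"
proof -
  have "(\<integral>\<^sup>+u. ennreal (root_tail u) * indicator {0<..<\<eta>} u \<partial>lborel) \<le>
      (\<integral>\<^sup>+u. ennreal (indicator {0..\<eta>} u * u powr (-3/4)) \<partial>lborel)"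
    using assms by (intro nn_integral_mono) (auto simp: indicator_def root_tail_le_1)
  also have "\<dots> = ennreal (\<eta> powr (-3/4+1) / (-3/4+1))"
    using has_integral_powr_from_0[of "-3/4" \<eta>] assms
    by (intro nn_integral_has_integral_lebesgue) auto
  finally show ?thesis by (simp add: mult.commute)
qed

lemma nn_integral_root_tail:
  "(\<integral>\<^sup>+u. ennreal (root_tail u) * indicator {0<..} u \<partial>lborel) \<le> ennreal 8"
proof -
  have "(\<integral>\<^sup>+u. ennreal (root_tail u) * indicator {0<..} u \<partial>lborel) =
      (\<integral>\<^sup>+u. ennreal (root_tail u) * indicator {0<..<1} u + ennreal (root_tail u) * indicator {1..} u \<partial>lborel)"
    by (intro nn_integral_cong) (auto simp: indicator_def)
  also have "\<dots> = (\<integral>\<^sup>+u. ennreal (root_tail u) * indicator {0<..<1} u \<partial>lborel) +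
      (\<integral>\<^sup>+u. ennreal (root_tail u) * indicator {1..} u \<partial>lborel)"
    by (rule nn_integral_add) auto
  also have "(\<integral>\<^sup>+u. ennreal (root_tail u) * indicator {0<..<1} u \<partial>lborel) \<le> ennreal 4"
    using nn_integral_root_tail_near_0[of 1] by simp
  also have "(\<integral>\<^sup>+u. ennreal (root_tail u) * indicator {1..} u \<partial>lborel) =
      (\<integral>\<^sup>+u. ennreal (indicator {1..} u * u powr (-5/4)) \<partial>lborel)"
    by (intro nn_integral_cong) (auto simp: indicator_def root_tail_ge_1)
  also have "\<dots> = ennreal (- (1 powr (-5/4+1)) / (-5/4+1))"
    using has_integral_powr_to_inf[of "-5/4" 1]
    by (intro nn_integral_has_integral_lebesgue) auto
  finally show ?thesis by (simp add: ennreal_plus[symmetric] del: ennreal_plus add_right_mono)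
qed

lemma emeasure_region_box_le:
  assumes r: "r \<ge> 2" and B: "\<And>i. i \<in> {1..r} \<Longrightarrow> B i \<in> sets borel"
  shows "emeasure (vol r) (region r 1 \<inter> Pi\<^sub>E {1..r} B)
    \<le> ennreal (c_const r ^ 2) * (\<Prod>i=1..r. \<integral>\<^sup>+u. ennreal (root_tail u) * indicator (B i) u \<partial>lborel)"
proof -
  interpret product_sigma_finite "\<lambda>_::nat. lborel :: real measure" by standard
  have "emeasure (vol r) (region r 1 \<inter> Pi\<^sub>E {1..r} B) =
      (\<integral>\<^sup>+y. indicator (region r 1 \<inter> Pi\<^sub>E {1..r} B) y \<partial>vol r)"
    using B by (intro nn_integral_indicator[symmetric] sets.Int region_sets sets_PiM_I_finite) auto
  also have "\<dots> \<le> (\<integral>\<^sup>+y. ennreal (c_const r ^ 2) *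
      (\<Prod>i=1..r. ennreal (root_tail (y i)) * indicator (B i) (y i)) \<partial>vol r)"
  proof (rule nn_integral_mono)
    fix y
    show "indicator (region r 1 \<inter> Pi\<^sub>E {1..r} B) y \<le> ennreal (c_const r ^ 2) *
      (\<Prod>i=1..r. ennreal (root_tail (y i)) * indicator (B i) (y i))"
    proof (cases "y \<in> region r 1 \<inter> Pi\<^sub>E {1..r} B")
      case True
      hence "(\<Prod>i=1..r. ennreal (root_tail (y i)) * indicator (B i) (y i)) =
          (\<Prod>i=1..r. ennreal (root_tail (y i)))"
        by (intro prod.cong) (auto simp: PiE_def Pi_def)
      also have "\<dots> = ennreal (\<Prod>i=1..r. root_tail (y i))"
        by (intro prod_ennreal less_imp_le root_tail_pos)
      finally have "ennreal (c_const r ^ 2) * (\<Prod>i=1..r. ennreal (root_tail (y i)) * indicator (B i) (y i))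
          = ennreal (c_const r ^ 2 * (\<Prod>i=1..r. root_tail (y i)))"
        by (simp add: ennreal_mult prod_nonneg less_imp_le root_tail_pos)
      moreover have "1 \<le> c_const r ^ 2 * (\<Prod>i=1..r. root_tail (y i))"
        using True r by (intro region_subset_product_bound) auto
      ultimately show ?thesis using True by (simp add: ennreal_leI flip: ennreal_1)
    qed auto
  qed
  also have "\<dots> = ennreal (c_const r ^ 2) *
      (\<integral>\<^sup>+y. (\<Prod>i=1..r. ennreal (root_tail (y i)) * indicator (B i) (y i)) \<partial>vol r)"
    using B by (intro nn_integral_cmult borel_measurable_prod_ennreal borel_measurable_times_ennreal
        measurable_compose[OF component_measurable] borel_measurable_indicator) auto
  also have "(\<integral>\<^sup>+y. (\<Prod>i=1..r. ennreal (root_tail (y i)) * indicator (B i) (y i)) \<partial>vol r) =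
     (\<Prod>i=1..r. \<integral>\<^sup>+u. ennreal (root_tail u) * indicator (B i) u \<partial>lborel)"
    using B by (intro product_nn_integral_prod) auto
  finally show ?thesis .
qed

text \<open>The region is unbounded, so this needs the product bound.\<close>

lemma emeasure_region_1_finite:
  assumes "r \<ge> 2"
  shows "emeasure (vol r) (region r 1) < \<infinity>"
proof -
  have "region r 1 = region r 1 \<inter> ({1..r} \<rightarrow>\<^sub>E {0<..})" by (auto simp: region_def)
  hence "emeasure (vol r) (region r 1) \<le> ennreal (c_const r ^ 2) *
      (\<Prod>i=1..r. \<integral>\<^sup>+u. ennreal (root_tail u) * indicator {0<..} u \<partial>lborel)"
    using emeasure_region_box_le[OF assms, of "\<lambda>_. {0<..}"] by simp
  also have "\<dots> \<le> ennreal (c_const r ^ 2) * (\<Prod>i=1..r. ennreal 8)"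
    by (intro mult_left_mono prod_mono_ennreal nn_integral_root_tail) auto
  also have "\<dots> < \<infinity>" by (simp add: ennreal_mult_less_top power_less_top_ennreal)
  finally show ?thesis .
qed

lemma C_const_eq: "C_const r = measure (vol r) (region r 1)"
proof -
  have "C_const r = (\<integral>y. indicator (region r 1) y \<partial>vol r)"
    by (simp add: C_const_def set_lebesgue_integral_def region_def)
  also have "\<dots> = measure (vol r) (region r 1 \<inter> space (vol r))"
    by (rule Bochner_Integration.integral_indicator)
  also have "region r 1 \<inter> space (vol r) = region r 1"
    by (auto simp: region_alt)
  finally show ?thesis .
qed

lemma emeasure_region_eq:
  assumes "r \<ge> 2" "c > 0"
  shows "emeasure (vol r) (region r (c ^ num_pos_roots r)) = ennreal (C_const r * c ^ r)"
proof -
  have "emeasure (vol r) (region r 1) = ennreal (C_const r)"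
    unfolding C_const_eq using emeasure_region_1_finite[OF assms(1)]
    by (intro emeasure_eq_ennreal_measure) auto
  thus ?thesis using assms emeasure_region_power[of c r]
    by (simp add: ennreal_mult'[symmetric] mult.commute C_const_eq)
qed

text \<open>Restricting one coordinate to \<open>(0, \<eta>)\<close> replaces one of the integrals over
  \<open>root_tail\<close> by \<open>4 * \<eta> powr (1/4)\<close>.\<close>

lemma measure_region_near_wall:
  assumes "r \<ge> 2" "0 < \<eta>" "\<eta> \<le> 1" "i \<in> {1..r}"
  shows "emeasure (vol r) {y \<in> region r 1. y i < \<eta>} \<le> ennreal (c_const r ^ 2 * 8 ^ r * \<eta> powr (1/4))"
proof -
  define B where "B j = (if j = i then {0<..<\<eta>} else {0::real<..})" for j
  have "{y \<in> region r 1. y i < \<eta>} = region r 1 \<inter> Pi\<^sub>E {1..r} B"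
    using assms(4) by (auto simp: region_def B_def PiE_def Pi_def split: if_splits)
  hence "emeasure (vol r) {y \<in> region r 1. y i < \<eta>} \<le> ennreal (c_const r ^ 2) *
      (\<Prod>j=1..r. \<integral>\<^sup>+u. ennreal (root_tail u) * indicator (B j) u \<partial>lborel)"
    using emeasure_region_box_le[OF assms(1), of B] by (simp add: B_def)
  also have "\<dots> \<le> ennreal (c_const r ^ 2) * ennreal (8 ^ r * \<eta> powr (1/4))"
  proof (rule mult_left_mono)
    have "(\<Prod>j=1..r. \<integral>\<^sup>+u. ennreal (root_tail u) * indicator (B j) u \<partial>lborel) \<le>
        (\<Prod>j=1..r. if j = i then ennreal (4 * \<eta> powr (1/4)) else ennreal 8)"
      using nn_integral_root_tail_near_0[OF assms(2,3)] nn_integral_root_tail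
      by (intro prod_mono_ennreal) (auto simp: B_def)
    also have "\<dots> = ennreal (\<Prod>j=1..r. if j = i then 4 * \<eta> powr (1/4) else 8)"
      by (subst prod_ennreal[symmetric]) (auto intro!: prod.cong)
    also have "(\<Prod>j=1..r. if j = i then 4 * \<eta> powr (1/4) else 8) = 4 * \<eta> powr (1/4) * 8 ^ (r - 1)"
      using assms(4) by (subst prod.remove[of _ i]) (auto simp: prod.If_cases card_Diff_singleton)
    also have "ennreal \<dots> \<le> ennreal (8 ^ r * \<eta> powr (1/4))"
      using assms(1) by (intro ennreal_leI) (cases r; simp)
    finally show "(\<Prod>j=1..r. \<integral>\<^sup>+u. ennreal (root_tail u) * indicator (B j) u \<partial>lborel)
        \<le> ennreal (8 ^ r * \<eta> powr (1/4))" .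
  qed simp
  finally show ?thesis
    by (simp add: ennreal_mult' mult.assoc)
qed

text \<open>Away from the walls, where all \<open>y i \<ge> \<eta>\<close>, adding
  \<open>\<eta>\<^sup>2\<close> to all coordinates is dominated by scaling with \<open>1 +
  \<eta>\<close>, so there the set lies between two dilates of the region whose volumes differ by
  \<open>O(\<eta>)\<close>. The part near the walls is small by
  \<open>measure_region_near_wall\<close>.\<close>

lemma emeasure_shell_le:
  assumes "r \<ge> 2" "0 < \<eta>" "\<eta> \<le> 1"
  shows "emeasure (vol r) {y \<in> region r 1. a_fun r (\<lambda>i. y i + \<eta>\<^sup>2) > 1}
    \<le> ennreal (r * (c_const r ^ 2 * 8 ^ r + C_const r) * \<eta> powr (1/4))"
proof -
  define e where "e = num_pos_roots r"
  define c where "c = 1 / (1 + \<eta>)"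
  have c: "0 < c" "c \<le> 1" using assms by (auto simp: c_def)
  have c_e: "c ^ e \<le> 1" using c by (simp add: power_le_one)
  have sub: "region r (c ^ e) \<subseteq> region r 1" using c_e by (auto simp: region_def)
  have "{y \<in> region r 1. a_fun r (\<lambda>i. y i + \<eta>\<^sup>2) > 1} \<subseteq>
      (\<Union>i\<in>{1..r}. {y \<in> region r 1. y i < \<eta>}) \<union> (region r 1 - region r (c ^ e))"
  proof
    fix y assume y: "y \<in> {y \<in> region r 1. a_fun r (\<lambda>i. y i + \<eta>\<^sup>2) > 1}"
    show "y \<in> (\<Union>i\<in>{1..r}. {y \<in> region r 1. y i < \<eta>}) \<union> (region r 1 - region r (c ^ e))"
    proof (cases "\<exists>i\<in>{1..r}. y i < \<eta>")
      case False
      have "1 < a_fun r (\<lambda>i. y i + \<eta>\<^sup>2)" using y by simp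
      also have "\<dots> \<le> a_fun r (\<lambda>i. (1 + \<eta>) * y i)"
      proof (rule a_fun_mono)
        fix i assume i: "i \<in> {1..r}"
        have "\<eta> \<le> y i" using False i by (auto simp: not_less)
        hence "\<eta> * \<eta> \<le> \<eta> * y i" using assms by (intro mult_left_mono) auto
        thus "0 \<le> y i + \<eta>\<^sup>2 \<and> y i + \<eta>\<^sup>2 \<le> (1 + \<eta>) * y i"
          using \<open>\<eta> \<le> y i\<close> assms
          by (simp add: power2_eq_square algebra_simps)
      qed
      also have "\<dots> = a_fun r y / c ^ e"
        by (simp add: a_fun_scale c_def e_def power_divide)
      finally have "y \<notin> region r (c ^ e)" using c by (auto simp: region_def field_simps)
      thus ?thesis using y by auto
    qed (use y in auto)
  qed
  moreover have wall: "{y \<in> region r 1. y i < \<eta>} \<in> sets (vol r)" if "i \<in> {1..r}" for i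
  proof -
    have "{y \<in> region r 1. y i < \<eta>} = region r 1 \<inter> {y \<in> space (vol r). y i < \<eta>}"
      by (auto simp: region_alt)
    thus ?thesis using component_measurable[OF that]
      by (auto intro!: sets.Int region_sets borel_measurable_less)
  qed
  ultimately have "emeasure (vol r) {y \<in> region r 1. a_fun r (\<lambda>i. y i + \<eta>\<^sup>2) > 1} \<le>
      emeasure (vol r) ((\<Union>i\<in>{1..r}. {y \<in> region r 1. y i < \<eta>}) \<union> (region r 1 - region r (c ^ e)))"
    by (intro emeasure_mono sets.Un sets.finite_UN sets.Diff region_sets) auto
  also have "\<dots> \<le> emeasure (vol r) (\<Union>i\<in>{1..r}. {y \<in> region r 1. y i < \<eta>}) + emeasure (vol r) (region r 1 - region r (c ^ e))"
    using wall by (intro emeasure_subadditive sets.finite_UN sets.Diff region_sets) auto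
  also have "emeasure (vol r) (\<Union>i\<in>{1..r}. {y \<in> region r 1. y i < \<eta>}) \<le>
      (\<Sum>i\<in>{1..r}. emeasure (vol r) {y \<in> region r 1. y i < \<eta>})"
    using wall by (intro emeasure_subadditive_finite) auto
  also have "\<dots> \<le> (\<Sum>i\<in>{1..r}. ennreal (c_const r ^ 2 * 8 ^ r * \<eta> powr (1/4)))"
    using assms by (intro sum_mono measure_region_near_wall)
  also have "\<dots> = ennreal (r * (c_const r ^ 2 * 8 ^ r * \<eta> powr (1/4)))"
    by (simp add: ennreal_mult' ennreal_of_nat_eq_real_of_nat)
  also have "emeasure (vol r) (region r 1 - region r (c ^ e)) = ennreal (C_const r - C_const r * c ^ r)"
  proof -
    have "emeasure (vol r) (region r 1 - region r (c ^ e)) =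
        emeasure (vol r) (region r 1) - emeasure (vol r) (region r (c ^ e))"
      using sub emeasure_region_eq[OF assms(1) c(1)] by (intro emeasure_Diff) (auto simp: e_def)
    also have "\<dots> = ennreal (C_const r) - ennreal (C_const r * c ^ r)"
      using emeasure_region_eq[OF assms(1) c(1)] emeasure_region_eq[OF assms(1), of 1] by (simp add: e_def)
    also have "\<dots> = ennreal (C_const r - C_const r * c ^ r)"
      using c by (intro ennreal_minus) (auto simp: C_const_eq)
    finally show ?thesis .
  qed
  also have "ennreal (r * (c_const r ^ 2 * 8 ^ r * \<eta> powr (1/4))) + ennreal (C_const r - C_const r * c ^ r) =
     ennreal (r * (c_const r ^ 2 * 8 ^ r * \<eta> powr (1/4)) + (C_const r - C_const r * c ^ r))"
    using c by (intro ennreal_plus[symmetric]) (auto simp: C_const_eq power_le_one mult_left_le)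
  also have "\<dots> \<le> ennreal (r * (c_const r ^ 2 * 8 ^ r + C_const r) * \<eta> powr (1/4))"
  proof (rule ennreal_leI)
    have "1 - r * \<eta> \<le> c ^ r"
    proof -
      have "1 - \<eta> \<le> c" using assms by (simp add: c_def field_simps)
      have "1 + real r * (c - 1) \<le> (1 + (c - 1)) ^ r"
        using c by (intro Bernoulli_inequality) auto
      moreover have "real r * (c - 1) \<ge> real r * (- \<eta>)"
        using \<open>1 - \<eta> \<le> c\<close> by (intro mult_left_mono) auto
      ultimately show ?thesis by simp
    qed
    hence "C_const r * (1 - r * \<eta>) \<le> C_const r * c ^ r"
      by (intro mult_left_mono) (auto simp: C_const_eq)
    moreover have "\<eta> \<le> \<eta> powr (1/4)"
      using powr_mono'[of "1/4" 1 \<eta>] assms by simp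
    hence "C_const r * r * \<eta> \<le> C_const r * r * \<eta> powr (1/4)"
      by (intro mult_left_mono) (auto simp: C_const_eq)
    ultimately show "r * (c_const r ^ 2 * 8 ^ r * \<eta> powr (1/4)) + (C_const r - C_const r * c ^ r)
      \<le> r * (c_const r ^ 2 * 8 ^ r + C_const r) * \<eta> powr (1/4)"
      by (simp add: algebra_simps)
  qed
  finally show ?thesis by (simp add: add_mono)
qed

lemma weights_memD: "k \<in> weights r \<Longrightarrow> i \<in> {1..r} \<Longrightarrow> k i \<ge> 1"
  by (auto simp: weights_def PiE_def Pi_def)

text \<open>Each \<open>k i\<close> is itself one of the factors in the numerator of Weyl's formula.\<close>

lemma finite_weights_le:
  "finite {k \<in> weights r. irrep_dim r k \<le> t}"
proof (rule finite_subset)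
  show "{k \<in> weights r. irrep_dim r k \<le> t} \<subseteq> {1..r} \<rightarrow>\<^sub>E {..nat \<lfloor>c_const r * t\<rfloor>}"
  proof
    fix k assume k: "k \<in> {k \<in> weights r. irrep_dim r k \<le> t}"
    define F where "F = (\<Prod>j=1..r. \<Prod>l=1..j. \<Sum>i=l..j. k i)"
    have "irrep_dim r k = real F / c_const r" by (simp add: irrep_dim_def a_fun_def F_def)
    hence F: "real F \<le> c_const r * t" using k c_const_ge_1[of r] by (simp add: divide_le_eq mult.commute)
    have "F > 0"
      unfolding F_def
    proof (intro prod_pos ballI)
      fix j l assume "j \<in> {1..r}" "l \<in> {1..j}"
      thus "0 < (\<Sum>i=l..j. k i)" using weights_memD[of k r j] k
        by (intro sum_pos2[of _ j]) auto
    qed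
    have "k i \<le> nat \<lfloor>c_const r * t\<rfloor>" if i: "i \<in> {1..r}" for i
    proof -
      have "(\<Sum>m=i..i. k m) dvd (\<Prod>l=1..i. \<Sum>m=l..i. k m)"
        using i by (intro dvd_prodI) auto
      also have "\<dots> dvd F" unfolding F_def using i by (intro dvd_prodI) auto
      finally have "k i \<le> F" using \<open>F > 0\<close> by (auto dest: dvd_imp_le)
      also have "F \<le> nat \<lfloor>c_const r * t\<rfloor>" using F by (simp add: le_nat_floor)
      finally show ?thesis .
    qed
    thus "k \<in> {1..r} \<rightarrow>\<^sub>E {..nat \<lfloor>c_const r * t\<rfloor>}"
      using k by (auto simp: weights_def PiE_def Pi_def)
  qed
qed (auto intro!: finite_PiE)

definition unit_cube :: "nat \<Rightarrow> (nat \<Rightarrow> nat) \<Rightarrow> (nat \<Rightarrow> real) set" where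
  "unit_cube r k = (\<Pi>\<^sub>E i\<in>{1..r}. {real (k i) - 1 <.. real (k i)})"

lemma unit_cube_sets: "unit_cube r k \<in> sets (vol r)"
  unfolding unit_cube_def by (rule sets_PiM_I_finite) auto

lemma emeasure_unit_cube: "emeasure (vol r) (unit_cube r k) = 1"
proof -
  interpret product_sigma_finite "\<lambda>_::nat. lborel :: real measure" by standard
  show ?thesis unfolding unit_cube_def by (subst emeasure_PiM) auto
qed

lemma disjoint_unit_cubes: "disjoint_family_on (unit_cube r) (weights r)"
unfolding disjoint_family_on_def
proof (intro ballI impI)
  fix k k' assume k: "k \<in> weights r" "k' \<in> weights r" "k \<noteq> k'"
  then obtain i where i: "i \<in> {1..r}" "k i \<noteq> k' i"
    unfolding weights_def by (metis PiE_ext)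
  show "unit_cube r k \<inter> unit_cube r k' = {}"
  proof (rule ccontr)
    assume "unit_cube r k \<inter> unit_cube r k' \<noteq> {}"
    then obtain y where "y \<in> unit_cube r k" "y \<in> unit_cube r k'" by blast
    hence "real (k i) - 1 < y i" "y i \<le> real (k i)" "real (k' i) - 1 < y i" "y i \<le> real (k' i)"
      using i(1) by (auto simp: unit_cube_def PiE_def Pi_def)
    thus False using i(2) by linarith
  qed
qed

lemma emeasure_Union_unit_cubes:
  assumes "finite L" "L \<subseteq> weights r"
  shows "emeasure (vol r) (\<Union>k\<in>L. unit_cube r k) = ennreal (card L)"
proof -
  have "emeasure (vol r) (\<Union>k\<in>L. unit_cube r k) = (\<Sum>k\<in>L. emeasure (vol r) (unit_cube r k))"
    using assms disjoint_unit_cubes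
    by (intro sum_emeasure[symmetric] disjoint_family_on_mono[of L]) (auto intro: unit_cube_sets)
  thus ?thesis by (simp add: emeasure_unit_cube ennreal_of_nat_eq_real_of_nat)
qed

lemma unit_cube_subset_region:
  assumes "k \<in> weights r" "irrep_dim r k \<le> t"
  shows "unit_cube r k \<subseteq> region r t"
proof
  fix y assume y: "y \<in> unit_cube r k"
  have *: "0 < y i \<and> y i \<le> real (k i)" if "i \<in> {1..r}" for i
  proof -
    have "1 \<le> k i" using assms weights_memD that by blast
    thus ?thesis using y that by (force simp: unit_cube_def PiE_def Pi_def)
  qed
  hence "a_fun r y \<le> irrep_dim r k"
    unfolding irrep_dim_def by (intro a_fun_mono) (auto intro: less_imp_le)
  thus "y \<in> region r t" using * y assms by (auto simp: region_def unit_cube_def PiE_def Pi_def)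
qed

lemma a_fun_shift_measurable: "(\<lambda>y. a_fun r (\<lambda>i. y i + s)) \<in> borel_measurable (vol r)"
  unfolding a_fun_def
  by (intro borel_measurable_divide borel_measurable_const borel_measurable_prod borel_measurable_sum
        borel_measurable_add component_measurable) auto

text \<open>The point \<open>y\<close> lies in the cube of the index \<open>k\<close> obtained by rounding
  up, and \<open>k\<close> is at most \<open>y + 1\<close> in every coordinate.\<close>

lemma region_minus_unit_cubes:
  "region r t - (\<Union>k\<in>{k \<in> weights r. irrep_dim r k \<le> t}. unit_cube r k)
    \<subseteq> {y \<in> region r t. a_fun r (\<lambda>i. y i + 1) > t}"
proof
  fix y assume y: "y \<in> region r t - (\<Union>k\<in>{k \<in> weights r. irrep_dim r k \<le> t}. unit_cube r k)"
  define k where "k = (\<lambda>i\<in>{1..r}. nat \<lceil>y i\<rceil>)"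
  have pos: "y i > 0" if "i \<in> {1..r}" for i
    using y that by (auto simp: region_def PiE_def Pi_def)
  have k: "real (k i) - 1 < y i" "y i \<le> real (k i)" "k i \<ge> 1" if "i \<in> {1..r}" for i
    using pos[OF that] that by (auto simp: k_def) linarith+
  have "k \<in> weights r" using k(3) by (auto simp: weights_def k_def)
  moreover have "y \<in> unit_cube r k"
    using k(1,2) y by (auto simp: unit_cube_def region_def PiE_def Pi_def)
  ultimately have "irrep_dim r k > t" using y by (auto simp: not_le)
  also have "irrep_dim r k \<le> a_fun r (\<lambda>i. y i + 1)"
    unfolding irrep_dim_def by (rule a_fun_mono) (use k in force)
  finally show "y \<in> {y \<in> region r t. a_fun r (\<lambda>i. y i + 1) > t}" using y by auto
qed

text \<open>Since \<open>a_fun\<close> is monotone, the unit cubes with upper corner \<open>k\<close> and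
  \<open>a(k) \<le> t\<close> are contained in the region.\<close>

lemma card_weights_le:
  assumes "r \<ge> 2" "c > 0"
  shows "card {k \<in> weights r. irrep_dim r k \<le> c ^ num_pos_roots r} \<le> C_const r * c ^ r"
proof -
  define t where "t = c ^ num_pos_roots r"
  have "ennreal (card {k \<in> weights r. irrep_dim r k \<le> t}) =
      emeasure (vol r) (\<Union>k\<in>{k \<in> weights r. irrep_dim r k \<le> t}. unit_cube r k)"
    by (intro emeasure_Union_unit_cubes[symmetric] finite_weights_le) auto
  also have "\<dots> \<le> emeasure (vol r) (region r t)"
    using unit_cube_subset_region by (intro emeasure_mono region_sets) blast
  also have "\<dots> = ennreal (C_const r * c ^ r)"
    using emeasure_region_eq[OF assms] by (simp add: t_def)
  finally show ?thesis using assms by (simp add: t_def C_const_eq)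
qed

text \<open>What the cubes do not cover is, after scaling by \<open>c\<close>, the shell of
  \<open>emeasure_shell_le\<close> with \<open>\<eta>\<^sup>2 = 1 / c\<close>.\<close>

lemma card_weights_ge:
  assumes "r \<ge> 2" "c \<ge> 1"
  shows "C_const r * c ^ r - r * (c_const r ^ 2 * 8 ^ r + C_const r) * c powr (r - 1/8)
    \<le> card {k \<in> weights r. irrep_dim r k \<le> c ^ num_pos_roots r}"
proof -
  define e where "e = num_pos_roots r"
  define t where "t = c ^ e"
  define L where "L = {k \<in> weights r. irrep_dim r k \<le> t}"
  define S where "S = {y \<in> region r t. a_fun r (\<lambda>i. y i + 1) > t}"
  define K where "K = r * (c_const r ^ 2 * 8 ^ r + C_const r)"
  have c: "c > 0" using assms by simp
  have K: "K \<ge> 0" by (simp add: K_def C_const_eq)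
  have cubes: "(\<Union>k\<in>L. unit_cube r k) \<in> sets (vol r)"
    unfolding L_def by (intro sets.finite_UN finite_weights_le unit_cube_sets)
  have S: "S \<in> sets (vol r)"
  proof -
    have "S = region r t \<inter> {y \<in> space (vol r). t < a_fun r (\<lambda>i. y i + 1)}"
      by (auto simp: S_def region_alt)
    thus ?thesis
      using a_fun_shift_measurable[of r 1]
      by (auto intro!: sets.Int region_sets borel_measurable_less)
  qed
  have "ennreal (C_const r * c ^ r) = emeasure (vol r) (region r t)"
    using emeasure_region_eq[OF assms(1) c] by (simp add: t_def e_def)
  also have "\<dots> \<le> emeasure (vol r) ((\<Union>k\<in>L. unit_cube r k) \<union> S)"
    using region_minus_unit_cubes[of r t] cubes S
    by (intro emeasure_mono sets.Un) (auto simp: S_def L_def)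
  also have "\<dots> \<le> emeasure (vol r) (\<Union>k\<in>L. unit_cube r k) + emeasure (vol r) S"
    using cubes S by (rule emeasure_subadditive)
  also have "emeasure (vol r) (\<Union>k\<in>L. unit_cube r k) = ennreal (card L)"
    unfolding L_def by (intro emeasure_Union_unit_cubes finite_weights_le) auto
  also have "emeasure (vol r) S = ennreal (c ^ r) * emeasure (vol r) {y \<in> region r 1. a_fun r (\<lambda>i. y i + (c powr (-1/2))\<^sup>2) > 1}"
  proof -
    have sq: "(c powr (-1/2))\<^sup>2 = 1 / c"
      using c by (simp add: powr_power powr_minus divide_simps)
    have "{y \<in> space (vol r). (\<lambda>i\<in>{1..r}. c * y i) \<in> S} =
        {y \<in> region r 1. a_fun r (\<lambda>i. y i + 1 / c) > 1}"
    proof -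
      have 1: "a_fun r (\<lambda>i\<in>{1..r}. c * y i) = t * a_fun r y" for y
        unfolding t_def e_def a_fun_scale[symmetric] by (rule a_fun_cong) simp
      have 2: "a_fun r (\<lambda>i. (\<lambda>i\<in>{1..r}. c * y i) i + 1) = t * a_fun r (\<lambda>i. y i + 1 / c)" for y
        unfolding t_def e_def a_fun_scale[symmetric] using c by (intro a_fun_cong) (simp add: field_simps)
      have "t > 0" using c by (simp add: t_def)
      thus ?thesis using c unfolding S_def region_def mem_Collect_eq 1 2
        by (auto simp: space_PiM PiE_def Pi_def extensional_def zero_less_mult_iff)
    qed
    thus ?thesis unfolding emeasure_vol_scale[OF c S] sq by simp
  qed
  also have "\<dots> \<le> ennreal (c ^ r) * ennreal (K * (c powr (-1/2)) powr (1/4))"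
    unfolding K_def using assms powr_mono[of "-1/2" 0 c] by (intro mult_left_mono emeasure_shell_le) auto
  also have "\<dots> = ennreal (c ^ r * (K * c powr (-1/8)))"
    using c K by (simp add: ennreal_mult powr_powr)
  also have "ennreal (card L) + ennreal (c ^ r * (K * c powr (-1/8))) = ennreal (card L + c ^ r * (K * c powr (-1/8)))"
    using c K by (intro ennreal_plus[symmetric]) auto
  finally have "ennreal (C_const r * c ^ r) \<le> ennreal (card L + c ^ r * (K * c powr (-1/8)))"
    by (simp add: add_left_mono)
  hence "C_const r * c ^ r \<le> card L + c ^ r * (K * c powr (-1/8))"
    using c K by (subst (asm) ennreal_le_iff) auto
  moreover have "c ^ r * c powr (-1/8) = c powr (r - 1/8)"
    using c by (simp add: powr_realpow[symmetric] powr_add[symmetric])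
  ultimately have "C_const r * c ^ r \<le> card L + K * c powr (r - 1/8)"
    by (simp add: mult.left_commute)
  thus ?thesis by (simp add: L_def t_def e_def K_def)
qed

lemma num_pos_roots_eq: "real (num_pos_roots r) = real r * (real r + 1) / 2"
proof (induction r)
  case (Suc r)
  thus ?case by (simp add: field_simps)
qed simp

lemma weights_count_le:
  assumes "r \<ge> 2" "t > 0"
  shows "card {k \<in> weights r. irrep_dim r k \<le> t} \<le> C_const r * t powr (2 / (real r + 1))"
proof -
  define e where "e = num_pos_roots r"
  have re: "real e = real r * (real r + 1) / 2" unfolding e_def by (rule num_pos_roots_eq)
  have "real e > 0" unfolding re using assms by simp
  hence e: "e > 0" by simp
  have ex: "real r / e = 2 / (real r + 1)" unfolding re using assms by simp
  have "(t powr (1 / e)) ^ e = t" "(t powr (1 / e)) ^ r = t powr (2 / (real r + 1))"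
    using e assms ex by (simp_all add: powr_power)
  thus ?thesis using card_weights_le[OF assms(1), of "t powr (1 / e)"] assms by (simp add: e_def)
qed

lemma weights_count_ge:
  assumes "r \<ge> 2" "t \<ge> 1"
  shows "C_const r * t powr (2 / (real r + 1)) - r * (c_const r ^ 2 * 8 ^ r + C_const r) *
      t powr (2 / (real r + 1) - 1 / (4 * real r * (real r + 1))) \<le> card {k \<in> weights r. irrep_dim r k \<le> t}"
proof -
  define e where "e = num_pos_roots r"
  have re: "real e = real r * (real r + 1) / 2" unfolding e_def by (rule num_pos_roots_eq)
  have "real e > 0" unfolding re using assms by simp
  hence e: "e > 0" by simp
  have ex: "real r / e = 2 / (real r + 1)" unfolding re using assms by simp
  have "(t powr (1 / e)) ^ e = t" "(t powr (1 / e)) ^ r = t powr (2 / (real r + 1))"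
    using e assms ex by (simp_all add: powr_power)
  moreover have "(t powr (1 / e)) powr (r - 1/8) = t powr (2 / (real r + 1) - 1 / (4 * real r * (real r + 1)))"
  proof -
    have eq: "1 / (4 * real r * (real r + 1)) = 1 / (8 * real e)" by (simp add: re)
    show ?thesis unfolding eq powr_powr ex[symmetric] by (simp add: diff_divide_distrib)
  qed
  ultimately show ?thesis
    using card_weights_ge[OF assms(1), of "t powr (1 / e)"] assms
    unfolding e_def[symmetric] by (simp add: ge_one_powr_ge_zero)
qed

text \<open>These are the symmetric powers of the standard representation.\<close>

lemma irrep_dim_rank_one_family:
  assumes "r \<ge> 1"
  shows "irrep_dim r (\<lambda>i\<in>{1..r}. if i = 1 then Suc m else 1) = real ((m + r) choose r)"
proof -
  define k where "k = (\<lambda>i\<in>{1..r}. if i = 1 then Suc m else 1)"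
  have S: "(\<Sum>i=l..j. k i) = (if l = 1 then m + j else Suc j - l)" if "j \<in> {1..r}" "l \<in> {1..j}" for l j
  proof -
    have "(\<Sum>i=l..j. k i) = (\<Sum>i=l..j. if i = 1 then m + 1 else 1)"
      using that by (intro sum.cong) (auto simp: k_def)
    also have "\<dots> = (\<Sum>i=l..j. (if i = 1 then m else 0) + 1)" by (intro sum.cong) auto
    also have "\<dots> = (if l = 1 then m + j else Suc j - l)"
      using that by (subst sum.distrib, subst sum.delta) auto
    finally show ?thesis .
  qed
  have inner: "(\<Prod>l=1..j. \<Sum>i=l..j. k i) = (m + j) * fact (j - 1)" if j: "j \<in> {1..r}" for j
  proof -
    have "(\<Prod>l=1..j. \<Sum>i=l..j. k i) = (\<Prod>l=1..j. if l = 1 then m + j else Suc j - l)"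
      using S j by (intro prod.cong) auto
    also have "\<dots> = (m + j) * (\<Prod>l\<in>{1..j} - {1}. Suc j - l)"
      using j by (subst prod.remove[of _ 1]) (auto intro!: prod.cong)
    also have "(\<Prod>l\<in>{1..j} - {1}. Suc j - l) = (\<Prod>i=1..j-1. i)"
      by (rule prod.reindex_bij_witness[of _ "\<lambda>i. Suc j - i" "\<lambda>l. Suc j - l"]) auto
    finally show ?thesis by (simp add: fact_prod)
  qed
  have "(\<Prod>j=1..r. \<Prod>l=1..j. \<Sum>i=l..j. real (k i)) = real (\<Prod>j=1..r. (m + j) * fact (j - 1))"
    unfolding of_nat_sum[symmetric] of_nat_prod[symmetric] using inner by (intro arg_cong[of _ _ real] prod.cong) auto
  also have "(\<Prod>j=1..r. (m + j) * fact (j - 1)) = (\<Prod>j=1..r. m + j) * (\<Prod>j=1..r. fact (j - 1))"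
    by (rule prod.distrib)
  also have "(\<Prod>j=1..r. m + j) = fact r * ((m + r) choose r)"
  proof -
    have "fact m * (\<Prod>j=1..n. m + j) = (fact (m + n) :: nat)" for n
      by (induction n) (auto simp: algebra_simps)
    hence "fact m * (\<Prod>j=1..r. m + j) = fact m * (fact r * ((m + r) choose r))"
      using binomial_fact_lemma[of r "m + r"] by (simp add: mult_ac)
    thus ?thesis by simp
  qed
  also have "real (fact r * ((m + r) choose r) * (\<Prod>j=1..r. fact (j - 1))) =
      real ((m + r) choose r) * c_const r"
  proof -
    have "fact r * (\<Prod>j=1..r. fact (j - 1)) = (\<Prod>j=1..r. fact j :: real)"
      by (induction r) (auto simp: mult_ac)
    thus ?thesis by (simp add: c_const_def mult_ac)
  qed
  finally show ?thesis
    using c_const_ge_1[of r] by (simp add: irrep_dim_def a_fun_def k_def)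
qed

lemma C_const_ge_1:
  assumes "r \<ge> 2"
  shows "C_const r \<ge> 1"
proof -
  define k where "k = (\<lambda>i\<in>{1..r}. if i = 1 then Suc 0 else 1)"
  have "irrep_dim r k = 1"
    using irrep_dim_rank_one_family[of r 0] assms by (simp add: k_def)
  moreover have "k \<in> weights r" by (auto simp: k_def weights_def)
  ultimately have "card {k} \<le> card {k \<in> weights r. irrep_dim r k \<le> 1}"
    by (intro card_mono finite_weights_le) auto
  thus ?thesis using weights_count_le[OF assms, of 1] by simp
qed

section \<open>Representations as multisets of weights\<close>

definition dim_nat :: "nat \<Rightarrow> (nat \<Rightarrow> nat) \<Rightarrow> nat" where
  "dim_nat r k = nat \<lfloor>irrep_dim r k\<rfloor>"

lemma of_nat_dim_nat: "real (dim_nat r k) = irrep_dim r k"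
proof -
  obtain m :: nat where "irrep_dim r k = real m" by (rule irrep_dim_eq_nat)
  thus ?thesis by (simp add: dim_nat_def)
qed

lemma dim_nat_pos:
  assumes "k \<in> weights r"
  shows "dim_nat r k > 0"
proof -
  have "(\<Sum>i=l..j. real (k i)) > 0" if "j \<in> {1..r}" "l \<in> {1..j}" for l j
    using weights_memD[OF assms, of j] that by (intro sum_pos2[of _ j]) auto
  hence "irrep_dim r k > 0"
    unfolding irrep_dim_def a_fun_def using c_const_ge_1[of r]
    by (intro divide_pos_pos prod_pos ballI) auto
  thus ?thesis by (simp flip: of_nat_dim_nat)
qed

definition first_weight_line :: "nat \<Rightarrow> nat \<Rightarrow> nat \<Rightarrow> nat" where
  "first_weight_line r m = (\<lambda>i\<in>{1..r}. if i = 1 then Suc m else 1)"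

text \<open>In the counting function, \<open>c\<close> with \<open>t = c\<^bsup>r(r+1)/2\<^esup>\<close>
  turns the saving of \<open>c powr (1/8)\<close> into \<open>\<delta> = 1 / (4 * r * (r +
  1))\<close>.\<close>

lemma dimension_family_sl:
  assumes "r \<ge> 2"
  shows "dimension_family (weights r) (dim_nat r) (2 / (real r + 1)) (C_const r) (1 / (4 * real r * (real r + 1)))
    (r * (c_const r ^ 2 * 8 ^ r + C_const r)) (first_weight_line r) r"
proof
  show "inj (first_weight_line r)"
  proof
    fix m m' assume "first_weight_line r m = first_weight_line r m'"
    hence "first_weight_line r m 1 = first_weight_line r m' 1" by simp
    thus "m = m'" using assms by (simp add: first_weight_line_def)
  qed
  show "first_weight_line r m \<in> weights r" for m
    by (auto simp: first_weight_line_def weights_def)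
  show "dim_nat r (first_weight_line r m) = (m + r) choose r" for m
    using irrep_dim_rank_one_family[of r m] assms of_nat_dim_nat[of r "first_weight_line r m"]
    by (simp add: first_weight_line_def)
  show "C_const r > 0" using C_const_ge_1[OF assms] by simp
  show "0 < 1 / (4 * real r * (real r + 1))" using assms by simp
  show "1 / (4 * real r * (real r + 1)) < 2 / (real r + 1)"
  proof -
    have "1 * (real r + 1) \<le> 4 * real r * (real r + 1)" using assms by (intro mult_right_mono) auto
    hence "1 / (4 * real r * (real r + 1)) \<le> 1 / (real r + 1)"
      using assms by (intro divide_left_mono) auto
    also have "\<dots> < 2 / (real r + 1)" by (intro divide_strict_right_mono) auto
    finally show ?thesis .
  qed
  show "0 \<le> real r * (c_const r ^ 2 * 8 ^ r + C_const r)"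
    using C_const_ge_1[OF assms] by simp
qed (use assms in \<open>auto simp: of_nat_dim_nat dim_nat_pos finite_weights_le weights_count_le weights_count_ge\<close>)

lemma rep_dim_eq: "rep_dim r \<rho> = real (\<Sum>k\<in>#\<rho>. dim_nat r k)"
proof -
  define f where "f = (\<lambda>k. irrep_dim r k)"
  have "(\<Sum>k\<in>set_mset \<rho>. f k * real (count \<rho> k)) = (\<Sum>k\<in>#\<rho>. f k)"
  proof (induction \<rho>)
    case (add x \<rho>)
    have "(\<Sum>k\<in>set_mset (add_mset x \<rho>). f k * real (count (add_mset x \<rho>) k)) =
        (\<Sum>k\<in>insert x (set_mset \<rho>). f k * real (count \<rho> k) + (if k = x then f x else 0))"
      by (intro sum.cong) (auto simp: algebra_simps)
    also have "\<dots> = (\<Sum>k\<in>insert x (set_mset \<rho>). f k * real (count \<rho> k)) + f x"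
      by (subst sum.distrib) simp
    also have "(\<Sum>k\<in>insert x (set_mset \<rho>). f k * real (count \<rho> k)) = (\<Sum>k\<in>set_mset \<rho>. f k * real (count \<rho> k))"
      by (intro sum.mono_neutral_right) (auto simp: not_in_iff)
    finally show ?case using add.IH by simp
  qed simp
  also have "\<dots> = real (\<Sum>k\<in>#\<rho>. dim_nat r k)"
    by (induction \<rho>) (auto simp: f_def of_nat_dim_nat)
  finally show ?thesis by (simp add: rep_dim_def f_def)
qed

lemma reps_iff: "\<rho> \<in> reps r n \<longleftrightarrow> set_mset \<rho> \<subseteq> weights r \<and> (\<Sum>k\<in>#\<rho>. dim_nat r k) = n"
  unfolding reps_def mem_Collect_eq rep_dim_eq of_nat_eq_iff ..

text \<open>The assumption \<open>n \<ge> 1\<close> excludes the zero representation, for which the maximum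
  is over the empty set.\<close>

lemma reps_D_max_le:
  assumes "n \<ge> 1"
  shows "reps r n \<inter> {\<rho>. D_max r \<rho> \<le> d} = partitions_into (dim_nat r) {k \<in> weights r. real (dim_nat r k) \<le> d} n"
proof -
  have "D_max r \<rho> \<le> d \<longleftrightarrow> (\<forall>k\<in>set_mset \<rho>. real (dim_nat r k) \<le> d)" if "\<rho> \<in> reps r n" for \<rho>
  proof -
    have "\<rho> \<noteq> {#}" using that assms by (auto simp: reps_iff)
    have "D_max r \<rho> = Max (irrep_dim r ` set_mset \<rho>)"
      unfolding D_max_def by (rule arg_cong[of _ _ Max]) auto
    thus ?thesis using \<open>\<rho> \<noteq> {#}\<close> by (simp add: of_nat_dim_nat)
  qed
  thus ?thesis by (auto simp: reps_iff partitions_into_def)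
qed

lemma reps_eq_partitions_into:
  "reps r n = partitions_into (dim_nat r) {k \<in> weights r. real (dim_nat r k) \<le> real n} n"
proof -
  have "dim_nat r k \<le> (\<Sum>k\<in>#\<rho>. dim_nat r k)" if "k \<in># \<rho>" for k \<rho>
    using that by (auto dest!: multi_member_split)
  thus ?thesis by (auto simp: reps_iff partitions_into_def)
qed

section \<open>The saddle point\<close>

context dimension_family
begin

lemma mean_term_antimono:
  assumes "k \<in> W" "0 < \<beta>" "\<beta> \<le> \<gamma>"
  shows "A k * mean_mult \<gamma> (A k) \<le> A k * mean_mult \<beta> (A k)"
proof -
  have "0 < \<beta> * A k" "\<beta> * A k \<le> \<gamma> * A k" using assms A_pos by (auto intro: mult_right_mono)
  hence "1 / (exp (\<gamma> * A k) - 1) \<le> 1 / (exp (\<beta> * A k) - 1)"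
    by (intro divide_left_mono mult_pos_pos) auto
  thus ?thesis unfolding mean_mult_def by (rule mult_left_mono) simp
qed

lemma mean_summable:
  assumes "\<beta> > 0"
  shows "(\<lambda>k. A k * mean_mult \<beta> (A k)) summable_on W"
proof (rule nonneg_bdd_above_summable_on)
  show "bdd_above (sum (\<lambda>k. A k * mean_mult \<beta> (A k)) ` {F. F \<subseteq> W \<and> finite F})"
    using mean_tail_le[of _ 0 \<beta>] assms by (intro bdd_aboveI2) auto
qed (use mean_term_nonneg assms in auto)

definition mean_total :: "real \<Rightarrow> real" where
  "mean_total \<beta> = (\<Sum>\<^sub>\<infinity>k\<in>W. A k * mean_mult \<beta> (A k))"

lemma has_sum_mean_total: "\<beta> > 0 \<Longrightarrow> ((\<lambda>k. A k * mean_mult \<beta> (A k)) has_sum mean_total \<beta>) W"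
  unfolding mean_total_def by (rule has_sum_infsum[OF mean_summable])

lemma fam_0: "fam 0 \<in> W" "A (fam 0) = 1"
  using fam by simp_all

lemma mean_total_continuous:
  assumes "a > 0"
  shows "continuous_on {a..b} mean_total"
proof (rule uniform_limit_theorem)
  show "uniform_limit {a..b} (\<lambda>X \<beta>. \<Sum>k\<in>X. A k * mean_mult \<beta> (A k)) mean_total (finite_subsets_at_top W)"
  proof (rule Weierstrass_m_test_general')
    show "norm (A k * mean_mult \<beta> (A k)) \<le> A k * mean_mult a (A k)" if "k \<in> W" "\<beta> \<in> {a..b}" for k \<beta>
      using mean_term_antimono[of k a \<beta>] mean_term_nonneg[of k \<beta>] that assms by simp
    show "((\<lambda>k. A k * mean_mult \<beta> (A k)) has_sum mean_total \<beta>) W" if "\<beta> \<in> {a..b}" for \<beta>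
      using that assms by (intro has_sum_mean_total) auto
    show "(\<lambda>k. A k * mean_mult a (A k)) summable_on W" by (rule mean_summable[OF assms])
  qed
  show "\<forall>\<^sub>F X in finite_subsets_at_top W. continuous_on {a..b} (\<lambda>\<beta>. \<Sum>k\<in>X. A k * mean_mult \<beta> (A k))"
  proof (rule eventually_finite_subsets_at_top_weakI)
    fix X assume X: "finite X" "X \<subseteq> W"
    have "exp (\<beta> * A k) - 1 \<noteq> 0" if "k \<in> X" "\<beta> \<in> {a..b}" for k \<beta>
      using that X A_pos[of k] assms by auto
    thus "continuous_on {a..b} (\<lambda>\<beta>. \<Sum>k\<in>X. A k * mean_mult \<beta> (A k))"
      unfolding mean_mult_def by (intro continuous_intros) auto
  qed
qed auto

lemma mean_total_strict_antimono:
  assumes "0 < \<beta>" "\<beta> < \<gamma>"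
  shows "mean_total \<gamma> < mean_total \<beta>"
proof (rule has_sum_strict_mono)
  show "((\<lambda>k. A k * mean_mult \<gamma> (A k)) has_sum mean_total \<gamma>) W" "((\<lambda>k. A k * mean_mult \<beta> (A k)) has_sum mean_total \<beta>) W"
    using assms by (auto intro: has_sum_mean_total)
  show "A (fam 0) * mean_mult \<gamma> (A (fam 0)) < A (fam 0) * mean_mult \<beta> (A (fam 0))"
    unfolding mean_mult_def fam_0 using assms by (auto intro!: divide_strict_left_mono mult_pos_pos)
qed (use assms mean_term_antimono fam_0 in auto)

text \<open>The expected total weight is continuous in \<open>\<beta>\<close>, at least the contribution
  \<open>1 / (exp \<beta> - 1)\<close> of the trivial part \<open>fam 0\<close>, and tends to
  \<open>0\<close> as \<open>\<beta>\<close> grows.\<close>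

lemma saddle_point_exists:
  assumes "x > 0"
  obtains \<beta> where "\<beta> > 0" "mean_total \<beta> = x"
proof -
  \<comment> \<open>Solves \<open>1 / (exp a - 1) = x\<close>.\<close>
  define a where "a = ln (1 + 1 / x)"
  have a: "a > 0" unfolding a_def using assms by (intro ln_gt_zero) simp
  have ea: "exp a = 1 + 1 / x" using assms by (simp add: a_def add_pos_pos)
  have "x = (\<Sum>k\<in>{fam 0}. A k * mean_mult a (A k))"
    using assms by (simp add: mean_mult_def fam_0 ea)
  also have "\<dots> \<le> mean_total a"
    using fam_0 mean_term_nonneg a by (intro finite_sum_le_has_sum[OF has_sum_mean_total]) auto
  finally have hi: "x \<le> mean_total a" .
  have "((\<lambda>\<beta>. 8 * C / \<beta> * (\<beta> / 8) powr - \<kappa>) \<longlongrightarrow> 0) at_top"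
    using C \<kappa> by real_asymp
  hence "\<forall>\<^sub>F \<beta> in at_top. 8 * C / \<beta> * (\<beta> / 8) powr - \<kappa> < x \<and> \<beta> \<ge> a"
    using assms by (intro eventually_conj eventually_ge_at_top order_tendstoD)
  then obtain b where b: "8 * C / b * (b / 8) powr - \<kappa> < x" "b \<ge> a"
    by (auto simp: eventually_at_top_linorder)
  have "below 0 = {}" using A_pos by (force simp: below_def)
  hence "mean_total b \<le> 8 * C / b * (b / 8) powr - \<kappa>"
    using mean_gap(2)[OF _ has_sum_mean_total[of b], of 0] a b by (simp add: mean_dim_def)
  hence lo: "mean_total b \<le> x" using b by simp
  obtain \<beta> where "a \<le> \<beta>" "mean_total \<beta> = x"
    using IVT2'[OF lo hi b(2) mean_total_continuous[OF a]] by auto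
  thus ?thesis using a by (intro that[of \<beta>]) auto
qed

end

lemma powr_exp_eq: "exp (- \<beta>) powr a = exp (- (\<beta> * a :: real))"
  by (simp add: powr_def)

lemma mean_mult_eq_q:
  assumes "\<beta> * a > 0"
  shows "a * exp (- \<beta>) powr a / (1 - exp (- \<beta>) powr a) = a * mean_mult \<beta> a"
proof -
  define E where "E = exp (\<beta> * a)"
  have "E > 1" using assms by (simp add: E_def)
  have E: "exp (- (\<beta> * a)) = inverse E" by (simp add: E_def exp_minus)
  show ?thesis
    unfolding powr_exp_eq mean_mult_def E E_def[symmetric] using \<open>E > 1\<close> by (simp add: field_simps)
qed

text \<open>Under \<open>q = exp (- \<beta>)\<close> the equation defining \<open>q_seq\<close> says that
  the expected total weight is \<open>n\<close>; it has a unique solution because the latter is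
  strictly decreasing in \<open>\<beta>\<close>.\<close>

lemma q_s_seq_eq:
  assumes "r \<ge> 2" "n \<ge> 1"
  obtains \<beta> where "\<beta> > 0" "((\<lambda>k. dim_nat r k * mean_mult \<beta> (dim_nat r k)) has_sum real n) (weights r)"
    "s_seq r n = \<beta> powr (2 / (real r * (real r + 1)))"
proof -
  interpret dimension_family "weights r" "dim_nat r" "2 / (real r + 1)" "C_const r" "1 / (4 * real r * (real r + 1))"
    "r * (c_const r ^ 2 * 8 ^ r + C_const r)" "first_weight_line r" r
    by (rule dimension_family_sl[OF assms(1)])
  obtain \<beta> where \<beta>: "\<beta> > 0" "mean_total \<beta> = real n"
    using saddle_point_exists[of "real n"] assms(2) by auto
  have eq: "((\<lambda>k. irrep_dim r k * exp (- \<gamma>) powr irrep_dim r k / (1 - exp (- \<gamma>) powr irrep_dim r k)) has_sum x) (weights r)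
     \<longleftrightarrow> ((\<lambda>k. dim_nat r k * mean_mult \<gamma> (dim_nat r k)) has_sum x) (weights r)" if "\<gamma> > 0" for \<gamma> x
    using that dim_nat_pos by (intro has_sum_cong) (simp add: of_nat_dim_nat[symmetric] mean_mult_eq_q)
  have q: "q_seq r n = exp (- \<beta>)"
    unfolding q_seq_def
  proof (rule the_equality)
    show "0 < exp (- \<beta>) \<and> exp (- \<beta>) < 1 \<and> ((\<lambda>k. irrep_dim r k * exp (- \<beta>) powr irrep_dim r k / (1 - exp (- \<beta>) powr irrep_dim r k)) has_sum real n) (weights r)"
      using \<beta> has_sum_mean_total[OF \<beta>(1)] eq[OF \<beta>(1)] by simp
    fix q assume q: "0 < q \<and> q < 1 \<and> ((\<lambda>k. irrep_dim r k * q powr irrep_dim r k / (1 - q powr irrep_dim r k)) has_sum real n) (weights r)"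
    define \<gamma> where "\<gamma> = - ln q"
    have \<gamma>: "\<gamma> > 0" "q = exp (- \<gamma>)" using q by (auto simp: \<gamma>_def)
    have "mean_total \<gamma> = real n"
      using q eq[OF \<gamma>(1)] has_sum_mean_total[OF \<gamma>(1)] has_sum_unique unfolding \<gamma>(2) by blast
    hence "\<gamma> = \<beta>" using mean_total_strict_antimono[of \<gamma> \<beta>] mean_total_strict_antimono[of \<beta> \<gamma>] \<beta> \<gamma>(1)
      by (metis less_irrefl linorder_neqE_linordered_idom)
    thus "q = exp (- \<beta>)" using \<gamma> by simp
  qed
  have R: "real r * (real r + 1) / 2 \<noteq> 0" "2 / (real r * (real r + 1)) * (real r * (real r + 1) / 2) = 1"
    using assms(1) by auto
  have "s_seq r n = \<beta> powr (2 / (real r * (real r + 1)))"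
    unfolding s_seq_def
  proof (rule the_equality)
    show "0 < \<beta> powr (2 / (real r * (real r + 1))) \<and>
        q_seq r n = exp (- ((\<beta> powr (2 / (real r * (real r + 1)))) powr (real r * (real r + 1) / 2)))"
      using \<beta>(1) unfolding powr_powr R(2) q by simp
    fix s assume s: "0 < s \<and> q_seq r n = exp (- (s powr (real r * (real r + 1) / 2)))"
    hence "\<beta> = s powr (real r * (real r + 1) / 2)" using q by simp
    thus "s = \<beta> powr (2 / (real r * (real r + 1)))" using s R(2) by (simp add: powr_powr mult.commute)
  qed
  thus ?thesis using \<beta> has_sum_mean_total[OF \<beta>(1)] by (intro that[of \<beta>]) auto
qed

lemma prob_D_max_le:
  assumes "r \<ge> 2" "n \<ge> 1"
  shows "measure_pmf.prob (P_unif r n) {\<rho>. D_max r \<rho> \<le> d} =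
    card (partitions_into (dim_nat r) {k \<in> weights r. real (dim_nat r k) \<le> d} n) /
    card (partitions_into (dim_nat r) {k \<in> weights r. real (dim_nat r k) \<le> real n} n)"
proof -
  interpret dimension_family "weights r" "dim_nat r" "2 / (real r + 1)" "C_const r" "1 / (4 * real r * (real r + 1))"
    "r * (c_const r ^ 2 * 8 ^ r + C_const r)" "first_weight_line r" r
    by (rule dimension_family_sl[OF assms(1)])
  have "replicate_mset n (first_weight_line r 0) \<in> reps r n"
    using fam_0 assms(2) by (simp add: reps_iff)
  moreover have "finite (reps r n)"
    unfolding reps_eq_partitions_into by (intro finite_partitions_into finite_below A_pos) auto
  ultimately show ?thesis
    unfolding P_unif_def reps_eq_partitions_into[symmetric] reps_D_max_le[OF assms(2), symmetric]
    by (intro measure_pmf_of_set) auto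
qed

text \<open>With \<open>\<kappa> = 2 / (r + 1)\<close> the event says that \<open>D_max\<close> is at most
  \<open>gumbel_level \<kappa> (C_const r) x \<beta> / \<beta>\<close>.\<close>

theorem theorem6p1:
  fixes r :: nat and x :: real
  assumes "r \<ge> 2"
  shows "(\<lambda>n. measure_pmf.prob (P_unif r n)
           {\<rho>. s_seq r n powr (real r * (real r + 1) / 2) * D_max r \<rho>
                 - ln (s_seq r n powr (- real r))
                 + (real r - 1) / (real r + 1) * ln (ln (s_seq r n powr (- real r)))
                 - ln (2 * C_const r / (real r + 1)) \<le> x})
         \<longlonglongrightarrow> exp (- exp (- x))"
proof -
  interpret dimension_family "weights r" "dim_nat r" "2 / (real r + 1)" "C_const r" "1 / (4 * real r * (real r + 1))"
    "r * (c_const r ^ 2 * 8 ^ r + C_const r)" "first_weight_line r" r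
    by (rule dimension_family_sl[OF assms])
  define \<kappa> where "\<kappa> = 2 / (real r + 1)"
  have "\<exists>\<beta>. \<beta> > 0 \<and> (n \<ge> 1 \<longrightarrow> ((\<lambda>k. dim_nat r k * mean_mult \<beta> (dim_nat r k)) has_sum real n) (weights r) \<and>
    s_seq r n = \<beta> powr (2 / (real r * (real r + 1))))" for n
  proof (cases "n \<ge> 1")
    case True
    show ?thesis by (rule q_s_seq_eq[OF assms True]) blast
  next
    case False
    thus ?thesis by (intro exI[where x = 1]) auto
  qed
  then obtain \<beta> where \<beta>: "\<And>n. \<beta> n > 0"
    "\<And>n. n \<ge> 1 \<Longrightarrow> ((\<lambda>k. dim_nat r k * mean_mult (\<beta> n) (dim_nat r k)) has_sum real n) (weights r)"
    "\<And>n. n \<ge> 1 \<Longrightarrow> s_seq r n = \<beta> n powr (2 / (real r * (real r + 1)))" by metis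
  have "(\<lambda>n. card (partitions_into (dim_nat r) (below (gumbel_level \<kappa> (C_const r) x (\<beta> n) / \<beta> n)) n) /
     card (partitions_into (dim_nat r) (below n) n)) \<longlonglongrightarrow> exp (- exp (- x))"
    unfolding \<kappa>_def by (rule partitions_max_part_gumbel[OF \<beta>(1,2)])
  moreover have "\<forall>\<^sub>F n in sequentially. card (partitions_into (dim_nat r) (below (gumbel_level \<kappa> (C_const r) x (\<beta> n) / \<beta> n)) n) /
     card (partitions_into (dim_nat r) (below n) n) =
     measure_pmf.prob (P_unif r n)
           {\<rho>. s_seq r n powr (real r * (real r + 1) / 2) * D_max r \<rho>
                 - ln (s_seq r n powr (- real r))
                 + (real r - 1) / (real r + 1) * ln (ln (s_seq r n powr (- real r)))
                 - ln (2 * C_const r / (real r + 1)) \<le> x}"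
    using eventually_ge_at_top[of 1]
  proof eventually_elim
    case (elim n)
    have "2 / (real r * (real r + 1)) * (real r * (real r + 1) / 2) = 1" using assms by auto
    hence s1: "s_seq r n powr (real r * (real r + 1) / 2) = \<beta> n"
      unfolding \<beta>(3)[OF elim] powr_powr using \<beta>(1)[of n] by simp
    have "2 / (real r * (real r + 1)) * (- real r) = - \<kappa>" using assms by (simp add: \<kappa>_def)
    hence s2: "ln (s_seq r n powr (- real r)) = - \<kappa> * ln (\<beta> n)"
      unfolding \<beta>(3)[OF elim] powr_powr using \<beta>(1)[of n] by (simp add: ln_powr)
    have k1: "(real r - 1) / (real r + 1) = 1 - \<kappa>" using assms by (simp add: \<kappa>_def field_simps)
    have k2: "2 * C_const r / (real r + 1) = \<kappa> * C_const r" by (simp add: \<kappa>_def)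
    have "\<beta> n * D - (- \<kappa> * ln (\<beta> n)) + (1 - \<kappa>) * ln (- \<kappa> * ln (\<beta> n)) - ln (\<kappa> * C_const r) \<le> x
        \<longleftrightarrow> D \<le> gumbel_level \<kappa> (C_const r) x (\<beta> n) / \<beta> n" for D
    proof -
      have "D \<le> gumbel_level \<kappa> (C_const r) x (\<beta> n) / \<beta> n \<longleftrightarrow> \<beta> n * D \<le> gumbel_level \<kappa> (C_const r) x (\<beta> n)"
        using \<beta>(1)[of n] by (simp add: le_divide_eq mult.commute)
      thus ?thesis unfolding gumbel_level_def by linarith
    qed
    thus ?case unfolding s1 s2 k1 k2 using prob_D_max_le[OF assms elim] by (simp add: below_def)
  qed
  ultimately show ?thesis by (rule Lim_transform_eventually)
qed

end
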